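(* Let $d\ge 2$ be an integer and let $1<p<p^*$. Then there exists a unique weak solution $\phi\in H^1_{loc}(\mathbb{R})$ of $$\phi''+\left(\frac{e^{2\zeta}}{2}-\frac{p+3}{p-1}+d-1\right)\phi'+\frac{2}{p-1}\left(\frac{p+1}{p-1}-d+1\right)(\phi-\phi^p)=0,\qquad \zeta\in\mathbb{R},$$ such that $\phi-\eta\in H^1(\mathbb{R},d\mu)$ and $0\le\phi\le 1$. Furthermore, $\phi\in C^\infty(\mathbb{R})$, $\phi$ satisfies the equation $$\phi''+\left(\frac{e^{2\zeta}}{2}-\frac{p+3}{p-1}+d-1\right)\phi'+\frac{2}{p-1}\left(\frac{p+1}{p-1}-d+1\right)(\phi-\phi^p)=0,\qquad \zeta\in\mathbb{R},$$ classically, and $0<\phi<1$. In addition, $\phi$ is strictly decreasing, satisfies $$\lim_{\zeta\to-\infty}\phi(\zeta)=1,\quad \lim_{\zeta\to-\infty}\phi'(\zeta)=0,\quad \lim_{\zeta\to+\infty}\phi(\zeta)=0,\quad \lim_{\zeta\to+\infty}\phi'(\zeta)=0,$$ and has the asymptotic behavior $$\phi(\zeta)\sim\exp\left\{-\frac{e^{2\zeta}}{4}+\left(\frac{5-p}{p-1}-d+1\right)\zeta\right\},\qquad \zeta\to+\infty,$$ where $\sim$ means asymptotic equivalence up to a positive multiplicative constant, i.e. the ratio of the two sides tends to some constant in $(0,\infty)$ as $\zeta\to+\infty$.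
   Context: Notation. $p^*=\infty$ if $d=2$ and $p^*=\frac{d}{d-2}$ if $d\ge 3$. $\eta\in C^\infty(\mathbb{R})$ is a fixed function with $\eta'(\zeta)\le 0$ for all $\zeta\in\mathbb{R}$, $\eta(\zeta)=1$ for $\zeta\in(-\infty,0]$, and $\eta(\zeta)=0$ for $\zeta\in[1,+\infty)$. The measure $\mu$ on $\mathbb{R}$ is $d\mu(\zeta)=\rho(\zeta)\,d\zeta$ with $$\rho(\zeta)=\exp\left\{\frac{e^{2\zeta}}{4}-\left(\frac{p+3}{p-1}-d+1\right)\zeta\right\}.$$ The weighted Sobolev space $H^1(\mathbb{R},d\mu)$ is the completion of the family of smooth compactly supported functions on $\mathbb{R}$ with respect to the norm $\|w\|_{H^1(\mathbb{R},d\mu)}^2=\|w_\zeta\|_{L^2(\mathbb{R},d\mu)}^2+\|w\|_{L^2(\mathbb{R},d\mu)}^2$, where $\|w\|_{L^2(\mathbb{R},d\mu)}^2=\int_{\mathbb{R}}w^2(\zeta)\,d\mu(\zeta)$. A weak solution is understood in the usual sense (the equation is tested against functions in $C_c^\infty(\mathbb{R})$, with the second derivative integrated by parts once). *)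

theory Defs
  imports "HOL-Analysis.Analysis"
begin

definition smooth_fun :: "(real \<Rightarrow> real) \<Rightarrow> bool" where
  "smooth_fun f \<longleftrightarrow> (\<forall>k x. (deriv ^^ k) f field_differentiable (at x))"

definition test_fun :: "(real \<Rightarrow> real) \<Rightarrow> bool" where
  "test_fun f \<longleftrightarrow> smooth_fun f \<and> compact (closure {x. f x \<noteq> 0})"

text \<open>Elements of Lebesgue and Sobolev spaces are represented by Borel functions; two functions
  represent the same element iff they agree almost everywhere with respect to \<^term>\<open>lborel\<close>.\<close>

definition L2_loc :: "(real \<Rightarrow> real) set" where
  "L2_loc = {f \<in> borel_measurable borel.
     \<forall>K. compact K \<longrightarrow> set_integrable lborel K (\<lambda>x. (f x)\<^sup>2)}"

definition has_weak_deriv :: "(real \<Rightarrow> real) \<Rightarrow> (real \<Rightarrow> real) \<Rightarrow> bool" where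
  "has_weak_deriv f g \<longleftrightarrow> (\<forall>\<psi>. test_fun \<psi> \<longrightarrow>
     (LINT x|lborel. f x * deriv \<psi> x) = - (LINT x|lborel. g x * \<psi> x))"

definition H1_loc :: "(real \<Rightarrow> real) set" where
  "H1_loc = {f \<in> L2_loc. \<exists>g \<in> L2_loc. has_weak_deriv f g}"

definition L2_norm_on :: "real measure \<Rightarrow> (real \<Rightarrow> real) \<Rightarrow> real" where
  "L2_norm_on M w = sqrt (LINT x|M. (w x)\<^sup>2)"

definition H1_norm_on :: "real measure \<Rightarrow> (real \<Rightarrow> real) \<Rightarrow> real" where
  "H1_norm_on M w = sqrt ((L2_norm_on M (deriv w))\<^sup>2 + (L2_norm_on M w)\<^sup>2)"

text \<open>The completion of the test functions in the norm \<^const>\<open>H1_norm_on\<close>, realised as a space of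
  functions: an element is the \<open>L\<^sup>2\<close>-limit of a sequence of test functions that is Cauchy in this norm.
  If \<open>M\<close> has a continuous positive density with respect to Lebesgue measure, as is the case for
  the measure used below, then the weak derivative of the limit is the \<open>L\<^sup>2\<close>-limit of the
  derivatives, so distinct points of the abstract completion have distinct limits and nothing is
  lost by this identification.\<close>

definition H1_on :: "real measure \<Rightarrow> (real \<Rightarrow> real) set" where
  "H1_on M = {w \<in> borel_measurable borel. integrable M (\<lambda>x. (w x)\<^sup>2) \<and>
     (\<exists>u :: nat \<Rightarrow> real \<Rightarrow> real.
        (\<forall>n. test_fun (u n)) \<and>
        (\<forall>e>0. \<exists>N. \<forall>m\<ge>N. \<forall>n\<ge>N. H1_norm_on M (\<lambda>x. u m x - u n x) < e) \<and>
        (\<lambda>n. L2_norm_on M (\<lambda>x. u n x - w x)) \<longlonglongrightarrow> 0)}"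

definition rho :: "nat \<Rightarrow> real \<Rightarrow> real \<Rightarrow> real" where
  "rho d p \<zeta> = exp (exp (2 * \<zeta>) / 4 - ((p + 3) / (p - 1) - real d + 1) * \<zeta>)"

definition mu :: "nat \<Rightarrow> real \<Rightarrow> real measure" where
  "mu d p = density lborel (\<lambda>\<zeta>. ennreal (rho d p \<zeta>))"

definition p_star :: "nat \<Rightarrow> ereal" where
  "p_star d = (if d = 2 then \<infinity> else ereal (real d / (real d - 2)))"

definition cutoff_fun :: "(real \<Rightarrow> real) \<Rightarrow> bool" where
  "cutoff_fun \<eta> \<longleftrightarrow> smooth_fun \<eta> \<and> (\<forall>\<zeta>. deriv \<eta> \<zeta> \<le> 0) \<and>
     (\<forall>\<zeta>\<le>0. \<eta> \<zeta> = 1) \<and> (\<forall>\<zeta>\<ge>1. \<eta> \<zeta> = 0)"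

definition drift :: "nat \<Rightarrow> real \<Rightarrow> real \<Rightarrow> real" where
  "drift d p \<zeta> = exp (2 * \<zeta>) / 2 - (p + 3) / (p - 1) + real d - 1"

definition reaction :: "nat \<Rightarrow> real \<Rightarrow> real \<Rightarrow> real" where
  "reaction d p s = 2 / (p - 1) * ((p + 1) / (p - 1) - real d + 1) * (s - s powr p)"

text \<open>The power \<^term>\<open>s powr p\<close> is only meaningful for \<^term>\<open>s \<ge> 0\<close>; the solutions below take
  values in the unit interval almost everywhere.\<close>

definition weak_solution :: "nat \<Rightarrow> real \<Rightarrow> (real \<Rightarrow> real) \<Rightarrow> bool" where
  "weak_solution d p \<phi> \<longleftrightarrow> \<phi> \<in> H1_loc \<and>
     (\<exists>g \<in> L2_loc. has_weak_deriv \<phi> g \<and>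
        (\<forall>\<psi>. test_fun \<psi> \<longrightarrow>
           - (LINT \<zeta>|lborel. g \<zeta> * deriv \<psi> \<zeta>)
           + (LINT \<zeta>|lborel. (drift d p \<zeta> * g \<zeta> + reaction d p (\<phi> \<zeta>)) * \<psi> \<zeta>) = 0))"

definition classical_solution :: "nat \<Rightarrow> real \<Rightarrow> (real \<Rightarrow> real) \<Rightarrow> bool" where
  "classical_solution d p \<phi> \<longleftrightarrow>
     (\<forall>\<zeta>. \<phi> field_differentiable (at \<zeta>) \<and> deriv \<phi> field_differentiable (at \<zeta>) \<and>
        deriv (deriv \<phi>) \<zeta> + drift d p \<zeta> * deriv \<phi> \<zeta> + reaction d p (\<phi> \<zeta>) = 0)"

definition admissible_solution :: "nat \<Rightarrow> real \<Rightarrow> (real \<Rightarrow> real) \<Rightarrow> (real \<Rightarrow> real) \<Rightarrow> bool" where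
  "admissible_solution d p \<eta> \<phi> \<longleftrightarrow> weak_solution d p \<phi> \<and>
     (\<lambda>\<zeta>. \<phi> \<zeta> - \<eta> \<zeta>) \<in> H1_on (mu d p) \<and>
     (AE \<zeta> in lborel. 0 \<le> \<phi> \<zeta> \<and> \<phi> \<zeta> \<le> 1)"

end

theory Submission
  imports Defs "HOL-Real_Asymp.Real_Asymp"
begin

text \<open>
  Put \<open>a = (p+3)/(p-1) - d + 1\<close>, \<open>b(x) = e\<^sup>2\<^sup>x/2 - a\<close> (the drift), \<open>r(x) = exp (e\<^sup>2\<^sup>x/4 - a x)\<close> (the density
  of \<open>\<mu>\<close>) and \<open>R(s) = c (s - s\<^sup>p)\<close>. Since \<open>r' = b r\<close>, the equation is \<open>(r \<phi>')' + r R(\<phi>) = 0\<close>; in terms of the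
  flux \<open>v = - r \<phi>'\<close> it is the system \<open>\<phi>' = - v / r\<close>, \<open>v' = r R(\<phi>)\<close>. The bound on \<open>p\<close> is used only through
  \<open>a > 0\<close> and \<open>c > 0\<close>. As \<open>R \<ge> 0\<close> on the unit interval, the flux of every solution with values there
  is nondecreasing, and almost everything rests on this monotonicity.

  Existence is by shooting from \<open>+\<infinity>\<close>. After \<open>R\<close> has been clamped outside \<open>[0,1]\<close> to a bounded Lipschitz function,
  there is for each \<open>M\<close> a global solution with \<open>\<phi> \<rightarrow> 0\<close> and \<open>v \<rightarrow> M\<close> at \<open>+\<infinity>\<close>. It is the fixed point of a
  contraction, and it depends continuously on \<open>M\<close> (\<open>shooting_from_infinity\<close>). For large \<open>M\<close> the function
  \<open>\<phi>\<close> exceeds 1 somewhere, for small \<open>M\<close> the flux becomes negative somewhere. Both conditions are open and they exclude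
  each other, so by connectedness some \<open>M > 0\<close> satisfies neither (\<open>critical_pair_exists\<close>). For this \<open>M\<close>, \<open>\<phi>\<close> decreases
  from 1 to 0 and takes values strictly between them (\<open>profile_exists\<close>, \<open>profile_tendsto_1\<close>). The asymptotic formula follows from
  \<open>\<phi>' = - v / r\<close> and \<open>v \<rightarrow> M\<close> by l'Hospital's rule (\<open>profile_asymptotics\<close>). The bounds \<open>0 < v \<le> M\<close> give enough decay
  at both ends for \<open>\<phi> - \<eta>\<close> to lie in \<open>H\<^sup>1(\<mu>)\<close>.

  For uniqueness, a weak solution first turns out to be a classical one (\<open>weak_second_order_regularity\<close>), and then
  integrability of \<open>r (\<psi> - \<eta>)\<^sup>2\<close> together with \<open>r \<rightarrow> \<infinity>\<close> at both ends forces \<open>\<psi> \<rightarrow> 1\<close> at \<open>-\<infinity>\<close> and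
  \<open>\<psi> \<rightarrow> 0\<close> at \<open>+\<infinity>\<close> (\<open>limits_of_weighted_integrable\<close>). For two solutions with fluxes \<open>w\<^sub>1\<close>, \<open>w\<^sub>2\<close> the weighted
  Wronskian \<open>D = w\<^sub>2 \<phi>\<^sub>1 - w\<^sub>1 \<phi>\<^sub>2\<close> has derivative
  \<open>c r \<phi>\<^sub>1 \<phi>\<^sub>2 (\<phi>\<^sub>1\<^sup>p\<^sup>-\<^sup>1 - \<phi>\<^sub>2\<^sup>p\<^sup>-\<^sup>1)\<close>. Thus \<open>D\<close> would increase strictly across an interval on which \<open>\<phi>\<^sub>1 > \<phi>\<^sub>2\<close>,
  whereas the signs of \<open>(\<phi>\<^sub>1 - \<phi>\<^sub>2)'\<close> at its ends, or \<open>D \<rightarrow> 0\<close> at \<open>\<plusminus>\<infinity>\<close>, force \<open>D \<ge> 0\<close> at the left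
  and \<open>D \<le> 0\<close> at the right (\<open>wronskian_comparison\<close>, \<open>flux_pair_unique\<close>).
\<close>

section \<open>Smooth functions and test functions\<close>

text \<open>Smoothness is coinductive: a set of differentiable functions that is closed under \<^const>\<open>deriv\<close>
  consists of smooth functions. This avoids formulas for higher derivatives.\<close>

lemma smooth_fun_coinduct:
  assumes "f \<in> A" and "\<And>g. g \<in> A \<Longrightarrow> (\<forall>x. g field_differentiable (at x)) \<and> deriv g \<in> A"
  shows "smooth_fun f"
proof -
  have "(deriv ^^ k) f \<in> A" for k
    by (induction k) (use assms in auto)
  then show ?thesis
    using assms(2) unfolding smooth_fun_def by blast
qed

lemma smooth_fun_differentiable: "smooth_fun f \<Longrightarrow> f field_differentiable (at x)"
  unfolding smooth_fun_def by (metis funpow_0)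

lemma smooth_fun_deriv: "smooth_fun f \<Longrightarrow> smooth_fun (deriv f)"
  unfolding smooth_fun_def by (metis comp_apply funpow_Suc_right)

lemma smooth_fun_DERIV: "smooth_fun f \<Longrightarrow> (f has_real_derivative deriv f x) (at x)"
  using smooth_fun_differentiable field_differentiable_derivI by blast

lemma smooth_fun_isCont: "smooth_fun f \<Longrightarrow> isCont f x"
  using smooth_fun_DERIV DERIV_isCont by blast

lemma smooth_fun_continuous_on: "smooth_fun f \<Longrightarrow> continuous_on S f"
  by (simp add: continuous_at_imp_continuous_on smooth_fun_isCont)

lemma smooth_fun_borel: "smooth_fun f \<Longrightarrow> f \<in> borel_measurable borel"
  by (intro borel_measurable_continuous_onI smooth_fun_continuous_on)

lemma smooth_fun_antiderivative:
  assumes "\<And>x. (f has_real_derivative f' x) (at x)" and "smooth_fun f'"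
  shows "smooth_fun f"
proof (rule smooth_fun_coinduct[where A = "insert f {g. smooth_fun g}"])
  have "deriv f = f'"
    using assms(1) by (auto intro!: DERIV_imp_deriv)
  then show "(\<forall>x. g field_differentiable (at x)) \<and> deriv g \<in> insert f {g. smooth_fun g}"
    if "g \<in> insert f {g. smooth_fun g}" for g
    using that assms smooth_fun_deriv smooth_fun_differentiable
    by (auto simp: field_differentiable_def)
qed auto

text \<open>By the sum and product rules, the algebra generated by \<open>S\<close> is closed under differentiation as soon as
  the derivatives of the elements of \<open>S\<close> belong to it.\<close>

inductive_set fun_algebra :: "(real \<Rightarrow> real) set \<Rightarrow> (real \<Rightarrow> real) set" for S where
  generator: "f \<in> S \<Longrightarrow> f \<in> fun_algebra S"
| const: "(\<lambda>x. c) \<in> fun_algebra S"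
| add: "f \<in> fun_algebra S \<Longrightarrow> g \<in> fun_algebra S \<Longrightarrow> (\<lambda>x. f x + g x) \<in> fun_algebra S"
| mult: "f \<in> fun_algebra S \<Longrightarrow> g \<in> fun_algebra S \<Longrightarrow> (\<lambda>x. f x * g x) \<in> fun_algebra S"

lemma smooth_fun_algebra:
  assumes S: "\<And>g. g \<in> S \<Longrightarrow> \<exists>g' \<in> fun_algebra S. \<forall>x. (g has_real_derivative g' x) (at x)"
    and f: "f \<in> fun_algebra S"
  shows "smooth_fun f"
proof (rule smooth_fun_coinduct[OF f])
  fix g assume "g \<in> fun_algebra S"
  then have "\<exists>g' \<in> fun_algebra S. \<forall>x. (g has_real_derivative g' x) (at x)"
  proof induction
    case (generator f) then show ?case by (rule S)
  next
    case (const c)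
    have "((\<lambda>x. c) has_real_derivative 0) (at x)" for x :: real by simp
    then show ?case by (intro bexI[OF _ fun_algebra.const[of 0]]) auto
  next
    case (add f g)
    then obtain f' g' where *: "f' \<in> fun_algebra S" "g' \<in> fun_algebra S"
      "\<And>x. (f has_real_derivative f' x) (at x)" "\<And>x. (g has_real_derivative g' x) (at x)"
      by blast
    then have "((\<lambda>x. f x + g x) has_real_derivative f' x + g' x) (at x)" for x
      by (intro DERIV_add) auto
    with fun_algebra.add[OF *(1,2)] show ?case by (intro bexI[of _ "\<lambda>x. f' x + g' x"]) auto
  next
    case (mult f g)
    then obtain f' g' where *: "f' \<in> fun_algebra S" "g' \<in> fun_algebra S"
      "\<And>x. (f has_real_derivative f' x) (at x)" "\<And>x. (g has_real_derivative g' x) (at x)"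
      by blast
    then have "((\<lambda>x. f x * g x) has_real_derivative f' x * g x + g' x * f x) (at x)" for x
      by (intro DERIV_mult) auto
    moreover have "(\<lambda>x. f' x * g x + g' x * f x) \<in> fun_algebra S"
      using * mult by (intro fun_algebra.add fun_algebra.mult)
    ultimately show ?case by (intro bexI[of _ "\<lambda>x. f' x * g x + g' x * f x"]) auto
  qed
  then obtain g' where g': "g' \<in> fun_algebra S" "\<And>x. (g has_real_derivative g' x) (at x)"
    by blast
  then have "deriv g = g'" by (auto intro!: DERIV_imp_deriv)
  with g' show "(\<forall>x. g field_differentiable (at x)) \<and> deriv g \<in> fun_algebra S"
    by (auto simp: field_differentiable_def)
qed

lemma smooth_fun_algebra_smooth:
  assumes "f \<in> fun_algebra {g. smooth_fun g}"
  shows "smooth_fun f"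
  using assms
  by (rule smooth_fun_algebra[rotated])
     (auto intro: fun_algebra.generator smooth_fun_deriv smooth_fun_DERIV)

lemma smooth_fun_add: "smooth_fun f \<Longrightarrow> smooth_fun g \<Longrightarrow> smooth_fun (\<lambda>x. f x + g x)"
  by (auto intro!: smooth_fun_algebra_smooth fun_algebra.add intro: fun_algebra.generator)

lemma smooth_fun_mult: "smooth_fun f \<Longrightarrow> smooth_fun g \<Longrightarrow> smooth_fun (\<lambda>x. f x * g x)"
  by (auto intro!: smooth_fun_algebra_smooth fun_algebra.mult intro: fun_algebra.generator)

lemma smooth_fun_const: "smooth_fun (\<lambda>x. c)"
  by (intro smooth_fun_algebra_smooth fun_algebra.const)

lemma smooth_fun_diff:
  assumes "smooth_fun f" "smooth_fun g" shows "smooth_fun (\<lambda>x. f x - g x)"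
  using smooth_fun_add[OF assms(1) smooth_fun_mult[OF smooth_fun_const[of "-1"] assms(2)]] by simp

lemma smooth_fun_affine:
  assumes "smooth_fun f"
  shows "smooth_fun (\<lambda>x. f (m * x + b))"
proof -
  let ?S = "{\<lambda>x. g (m * x + b) |g. smooth_fun g}"
  show ?thesis
  proof (rule smooth_fun_algebra[where S = ?S])
    show "(\<lambda>x. f (m * x + b)) \<in> fun_algebra ?S"
      using assms by (auto intro: fun_algebra.generator)
    fix h assume "h \<in> ?S"
    then obtain g where g: "smooth_fun g" "h = (\<lambda>x. g (m * x + b))" by blast
    have "(h has_real_derivative deriv g (m * x + b) * m) (at x)" for x
      unfolding g(2) by (rule DERIV_chain2[OF smooth_fun_DERIV[OF g(1)]])
        (auto intro!: derivative_eq_intros)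
    moreover have "(\<lambda>x. deriv g (m * x + b) * m) \<in> fun_algebra ?S"
      using g(1) smooth_fun_deriv
      by (intro fun_algebra.mult fun_algebra.const) (auto intro: fun_algebra.generator)
    ultimately show "\<exists>g' \<in> fun_algebra ?S. \<forall>x. (h has_real_derivative g' x) (at x)"
      by (intro bexI[of _ "\<lambda>x. deriv g (m * x + b) * m"]) auto
  qed
qed

lemma test_funI:
  assumes "smooth_fun f" and "\<And>x. x \<notin> {A..B} \<Longrightarrow> f x = 0"
  shows "test_fun f"
proof -
  have "closure {x. f x \<noteq> 0} \<subseteq> {A..B}"
    using assms(2) by (intro closure_minimal) force+
  then have "compact (closure {x. f x \<noteq> 0})"
    by (meson bounded_subset bounded_closed_interval closed_closure compact_eq_bounded_closed)
  with assms(1) show ?thesis unfolding test_fun_def by blast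
qed

text \<open>The bound also covers the derivative, so that both factors in an integration by parts vanish
  at the ends of one interval.\<close>

lemma test_fun_support:
  assumes "test_fun f"
  obtains B where "B > 0" "\<And>x. \<bar>x\<bar> \<ge> B \<Longrightarrow> f x = 0" "\<And>x. \<bar>x\<bar> \<ge> B \<Longrightarrow> deriv f x = 0"
proof -
  have "bounded {x. f x \<noteq> 0}"
    using assms unfolding test_fun_def
    by (meson bounded_subset closure_subset compact_imp_bounded)
  then obtain B0 where B0: "\<And>x. f x \<noteq> 0 \<Longrightarrow> \<bar>x\<bar> \<le> B0"
    by (auto simp: bounded_iff)
  define B where "B = \<bar>B0\<bar> + 1"
  have *: "f x = 0" if "\<bar>x\<bar> > \<bar>B0\<bar>" for x
    using B0[of x] that by fastforce
  have "deriv f x = 0" if "\<bar>x\<bar> \<ge> B" for x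
  proof -
    have "eventually (\<lambda>y. \<bar>y\<bar> > \<bar>B0\<bar>) (nhds x)"
      using that by (intro order_tendstoD(1)[of _ "\<bar>x\<bar>"] tendsto_rabs filterlim_ident) (auto simp: B_def)
    then have "eventually (\<lambda>y. f y = 0) (nhds x)"
      by eventually_elim (rule *)
    then have "deriv f x = deriv (\<lambda>_. 0) x" by (intro deriv_cong_ev) auto
    then show ?thesis by simp
  qed
  with * show thesis by (intro that[of B]) (auto simp: B_def)
qed

section \<open>Weak derivatives\<close>

lemma L2_loc_borel: "f \<in> L2_loc \<Longrightarrow> f \<in> borel_measurable borel"
  by (simp add: L2_loc_def)

lemma L2_loc_set_integrable:
  assumes "f \<in> L2_loc"
  shows "set_integrable lborel {a..b} f"
proof (rule set_integrable_bound)
  have sq: "set_integrable lborel {a..b} (\<lambda>x. (f x)\<^sup>2)"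
    using assms by (auto simp: L2_loc_def)
  have "set_integrable lborel {a..b} (\<lambda>x. 1 :: real)"
    by (intro borel_integrable_atLeastAtMost' continuous_intros)
  then show "set_integrable lborel {a..b} (\<lambda>x. 1 + (f x)\<^sup>2)"
    using sq by (rule set_integral_add)
  show "set_borel_measurable lborel {a..b} f"
    using L2_loc_borel[OF assms] unfolding set_borel_measurable_def by measurable
  have "\<bar>f x\<bar> \<le> 1 + (f x)\<^sup>2" for x
    using sum_power2_ge_zero[of "\<bar>f x\<bar> - 1" 0] zero_le_power2[of "f x"]
    by (simp add: power2_eq_square algebra_simps abs_if split: if_splits)
  then show "AE x in lborel. x \<in> {a..b} \<longrightarrow> norm (f x) \<le> norm (1 + (f x)\<^sup>2)"
    by (intro always_eventually) (simp add: abs_of_nonneg)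
qed

lemma continuous_L2_loc:
  assumes "continuous_on UNIV f" shows "f \<in> L2_loc"
proof -
  have "set_integrable lborel K (\<lambda>x. (f x)\<^sup>2)" if "compact K" for K
    unfolding set_integrable_def using that assms
    by (intro borel_integrable_compact continuous_intros) (auto intro: continuous_on_subset)
  then show ?thesis
    using assms by (auto simp: L2_loc_def intro: borel_measurable_continuous_onI)
qed

lemma LBINT_mult_limit:
  fixes f :: "real \<Rightarrow> real" and h :: "nat \<Rightarrow> real \<Rightarrow> real"
  assumes f: "f \<in> borel_measurable borel" "set_integrable lborel {a..b} f"
    and h: "\<And>n. h n \<in> borel_measurable borel" "\<And>n x. \<bar>h n x\<bar> \<le> B * indicator {a..b} x"
    and lim: "\<And>x. (\<lambda>n. h n x) \<longlonglongrightarrow> h' x"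
  shows "(\<lambda>n. LINT x|lborel. f x * h n x) \<longlonglongrightarrow> (LINT x|lborel. f x * h' x)"
proof -
  have h': "h' \<in> borel_measurable borel"
    using h(1) lim by (rule borel_measurable_LIMSEQ_metric)
  have dom: "integrable lborel (\<lambda>x. B * \<bar>indicator {a..b} x *\<^sub>R f x\<bar>)"
    using f(2) unfolding set_integrable_def by (intro integrable_mult_right integrable_abs)
  have bound: "norm (f x * h n x) \<le> B * \<bar>indicator {a..b} x *\<^sub>R f x\<bar>" for n x
    using mult_left_mono[OF h(2)[of n x], of "\<bar>f x\<bar>"] by (cases "x \<in> {a..b}") (auto simp: abs_mult mult_ac)
  have lim': "(\<lambda>n. f x * h n x) \<longlonglongrightarrow> f x * h' x" for x
    by (intro tendsto_intros lim)
  show "(\<lambda>n. LINT x|lborel. f x * h n x) \<longlonglongrightarrow> (LINT x|lborel. f x * h' x)"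
    by (rule integral_dominated_convergence[OF _ _ dom])
       (use f(1) h(1) h' bound lim' in \<open>auto intro!: always_eventually\<close>)
qed

lemma C1_has_weak_deriv:
  assumes u: "\<And>x. (u has_real_derivative u' x) (at x)" and u': "continuous_on UNIV u'"
  shows "has_weak_deriv u u'"
  unfolding has_weak_deriv_def
proof safe
  fix \<psi> assume \<psi>: "test_fun \<psi>"
  then obtain B where B: "B > 0" "\<And>x. \<bar>x\<bar> \<ge> B \<Longrightarrow> \<psi> x = 0" "\<And>x. \<bar>x\<bar> \<ge> B \<Longrightarrow> deriv \<psi> x = 0"
    using test_fun_support by metis
  have sm: "smooth_fun \<psi>" using \<psi> by (simp add: test_fun_def)
  have "(LINT x|lborel. (u x * deriv \<psi> x) * indicator {-B..B} x) =
      u B * \<psi> B - u (-B) * \<psi> (-B) - (LINT x|lborel. (u' x * \<psi> x) * indicator {-B..B} x)"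
    using B(1) u u' sm smooth_fun_deriv[OF sm]
    by (intro integral_by_parts)
       (auto intro: smooth_fun_isCont smooth_fun_DERIV simp: continuous_on_eq_continuous_at)
  moreover have "(u x * deriv \<psi> x) * indicator {-B..B} x = u x * deriv \<psi> x"
    "(u' x * \<psi> x) * indicator {-B..B} x = u' x * \<psi> x" for x
    using B(2,3)[of x] by (cases "x \<in> {-B..B}"; force)+
  ultimately show "(LINT x|lborel. u x * deriv \<psi> x) = - (LINT x|lborel. u' x * \<psi> x)"
    using B by simp
qed

lemma continuous_antiderivative:
  fixes f :: "real \<Rightarrow> real"
  assumes f: "continuous_on UNIV f"
  shows "((\<lambda>x :: real. LBINT y=ereal c..ereal x. f y) has_real_derivative f x) (at x)"
proof -
  let ?A = "min c x - 1" and ?B = "max c x + 1"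
  have "((\<lambda>u :: real. LBINT y=ereal c..ereal u. f y) has_vector_derivative f x) (at x within {?A..?B})"
    by (intro interval_integral_FTC2 continuous_on_subset[OF f]) auto
  moreover have "at x within {?A..?B} = at x"
    by (rule at_within_Icc_at) auto
  ultimately show ?thesis by (simp add: has_real_derivative_iff_has_vector_derivative)
qed

text \<open>The given cutoff \<open>\<eta>\<close> is the only bump function needed below: rescaled copies of it serve as
  approximate step functions and as truncations.\<close>

lemma cutoff_fun_range:
  assumes "cutoff_fun \<eta>" shows "0 \<le> \<eta> x" "\<eta> x \<le> 1"
proof -
  have anti: "\<eta> y \<le> \<eta> x" if "x \<le> y" for x y
    using assms that unfolding cutoff_fun_def
    by (intro DERIV_nonpos_imp_nonincreasing[OF that]) (auto intro: smooth_fun_DERIV)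
  show "0 \<le> \<eta> x" "\<eta> x \<le> 1"
    using anti[of x "max x 1"] anti[of "min x 0" x] assms by (auto simp: cutoff_fun_def)
qed

text \<open>Testing the weak derivative with the trapezoid \<open>T\<close>, whose derivative is the difference of the indicator functions
  of \<open>[u, u + \<delta>]\<close> and \<open>[w, w + \<delta>]\<close>, compares the averages of \<open>f\<close> over two short intervals. The trapezoid is not
  smooth, but it is the limit of combinations of antiderivatives of \<open>x \<mapsto> \<eta> (m x)\<close>; these combinations have compact support,
  because the linear parts on the left and the constant parts on the right cancel.\<close>

lemma weak_deriv_trapezoid:
  assumes \<eta>: "cutoff_fun \<eta>" and f: "f \<in> L2_loc" and k: "k \<in> L2_loc" and wd: "has_weak_deriv f k"
    and "\<delta> > 0" "u < w"
  defines "T \<equiv> \<lambda>x. min (x - w) 0 - min (x - w - \<delta>) 0 - (min (x - u) 0 - min (x - u - \<delta>) 0)"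
  shows "(LINT x:{w..w+\<delta>}|lborel. f x) - (LINT x:{u..u+\<delta>}|lborel. f x)
    = (LINT x|lborel. k x * T x)"
proof -
  have sm: "smooth_fun \<eta>" and \<eta>1: "\<And>x. x \<le> 0 \<Longrightarrow> \<eta> x = 1" and \<eta>0: "\<And>x. x \<ge> 1 \<Longrightarrow> \<eta> x = 0"
    using \<eta> by (auto simp: cutoff_fun_def)
  \<comment> \<open>\<open>Q (m x) / m\<close> is a smooth approximation of \<open>min x 0\<close> with error at most \<open>1 / m\<close>\<close>
  define Q where "Q x = (LBINT y=ereal 0..ereal x. \<eta> y)" for x
  have Q': "(Q has_real_derivative \<eta> x) (at x)" for x
    unfolding Q_def using continuous_antiderivative[of \<eta> 0 x] smooth_fun_continuous_on[OF sm] by simp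
  have Q0: "Q 0 = 0" by (simp add: Q_def zero_ereal_def[symmetric])
  have Qneg: "Q x = x" if x: "x \<le> 0" for x
  proof (cases "x = 0")
    case False
    then obtain z where "x < z" "z < 0" "Q 0 - Q x = (0 - x) * \<eta> z"
      using MVT2[of x 0 Q \<eta>] Q' x by force
    then show ?thesis using \<eta>1[of z] Q0 by simp
  qed (simp add: Q0)
  have Qpos: "Q x = Q 1" if x: "x \<ge> 1" for x
  proof (cases "x = 1")
    case False
    then obtain z where "1 < z" "z < x" "Q x - Q 1 = (x - 1) * \<eta> z"
      using MVT2[of 1 x Q \<eta>] Q' x by force
    then show ?thesis using \<eta>0[of z] by simp
  qed simp
  have Qmid: "0 \<le> Q x \<and> Q x \<le> 1" if x: "0 \<le> x" "x \<le> 1" for x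
  proof (cases "x = 0")
    case False
    then obtain z where z: "0 < z" "z < x" "Q x - Q 0 = (x - 0) * \<eta> z"
      using MVT2[of 0 x Q \<eta>] Q' x by force
    then show ?thesis using cutoff_fun_range[OF \<eta>, of z] that Q0
      by (auto intro: mult_le_one)
  qed (simp add: Q0)
  have Qmin: "\<bar>Q x - min x 0\<bar> \<le> 1" for x
    using Qneg[of x] Qpos[of x] Qmid[of x] Qmid[of 1]
    by (cases "x \<le> 0"; cases "x \<le> 1") auto
  define m where "m n = real (Suc n)" for n
  have m: "m n \<ge> 1" for n by (simp add: m_def)
  define P where "P n x = Q (m n * x) / m n" for n x
  have Pmin: "\<bar>P n x - min x 0\<bar> \<le> 1 / m n" for n x
  proof -
    have "P n x - min x 0 = (Q (m n * x) - min (m n * x) 0) / m n"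
      using m[of n] by (auto simp: P_def min_def field_simps mult_le_0_iff)
    then show ?thesis using Qmin[of "m n * x"] m[of n] by (simp add: divide_right_mono)
  qed
  have P': "(P n has_real_derivative \<eta> (m n * x)) (at x)" for n x
  proof -
    have "((\<lambda>x. Q (m n * x)) has_real_derivative \<eta> (m n * x) * m n) (at x)"
      using DERIV_chain2[of Q "\<eta> (m n * x)" "\<lambda>x. m n * x" x "m n" UNIV] Q'
      by (auto intro!: derivative_eq_intros)
    from DERIV_cdivide[OF this, of "m n"] show ?thesis
      unfolding P_def using m[of n] by simp
  qed
  have P'_shift: "((\<lambda>x. P n (x - c)) has_real_derivative \<eta> (m n * (x - c))) (at x)" for n c x
  proof -
    have "((\<lambda>x :: real. x - c) has_real_derivative 1) (at x)"
      by (auto intro!: derivative_eq_intros)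
    with P'[of n "x - c"] show ?thesis
      using DERIV_chain2[of "P n" "\<eta> (m n * (x - c))" "\<lambda>x. x - c" x 1 UNIV] by simp
  qed
  have smP: "smooth_fun (\<lambda>x. P n (x - c))" for n c
  proof -
    have "m n * x + - m n * c = m n * (x - c)" for x
      by (simp add: right_diff_distrib)
    then have "smooth_fun (\<lambda>x. \<eta> (m n * (x - c)))"
      using smooth_fun_affine[OF sm, of "m n" "- m n * c"] by simp
    with P'_shift show ?thesis by (rule smooth_fun_antiderivative)
  qed
  have Pneg: "P n x = x" if "x \<le> 0" for n x
    using that m[of n] by (simp add: P_def Qneg mult_nonneg_nonpos)
  have Ppos: "P n x = Q 1 / m n" if "x \<ge> 1" for n x
    using that m[of n] mult_mono[of 1 "m n" 1 x] Qpos[of "m n * x"] by (simp add: P_def)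
  define h where "h n x = P n (x - w) - P n (x - (w + \<delta>)) - (P n (x - u) - P n (x - (u + \<delta>)))" for n x
  define h' where "h' n x = \<eta> (m n * (x - w)) - \<eta> (m n * (x - (w + \<delta>)))
     - (\<eta> (m n * (x - u)) - \<eta> (m n * (x - (u + \<delta>))))" for n x
  have smh: "smooth_fun (h n)" for n
    unfolding h_def by (intro smooth_fun_diff smP)
  have dh: "deriv (h n) = h' n" for n
    unfolding h_def h'_def
    by (rule ext, rule DERIV_imp_deriv) (intro DERIV_diff P'_shift)
  let ?I = "{u..w+\<delta>+1}"
  have hsupp: "h n x = 0" if "x \<notin> ?I" for n x
    using that \<open>\<delta> > 0\<close> \<open>u < w\<close> by (cases "x < u") (auto simp: h_def Pneg Ppos)
  then have test: "test_fun (h n)" for n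
    by (intro test_funI smh)
  have "(LINT x|lborel. f x * h' n x) = - (LINT x|lborel. k x * h n x)" for n
    using wd test[of n] dh[of n] unfolding has_weak_deriv_def by metis
  moreover have "(\<lambda>n. LINT x|lborel. k x * h n x) \<longlonglongrightarrow> (LINT x|lborel. k x * T x)"
  proof (rule LBINT_mult_limit[OF L2_loc_borel[OF k] L2_loc_set_integrable[OF k]])
    have close: "\<bar>h n x - T x\<bar> \<le> 4 / m n" for n x
    proof -
      have four: "\<bar>(a - a') - (b - b') - ((c - c') - (d - d'))\<bar> \<le> 4 / r"
        if "\<bar>a - a'\<bar> \<le> 1 / r" "\<bar>b - b'\<bar> \<le> 1 / r" "\<bar>c - c'\<bar> \<le> 1 / r" "\<bar>d - d'\<bar> \<le> 1 / r"
        for a a' b b' c c' d d' r :: real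
        using that by linarith
      have "h n x - T x = (P n (x - w) - min (x - w) 0) - (P n (x - (w + \<delta>)) - min (x - (w + \<delta>)) 0)
          - ((P n (x - u) - min (x - u) 0) - (P n (x - (u + \<delta>)) - min (x - (u + \<delta>)) 0))"
        unfolding h_def T_def diff_diff_add by (simp only: algebra_simps)
      then show ?thesis by (simp only:) (intro four Pmin)
    qed
    show "h n \<in> borel_measurable borel" for n by (rule smooth_fun_borel[OF smh])
    show "\<bar>h n x\<bar> \<le> (\<delta> + 4) * indicator ?I x" for n x
    proof (cases "x \<in> ?I")
      case True
      have "\<bar>T x\<bar> \<le> \<delta>" using \<open>\<delta> > 0\<close> unfolding T_def by linarith
      moreover have "4 / m n \<le> 4" using m[of n] by (simp add: field_simps)
      ultimately show ?thesis using close[of n x] True by simp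
    qed (simp add: hsupp)
    show "(\<lambda>n. h n x) \<longlonglongrightarrow> T x" for x
    proof (rule LIM_zero_cancel, rule Lim_null_comparison)
      show "\<forall>\<^sub>F n in sequentially. norm (h n x - T x) \<le> 4 / m n"
        using close by simp
      show "(\<lambda>n. 4 / m n) \<longlonglongrightarrow> 0" unfolding m_def by real_asymp
    qed
  qed
  moreover have "(\<lambda>n. LINT x|lborel. f x * h' n x) \<longlonglongrightarrow>
      (LINT x|lborel. f x * (indicator {u<..u+\<delta>} x - indicator {w<..w+\<delta>} x))"
  proof (rule LBINT_mult_limit[OF L2_loc_borel[OF f] L2_loc_set_integrable[OF f]])
    show "h' n \<in> borel_measurable borel" for n
      using smooth_fun_borel[OF smooth_fun_deriv[OF smh[of n]]] dh by simp
    show "\<bar>h' n x\<bar> \<le> 2 * indicator ?I x" for n x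
    proof (cases "x \<in> ?I")
      case True
      then show ?thesis
        using cutoff_fun_range[OF \<eta>, of "m n * (x - w)"] cutoff_fun_range[OF \<eta>, of "m n * (x - (w + \<delta>))"]
          cutoff_fun_range[OF \<eta>, of "m n * (x - u)"] cutoff_fun_range[OF \<eta>, of "m n * (x - (u + \<delta>))"]
        by (simp add: h'_def)
    next
      case False
      have e0: "\<eta> (m n * y) = 0" if "y \<ge> 1" for y
        using that m[of n] mult_mono[of 1 "m n" 1 y] by (simp add: \<eta>0)
      have e1: "\<eta> (m n * y) = 1" if "y \<le> 0" for y
        using that m[of n] by (simp add: \<eta>1 mult_nonneg_nonpos)
      show ?thesis
        using False \<open>\<delta> > 0\<close> \<open>u < w\<close> by (cases "x < u") (auto simp: h'_def e0 e1)
    qed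
    have step: "(\<lambda>n. \<eta> (m n * y)) \<longlonglongrightarrow> indicator {..0} y" for y
    proof (cases "y \<le> 0")
      case True
      then have "\<eta> (m n * y) = indicator {..0} y" for n
        using m[of n] by (simp add: \<eta>1 mult_nonneg_nonpos)
      then show ?thesis by simp
    next
      case False
      then have "filterlim (\<lambda>n. m n * y) at_top sequentially"
        unfolding m_def by real_asymp
      then have "\<forall>\<^sub>F n in sequentially. m n * y \<ge> 1"
        by (simp add: filterlim_at_top)
      then have "\<forall>\<^sub>F n in sequentially. \<eta> (m n * y) = indicator {..0} y"
        by eventually_elim (use False in \<open>simp add: \<eta>0\<close>)
      then show ?thesis by (rule tendsto_eventually)
    qed
    have "indicator {u<..u+\<delta>} x - indicator {w<..w+\<delta>} x = (indicator {..0} (x - w) - indicator {..0} (x - (w+\<delta>))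
        - (indicator {..0} (x - u) - indicator {..0} (x - (u+\<delta>))) :: real)" for x
      using \<open>\<delta> > 0\<close> \<open>u < w\<close> by (auto simp: indicator_def)
    then show "(\<lambda>n. h' n x) \<longlonglongrightarrow> indicator {u<..u+\<delta>} x - indicator {w<..w+\<delta>} x" for x
      unfolding h'_def by (simp only:) (intro tendsto_diff step)
  qed
  ultimately have "(\<lambda>n. - (LINT x|lborel. k x * h n x)) \<longlonglongrightarrow>
      (LINT x|lborel. f x * (indicator {u<..u+\<delta>} x - indicator {w<..w+\<delta>} x))"
    "(\<lambda>n. - (LINT x|lborel. k x * h n x)) \<longlonglongrightarrow> - (LINT x|lborel. k x * T x)"
    by (simp, intro tendsto_minus)
  then have eq: "(LINT x|lborel. f x * (indicator {u<..u+\<delta>} x - indicator {w<..w+\<delta>} x))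
      = - (LINT x|lborel. k x * T x)"
    by (rule LIMSEQ_unique)
  have int: "integrable lborel (\<lambda>x. f x * indicator {c<..c+\<delta>} x)" for c
  proof -
    have "set_integrable lborel {c<..c+\<delta>} f"
      by (rule set_integrable_subset[OF L2_loc_set_integrable[OF f, of c "c+\<delta>"]]) auto
    then show ?thesis unfolding set_integrable_def by (simp add: mult.commute)
  qed
  have "(LINT x|lborel. f x * indicator {c<..c+\<delta>} x) = (LINT x:{c..c+\<delta>}|lborel. f x)" for c
  proof -
    have "(LINT x|lborel. f x * indicator {c<..c+\<delta>} x) = (LINT x:{c<..c+\<delta>}|lborel. f x)"
      unfolding set_lebesgue_integral_def by (simp add: mult.commute)
    also have "\<dots> = (LINT x:{c..c+\<delta>}|lborel. f x)"
      using \<open>\<delta> > 0\<close> interval_integral_Ioc[of c "c+\<delta>" f] interval_integral_Icc[of c "c+\<delta>" f] by simp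
    finally show ?thesis .
  qed
  with eq int show ?thesis
    by (simp add: right_diff_distrib)
qed

text \<open>Dividing by \<open>\<delta>\<close> and letting \<open>\<delta> \<rightarrow> 0\<close>, the averages converge to \<open>f\<close> at the Lebesgue points of \<open>f\<close>,
  and \<open>T / \<delta>\<close> converges to the indicator function of \<open>(u, w]\<close>.\<close>

lemma weak_deriv_increment:
  assumes \<eta>: "cutoff_fun \<eta>" and f: "f \<in> L2_loc" and k: "k \<in> L2_loc" and wd: "has_weak_deriv f k"
  obtains N where "negligible N"
    "\<And>u w. u \<notin> N \<Longrightarrow> w \<notin> N \<Longrightarrow> u < w \<Longrightarrow> f w - f u = (LINT x:{u<..w}|lborel. k x)"
proof -
  have HK: "f integrable_on {a..b}" "(LINT x:{a..b}|lborel. f x) = integral {a..b} f" for a b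
    using set_borel_integral_eq_integral[OF L2_loc_set_integrable[OF f]] by auto
  obtain N where N: "negligible N" and
    leb: "\<And>x e. \<lbrakk>x \<notin> N; 0 < e\<rbrakk> \<Longrightarrow> \<exists>d>0. \<forall>h. 0 < h \<and> h < d \<longrightarrow>
        norm (integral (cbox x (x + h *\<^sub>R One)) f /\<^sub>R h ^ DIM(real) - f x) < e"
    using integrable_ccontinuous_explicit[of f] HK by auto
  define \<delta> where "\<delta> n = 1 / real (Suc n)" for n
  have \<delta>: "\<delta> n > 0" "\<delta> n \<le> 1" for n by (auto simp: \<delta>_def)
  have \<delta>0: "\<delta> \<longlonglongrightarrow> 0" unfolding \<delta>_def by real_asymp
  have avg: "(\<lambda>n. (LINT x:{c..c+\<delta> n}|lborel. f x) / \<delta> n) \<longlonglongrightarrow> f c" if c: "c \<notin> N" for c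
  proof (rule LIMSEQ_I)
    fix e :: real assume "e > 0"
    then obtain d where d: "d > 0" "\<And>h. 0 < h \<Longrightarrow> h < d \<Longrightarrow> \<bar>integral {c..c+h} f / h - f c\<bar> < e"
      using leb[of c e] c by (auto simp: divide_inverse_commute)
    from \<delta>0 d(1) obtain n0 where "\<And>n. n \<ge> n0 \<Longrightarrow> \<delta> n < d"
      by (metis eventually_sequentially order_tendstoD(2))
    then show "\<exists>n0. \<forall>n\<ge>n0. norm ((LINT x:{c..c+\<delta> n}|lborel. f x) / \<delta> n - f c) < e"
      using d(2) \<delta>(1) HK(2) by auto
  qed
  have "f w - f u = (LINT x:{u<..w}|lborel. k x)" if "u \<notin> N" "w \<notin> N" "u < w" for u w
  proof -
    define T where "T n x = (min (x - w) 0 - min (x - w - \<delta> n) 0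
        - (min (x - u) 0 - min (x - u - \<delta> n) 0)) / \<delta> n" for n x
    have "(LINT x:{w..w+\<delta> n}|lborel. f x) / \<delta> n - (LINT x:{u..u+\<delta> n}|lborel. f x) / \<delta> n
        = (LINT x|lborel. k x * T n x)" for n
      using arg_cong[OF weak_deriv_trapezoid[OF \<eta> f k wd \<delta>(1)[of n] \<open>u < w\<close>], of "\<lambda>x. x / \<delta> n"]
      by (simp add: T_def diff_divide_distrib flip: integral_divide_zero times_divide_eq_right)
    moreover have "(\<lambda>n. LINT x|lborel. k x * T n x) \<longlonglongrightarrow> (LINT x|lborel. k x * indicator {u<..w} x)"
    proof (rule LBINT_mult_limit[OF L2_loc_borel[OF k] L2_loc_set_integrable[OF k]])
      show "T n \<in> borel_measurable borel" for n
        unfolding T_def using \<delta>(1)[of n]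
        by (intro borel_measurable_continuous_onI continuous_intros) auto
      show "\<bar>T n x\<bar> \<le> 1 * indicator {u..w+1} x" for n x
      proof (cases "x \<in> {u..w+1}")
        case True
        have "\<bar>min (x - w) 0 - min (x - w - \<delta> n) 0 - (min (x - u) 0 - min (x - u - \<delta> n) 0)\<bar> \<le> \<delta> n"
          using \<delta>(1)[of n] by linarith
        then show ?thesis using True \<delta>(1)[of n] by (simp add: T_def)
      next
        case False
        then show ?thesis using \<delta>[of n] \<open>u < w\<close> by (auto simp: T_def)
      qed
      show "(\<lambda>n. T n x) \<longlonglongrightarrow> indicator {u<..w} x" for x
      proof (rule tendsto_eventually)
        have "\<forall>\<^sub>F n in sequentially. \<delta> n < (if x > w then x - w else if x > u then x - u else 1)"
          using \<delta>0 by (rule order_tendstoD(2)) auto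
        then show "\<forall>\<^sub>F n in sequentially. T n x = indicator {u<..w} x"
        proof eventually_elim
          case (elim n)
          then show ?case using \<delta>[of n] \<open>u < w\<close>
            by (auto simp: T_def indicator_def split: if_splits)
        qed
      qed
    qed
    moreover have "(\<lambda>n. (LINT x:{w..w+\<delta> n}|lborel. f x) / \<delta> n - (LINT x:{u..u+\<delta> n}|lborel. f x) / \<delta> n)
        \<longlonglongrightarrow> f w - f u"
      by (intro tendsto_diff avg that)
    ultimately have "f w - f u = (LINT x|lborel. k x * indicator {u<..w} x)"
      using LIMSEQ_unique by simp
    then show ?thesis by (simp add: set_lebesgue_integral_def mult.commute)
  qed
  with N that show thesis by blast
qed

lemma weak_deriv_AE_interval_integral:
  assumes \<eta>: "cutoff_fun \<eta>" and f: "f \<in> L2_loc" and k: "k \<in> L2_loc" and wd: "has_weak_deriv f k"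
  obtains c C where "AE x in lborel. f x = C + (LBINT y=ereal c..ereal x. k y)"
proof -
  obtain N where N: "negligible N"
    "\<And>u w. u \<notin> N \<Longrightarrow> w \<notin> N \<Longrightarrow> u < w \<Longrightarrow> f w - f u = (LINT x:{u<..w}|lborel. k x)"
    using weak_deriv_increment[OF assms] by metis
  have "N \<noteq> UNIV" using N(1) by auto
  then obtain c where c: "c \<notin> N" by blast
  have "f x = f c + (LBINT y=ereal c..ereal x. k y)" if x: "x \<notin> N" for x
  proof (rule linorder_cases[of c x])
    assume "c < x"
    then show ?thesis using N(2)[OF c x] by (simp add: interval_integral_Ioc)
  next
    assume "x < c"
    then show ?thesis using N(2)[OF x c] by (simp add: interval_integral_Ioc interval_integral_endpoints_reverse[of c x])
  qed simp
  moreover have "AE x in lborel. x \<notin> N"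
    using N(1) negligible_iff_null_sets[of N] AE_not_in[of N lebesgue] by (simp add: AE_completion_iff)
  ultimately have "AE x in lborel. f x = f c + (LBINT y=ereal c..ereal x. k y)"
    by (auto elim: eventually_mono)
  then show thesis by (rule that)
qed

section \<open>Regularity of weak solutions\<close>

lemma power2_sum_le: "(s + t)\<^sup>2 \<le> 2 * s\<^sup>2 + 2 * t\<^sup>2" for s t :: real
  using sum_squares_bound[of s t] by (simp add: power2_sum)

lemma L2_loc_add:
  assumes f: "f \<in> L2_loc" and g: "g \<in> L2_loc" shows "(\<lambda>x. f x + g x) \<in> L2_loc"
proof -
  have [measurable]: "f \<in> borel_measurable borel" "g \<in> borel_measurable borel"
    using assms by (auto intro: L2_loc_borel)
  have "set_integrable lborel K (\<lambda>x. (f x + g x)\<^sup>2)" if K: "compact K" for K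
  proof (rule set_integrable_bound)
    show "set_integrable lborel K (\<lambda>x. 2 * (f x)\<^sup>2 + 2 * (g x)\<^sup>2)"
      using f g K by (intro set_integral_add set_integrable_mult_right) (auto simp: L2_loc_def)
    have [measurable]: "K \<in> sets borel" using K by (intro borel_closed compact_imp_closed)
    show "set_borel_measurable lborel K (\<lambda>x. (f x + g x)\<^sup>2)"
      unfolding set_borel_measurable_def by measurable
    show "AE x in lborel. x \<in> K \<longrightarrow> norm ((f x + g x)\<^sup>2) \<le> norm (2 * (f x)\<^sup>2 + 2 * (g x)\<^sup>2)"
      using power2_sum_le by (intro always_eventually) simp
  qed
  then show ?thesis by (simp add: L2_loc_def)
qed

lemma L2_loc_mult_bounded:
  assumes f: "f \<in> L2_loc" and h: "h \<in> borel_measurable borel" "\<And>K. compact K \<Longrightarrow> \<exists>B. \<forall>x\<in>K. \<bar>h x\<bar> \<le> B"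
  shows "(\<lambda>x. h x * f x) \<in> L2_loc"
proof -
  have [measurable]: "f \<in> borel_measurable borel" "h \<in> borel_measurable borel"
    using assms by (auto intro: L2_loc_borel)
  have "set_integrable lborel K (\<lambda>x. (h x * f x)\<^sup>2)" if K: "compact K" for K
  proof -
    obtain B where B: "\<forall>x\<in>K. \<bar>h x\<bar> \<le> B" using h(2)[OF K] by blast
    show ?thesis
    proof (rule set_integrable_bound)
      show "set_integrable lborel K (\<lambda>x. B\<^sup>2 * (f x)\<^sup>2)"
        using f K by (intro set_integrable_mult_right) (auto simp: L2_loc_def)
      have [measurable]: "K \<in> sets borel" using K by (intro borel_closed compact_imp_closed)
      show "set_borel_measurable lborel K (\<lambda>x. (h x * f x)\<^sup>2)"
        unfolding set_borel_measurable_def by measurable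
      have "(h x)\<^sup>2 \<le> B\<^sup>2" if "x \<in> K" for x
        using B that by (intro power2_le_iff_abs_le[THEN iffD2]) (auto intro: order_trans[OF abs_ge_zero])
      then show "AE x in lborel. x \<in> K \<longrightarrow> norm ((h x * f x)\<^sup>2) \<le> norm (B\<^sup>2 * (f x)\<^sup>2)"
        by (intro always_eventually) (simp add: power_mult_distrib mult_right_mono)
    qed
  qed
  then show ?thesis by (simp add: L2_loc_def)
qed

lemma continuous_mult_L2_loc:
  assumes "f \<in> L2_loc" and h: "continuous_on UNIV h"
  shows "(\<lambda>x. h x * f x) \<in> L2_loc"
proof (rule L2_loc_mult_bounded[OF assms(1) borel_measurable_continuous_onI[OF h]])
  fix K :: "real set" assume "compact K"
  then have "bounded (h ` K)"
    using h by (intro compact_imp_bounded compact_continuous_image) (auto intro: continuous_on_subset)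
  then show "\<exists>B. \<forall>x\<in>K. \<bar>h x\<bar> \<le> B" by (auto simp: bounded_iff)
qed

lemma bounded_L2_loc:
  assumes "h \<in> borel_measurable borel" "\<And>x. \<bar>h x\<bar> \<le> B" shows "h \<in> L2_loc"
  using L2_loc_mult_bounded[OF continuous_L2_loc[OF continuous_on_const, of 1] assms(1)] assms(2) by auto

lemma interval_integral_continuous:
  fixes k :: "real \<Rightarrow> real"
  assumes k: "\<And>a b. set_integrable lborel {a..b} k"
  shows "continuous_on UNIV (\<lambda>x. LBINT y=ereal c..ereal x. k y)"
proof -
  have "isCont (\<lambda>x. LBINT y=ereal c..ereal x. k y) x0" for x0
  proof -
    define A where "A = min c x0 - 1"
    define B where "B = max c x0 + 1"
    have AB: "A < c" "c < B" "A < x0" "x0 < B" by (auto simp: A_def B_def)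
    have HK: "(LBINT y=ereal A..ereal x. k y) = integral {A..x} k" if "A \<le> x" for x
      using that set_borel_integral_eq_integral(2)[OF k] by (simp add: interval_integral_Icc)
    have "continuous_on {A..B} (\<lambda>x. integral {A..x} k)"
      by (rule indefinite_integral_continuous_1) (rule set_borel_integral_eq_integral(1)[OF k])
    then have c1: "continuous_on {A..B} (\<lambda>x. integral {A..x} k - integral {A..c} k)"
      by (intro continuous_on_diff continuous_on_const)
    have e1: "(LBINT y=ereal c..ereal x. k y) = integral {A..x} k - integral {A..c} k" if "x \<in> {A..B}" for x
    proof -
      have "interval_lebesgue_integrable lborel (min (ereal A) (min (ereal c) (ereal x))) (max (ereal A) (max (ereal c) (ereal x))) k"
        using AB that by (auto simp: interval_lebesgue_integrable_def min_def max_def intro!: set_integrable_subset[OF k[of A B]])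
      from interval_integral_sum[OF this] show ?thesis
        using HK[of c] HK[of x] AB that by simp
    qed
    have "continuous_on {A..B} (\<lambda>x. LBINT y=ereal c..ereal x. k y)"
      by (rule continuous_on_eq[OF c1]) (simp add: e1)
    then show ?thesis
      using AB by (intro continuous_on_interior[where S = "{A..B}"]) auto
  qed
  then show ?thesis by (simp add: continuous_at_imp_continuous_on)
qed

lemma AE_continuous_nonneg:
  fixes f :: "real \<Rightarrow> real"
  assumes f: "continuous_on UNIV f" and ae: "AE x in lborel. 0 \<le> f x"
  shows "0 \<le> f x"
proof (rule ccontr)
  assume "\<not> 0 \<le> f x"
  then have ne: "{x. f x < 0} \<noteq> {}" by (auto simp: not_le)
  have op: "open {x. f x < 0}" using f by (intro open_Collect_less continuous_on_const)
  have "AE x in lebesgue. x \<notin> {x. f x < 0}"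
    using ae by (auto simp: not_less intro: AE_completion)
  then have "{x. f x < 0} \<in> null_sets lebesgue"
    using op by (subst AE_iff_null_sets) auto
  then show False using open_not_negligible[OF op ne] by (simp add: negligible_iff_null_sets)
qed

lemma interval_integral_cong_AE':
  fixes f g :: "real \<Rightarrow> real"
  assumes "f \<in> borel_measurable borel" "g \<in> borel_measurable borel" "AE x in lborel. f x = g x"
  shows "(LBINT y=ereal c..ereal x. f y) = (LBINT y=ereal c..ereal x. g y)"
  using assms by (intro interval_integral_cong_AE) (auto elim: eventually_mono)

text \<open>Bootstrapping: the equation says that \<open>g\<close> has a locally square integrable weak derivative, so \<open>g\<close> has a
  continuous representative \<open>u'\<close>; then \<open>\<psi>\<close> has a \<open>C\<^sup>1\<close> representative \<open>u\<close>, and now the right-hand side of the equation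
  for \<open>u'\<close> is continuous.\<close>

lemma weak_second_order_regularity:
  fixes F :: "real \<Rightarrow> real"
  assumes \<eta>: "cutoff_fun \<eta>" and \<psi>: "\<psi> \<in> L2_loc" and g: "g \<in> L2_loc" and wd: "has_weak_deriv \<psi> g"
    and b: "continuous_on UNIV b" and F: "continuous_on UNIV F" "\<And>s. \<bar>F s\<bar> \<le> B"
    and weak: "has_weak_deriv g (\<lambda>x. - (b x * g x + F (\<psi> x)))"
  obtains u u' where "AE x in lborel. \<psi> x = u x" "\<And>x. (u has_real_derivative u' x) (at x)"
    "\<And>x. (u' has_real_derivative - (b x * u' x + F (u x))) (at x)"
proof -
  have [measurable]: "\<psi> \<in> borel_measurable borel" "g \<in> borel_measurable borel" "F \<in> borel_measurable borel"
      "b \<in> borel_measurable borel"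
    using \<psi> g F(1) b by (auto intro: L2_loc_borel borel_measurable_continuous_onI)
  define k where "k x = - 1 * (b x * g x + F (\<psi> x))" for x
  have "(\<lambda>x. F (\<psi> x)) \<in> L2_loc"
    by (rule bounded_L2_loc[OF _ F(2)]) measurable
  then have k: "k \<in> L2_loc"
    unfolding k_def by (intro continuous_mult_L2_loc L2_loc_add g b continuous_on_const)
  have [measurable]: "k \<in> borel_measurable borel" by (rule L2_loc_borel[OF k])
  have "k = (\<lambda>x. - (b x * g x + F (\<psi> x)))" by (auto simp: k_def)
  with weak have "has_weak_deriv g k" by simp
  then obtain c C where gC: "AE x in lborel. g x = C + (LBINT y=ereal c..ereal x. k y)"
    using weak_deriv_AE_interval_integral[OF \<eta> g k] by metis
  define u' where "u' x = C + (LBINT y=ereal c..ereal x. k y)" for x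
  have u'_cont: "continuous_on UNIV u'"
    unfolding u'_def by (intro continuous_on_add continuous_on_const interval_integral_continuous L2_loc_set_integrable[OF k])
  have [measurable]: "u' \<in> borel_measurable borel" by (rule borel_measurable_continuous_onI[OF u'_cont])
  have gu: "AE x in lborel. g x = u' x" using gC by (simp add: u'_def)
  obtain c2 C2 where \<psi>C: "AE x in lborel. \<psi> x = C2 + (LBINT y=ereal c2..ereal x. g y)"
    using weak_deriv_AE_interval_integral[OF \<eta> \<psi> g wd] by metis
  define u where "u x = C2 + (LBINT y=ereal c2..ereal x. u' y)" for x
  have u: "(u has_real_derivative u' x) (at x)" for x
    unfolding u_def using DERIV_add[OF DERIV_const continuous_antiderivative[OF u'_cont]] by simp
  have u_cont: "continuous_on UNIV u" using u by (meson DERIV_continuous_on has_field_derivative_at_within)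
  have [measurable]: "u \<in> borel_measurable borel" by (rule borel_measurable_continuous_onI[OF u_cont])
  have "(LBINT y=ereal c2..ereal x. g y) = (LBINT y=ereal c2..ereal x. u' y)" for x
    by (rule interval_integral_cong_AE'[OF _ _ gu]) measurable
  then have \<psi>u: "AE x in lborel. \<psi> x = u x" using \<psi>C by (simp add: u_def)
  define k2 where "k2 x = - (b x * u' x + F (u x))" for x
  have k2_cont: "continuous_on UNIV k2"
    unfolding k2_def
    by (intro continuous_on_minus continuous_on_add continuous_on_mult b u'_cont)
      (rule continuous_on_compose2[OF F(1) u_cont], simp)
  have [measurable]: "k2 \<in> borel_measurable borel" by (rule borel_measurable_continuous_onI[OF k2_cont])
  have "AE x in lborel. k x = k2 x" using gu \<psi>u by eventually_elim (simp add: k_def k2_def)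
  then have "(LBINT y=ereal c..ereal x. k y) = (LBINT y=ereal c..ereal x. k2 y)" for x
    by (intro interval_integral_cong_AE') measurable
  then have "u' = (\<lambda>x. C + (LBINT y=ereal c..ereal x. k2 y))" by (simp add: u'_def[abs_def])
  then have "(u' has_real_derivative k2 x) (at x)" for x
    using DERIV_add[OF DERIV_const continuous_antiderivative[OF k2_cont]] by simp
  with \<psi>u u show thesis by (intro that[of u u']) (auto simp: k2_def)
qed

section \<open>Truncation in Sobolev norms\<close>

lemma cutoff_fun_deriv_zero:
  assumes "cutoff_fun \<eta>" and that: "x < 0 \<or> 1 < x"
  shows "deriv \<eta> x = 0"
proof -
  have "\<forall>\<^sub>F y in nhds x. y \<in> (if x < 0 then {..<0} else {1<..})"
    using that by (intro eventually_nhds_in_open) auto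
  then have "\<forall>\<^sub>F y in nhds x. \<eta> y = (if x < 0 then 1 else 0)"
    by eventually_elim (use assms(1) in \<open>auto simp: cutoff_fun_def split: if_splits\<close>)
  then have "deriv \<eta> x = deriv (\<lambda>_. if x < 0 then 1 else 0) x" by (intro deriv_cong_ev) auto
  then show ?thesis by simp
qed

text \<open>Multiplying \<open>w\<close> by cutoffs \<open>\<kappa> n\<close> that are 1 on \<open>[-n, n]\<close> and have uniformly bounded derivatives gives test
  functions; by dominated convergence the errors \<open>e n\<close> and their derivatives tend to 0 in \<open>L\<^sup>2\<close>, which also yields the Cauchy
  property.\<close>

lemma smooth_mem_H1_on:
  assumes \<eta>: "cutoff_fun \<eta>" and M: "sets M = sets borel" and w: "smooth_fun w"
    and int: "integrable M (\<lambda>x. (w x)\<^sup>2)" "integrable M (\<lambda>x. (deriv w x)\<^sup>2)"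
  shows "w \<in> H1_on M"
proof -
  have sm: "smooth_fun \<eta>" and \<eta>1: "\<And>x. x \<le> 0 \<Longrightarrow> \<eta> x = 1" and \<eta>0: "\<And>x. x \<ge> 1 \<Longrightarrow> \<eta> x = 0"
    using \<eta> by (auto simp: cutoff_fun_def)
  note [measurable_cong] = M
  have smM: "f \<in> borel_measurable M" if "smooth_fun f" for f
    using smooth_fun_borel[OF that] M by (simp cong: measurable_cong_sets)
  define \<kappa> where "\<kappa> n x = \<eta> (1 * x + - real n) * \<eta> (- 1 * x + - real n)" for n :: nat and x
  have sm\<kappa>: "smooth_fun (\<kappa> n)" for n
    unfolding \<kappa>_def by (intro smooth_fun_mult smooth_fun_affine sm)
  have \<kappa>_eq1: "\<kappa> n x = 1" if "\<bar>x\<bar> \<le> real n" for n x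
    using that by (simp add: \<kappa>_def \<eta>1 abs_le_iff)
  have \<kappa>_eq0: "\<kappa> n x = 0" if "\<bar>x\<bar> \<ge> real n + 1" for n x
    using that by (cases "0 \<le> x") (auto simp: \<kappa>_def \<eta>0)
  have \<kappa>_range: "\<bar>\<kappa> n x - 1\<bar> \<le> 1" for n x
    using cutoff_fun_range[OF \<eta>] mult_le_one[of "\<eta> (1 * x + - real n)" "\<eta> (- 1 * x + - real n)"]
    unfolding \<kappa>_def by (auto simp: abs_le_iff)
  have "bounded (deriv \<eta> ` {-1..2})"
    by (intro compact_imp_bounded compact_continuous_image smooth_fun_continuous_on smooth_fun_deriv sm compact_Icc)
  then obtain C0 where C0: "\<forall>x\<in>{-1..2}. \<bar>deriv \<eta> x\<bar> \<le> C0" by (auto simp: bounded_iff)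
  note d0 = cutoff_fun_deriv_zero[OF \<eta>]
  define C where "C = \<bar>C0\<bar>"
  have C: "\<bar>deriv \<eta> x\<bar> \<le> C" for x
  proof (cases "x \<in> {-1..2}")
    case True
    then have "\<bar>deriv \<eta> x\<bar> \<le> C0" using C0 by blast
    then show ?thesis by (simp add: C_def)
  qed (auto simp: C_def d0)
  define \<kappa>' where "\<kappa>' n x = deriv \<eta> (x - real n) * \<eta> (- x - real n) - deriv \<eta> (- x - real n) * \<eta> (x - real n)" for n :: nat and x
  have d\<kappa>: "(\<kappa> n has_real_derivative \<kappa>' n x) (at x)" for n x
  proof -
    have 1: "((\<lambda>x. \<eta> (1 * x + - real n)) has_real_derivative deriv \<eta> (1 * x + - real n) * 1) (at x)"
      by (rule DERIV_chain2[OF smooth_fun_DERIV[OF sm]]) (auto intro!: derivative_eq_intros)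
    have 2: "((\<lambda>x. \<eta> (- 1 * x + - real n)) has_real_derivative deriv \<eta> (- 1 * x + - real n) * - 1) (at x)"
      by (rule DERIV_chain2[OF smooth_fun_DERIV[OF sm]]) (auto intro!: derivative_eq_intros)
    show ?thesis
      unfolding \<kappa>_def using DERIV_mult[OF 1 2] by (simp add: \<kappa>'_def)
  qed
  have \<kappa>'_bound: "\<bar>\<kappa>' n x\<bar> \<le> 2 * C" for n x
  proof -
    have *: "\<bar>deriv \<eta> s * \<eta> t\<bar> \<le> C" for s t
      using mult_mono[OF C[of s], of "\<eta> t" 1] cutoff_fun_range[OF \<eta>, of t] by (simp add: abs_mult C_def)
    show ?thesis
      using *[of "x - real n" "- x - real n"] *[of "- x - real n" "x - real n"] by (simp add: \<kappa>'_def)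
  qed
  have \<kappa>'_eq0: "\<kappa>' n x = 0" if "\<bar>x\<bar> < real n" for n x
    using that d0[of "x - real n"] d0[of "- x - real n"] by (simp add: \<kappa>'_def abs_less_iff)
  define u where "u n x = w x * \<kappa> n x" for n x
  have u_test: "test_fun (u n)" for n
    unfolding u_def using \<kappa>_eq0
    by (intro test_funI[of _ "- real n - 1" "real n + 1"] smooth_fun_mult w sm\<kappa>) (auto simp: abs_le_iff not_le)
  define e where "e n x = w x * (\<kappa> n x - 1)" for n x
  define e' where "e' n x = deriv w x * (\<kappa> n x - 1) + \<kappa>' n x * w x" for n x
  have de: "(e n has_real_derivative e' n x) (at x)" for n x
    unfolding e_def e'_def
    using DERIV_mult[OF smooth_fun_DERIV[OF w] DERIV_diff[OF d\<kappa> DERIV_const]] by simp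
  have sme: "smooth_fun (e n)" for n
    unfolding e_def by (intro smooth_fun_mult w smooth_fun_diff sm\<kappa> smooth_fun_const)
  have e'_deriv: "e' n = deriv (e n)" for n using DERIV_imp_deriv[OF de] by auto
  have meas: "e n \<in> borel_measurable M" "e' n \<in> borel_measurable M" for n
    using smM[OF sme] smM[OF smooth_fun_deriv[OF sme]] by (auto simp: e'_deriv)
  have small: "\<forall>\<^sub>F n in sequentially. \<kappa> n x = 1 \<and> \<kappa>' n x = 0" for x
  proof -
    obtain N :: nat where "\<bar>x\<bar> < real N" using reals_Archimedean2 by blast
    then have "\<kappa> n x = 1 \<and> \<kappa>' n x = 0" if "n \<ge> N" for n
      using that by (intro conjI \<kappa>_eq1 \<kappa>'_eq0) auto
    then show ?thesis by (auto simp: eventually_sequentially)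
  qed
  have e_bound: "(e n x)\<^sup>2 \<le> (w x)\<^sup>2" for n x
    using mult_left_mono[OF power_mono[OF \<kappa>_range[of n x], of 2], of "(w x)\<^sup>2"]
    by (simp add: e_def power_mult_distrib)
  have e'_bound: "(e' n x)\<^sup>2 \<le> 2 * (deriv w x)\<^sup>2 + 2 * ((2 * C)\<^sup>2 * (w x)\<^sup>2)" for n x
  proof -
    have "(deriv w x * (\<kappa> n x - 1))\<^sup>2 \<le> (deriv w x)\<^sup>2"
      using mult_left_mono[OF power_mono[OF \<kappa>_range[of n x], of 2], of "(deriv w x)\<^sup>2"]
      by (simp add: power_mult_distrib)
    moreover have "(\<kappa>' n x * w x)\<^sup>2 \<le> (2 * C)\<^sup>2 * (w x)\<^sup>2"
      using mult_right_mono[OF power_mono[OF \<kappa>'_bound[of n x], of 2], of "(w x)\<^sup>2"]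
      by (simp only: power_mult_distrib power2_abs) simp
    ultimately show ?thesis
      using power2_sum_le[of "deriv w x * (\<kappa> n x - 1)" "\<kappa>' n x * w x"] unfolding e'_def by linarith
  qed
  have e_lim: "(\<lambda>n. LINT x|M. (e n x)\<^sup>2) \<longlonglongrightarrow> 0" and e_int: "\<And>n. integrable M (\<lambda>x. (e n x)\<^sup>2)"
  proof -
    have lim: "AE x in M. (\<lambda>n. (e n x)\<^sup>2) \<longlonglongrightarrow> 0"
    proof (rule AE_I2, rule tendsto_eventually)
      show "\<forall>\<^sub>F n in sequentially. (e n x)\<^sup>2 = 0" for x
        using small[of x] by eventually_elim (simp add: e_def)
    qed
    have bd: "AE x in M. norm ((e n x)\<^sup>2) \<le> (w x)\<^sup>2" for n using e_bound by simp
    have m1: "(\<lambda>x. (e n x)\<^sup>2) \<in> borel_measurable M" for n using meas by measurable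
    show "(\<lambda>n. LINT x|M. (e n x)\<^sup>2) \<longlonglongrightarrow> 0"
      using integral_dominated_convergence[OF _ m1 int(1) lim bd] by simp
    show "integrable M (\<lambda>x. (e n x)\<^sup>2)" for n
      using integrable_dominated_convergence2[OF _ m1 int(1) lim bd] by simp
  qed
  have e'_lim: "(\<lambda>n. LINT x|M. (e' n x)\<^sup>2) \<longlonglongrightarrow> 0" and e'_int: "\<And>n. integrable M (\<lambda>x. (e' n x)\<^sup>2)"
  proof -
    have dom: "integrable M (\<lambda>x. 2 * (deriv w x)\<^sup>2 + 2 * ((2 * C)\<^sup>2 * (w x)\<^sup>2))"
      by (intro Bochner_Integration.integrable_add integrable_mult_right int)
    have lim: "AE x in M. (\<lambda>n. (e' n x)\<^sup>2) \<longlonglongrightarrow> 0"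
    proof (rule AE_I2, rule tendsto_eventually)
      show "\<forall>\<^sub>F n in sequentially. (e' n x)\<^sup>2 = 0" for x
        using small[of x] by eventually_elim (simp add: e'_def)
    qed
    have bd: "AE x in M. norm ((e' n x)\<^sup>2) \<le> 2 * (deriv w x)\<^sup>2 + 2 * ((2 * C)\<^sup>2 * (w x)\<^sup>2)" for n
      using e'_bound by (intro always_eventually allI) (simp only: real_norm_def abs_power2)
    have m1: "(\<lambda>x. (e' n x)\<^sup>2) \<in> borel_measurable M" for n using meas by measurable
    show "(\<lambda>n. LINT x|M. (e' n x)\<^sup>2) \<longlonglongrightarrow> 0"
      using integral_dominated_convergence[OF _ m1 dom lim bd] by simp
    show "integrable M (\<lambda>x. (e' n x)\<^sup>2)" for n
      using integrable_dominated_convergence2[OF _ m1 dom lim bd] by simp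
  qed
  define A where "A n = (LINT x|M. (e' n x)\<^sup>2) + (LINT x|M. (e n x)\<^sup>2)" for n
  have A_lim: "A \<longlonglongrightarrow> 0" unfolding A_def using tendsto_add[OF e'_lim e_lim] by simp
  have diff: "(LINT x|M. (f x - h x)\<^sup>2) \<le> 2 * (LINT x|M. (f x)\<^sup>2) + 2 * (LINT x|M. (h x)\<^sup>2)"
    if "f \<in> borel_measurable M" "h \<in> borel_measurable M" "integrable M (\<lambda>x. (f x)\<^sup>2)" "integrable M (\<lambda>x. (h x)\<^sup>2)" for f h :: "real \<Rightarrow> real"
  proof -
    have "(LINT x|M. (f x - h x)\<^sup>2) \<le> (LINT x|M. 2 * (f x)\<^sup>2 + 2 * (h x)\<^sup>2)"
    proof (rule integral_mono')
      show "integrable M (\<lambda>x. 2 * (f x)\<^sup>2 + 2 * (h x)\<^sup>2)"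
        using that by (intro Bochner_Integration.integrable_add integrable_mult_right)
      show "(f x - h x)\<^sup>2 \<le> 2 * (f x)\<^sup>2 + 2 * (h x)\<^sup>2" for x using power2_sum_le[of "f x" "- h x"] by simp
    qed simp
    also have "\<dots> = 2 * (LINT x|M. (f x)\<^sup>2) + 2 * (LINT x|M. (h x)\<^sup>2)"
      using that by simp
    finally show ?thesis .
  qed
  have L2sq: "(L2_norm_on M f)\<^sup>2 = (LINT x|M. (f x)\<^sup>2)" for f
    unfolding L2_norm_on_def by (intro real_sqrt_pow2 Bochner_Integration.integral_nonneg) simp
  have H1: "H1_norm_on M (\<lambda>x. u m x - u n x) \<le> sqrt (2 * (A m + A n))" for m n
  proof -
    have ue: "(\<lambda>x. u m x - u n x) = (\<lambda>x. e m x - e n x)" by (auto simp: u_def e_def algebra_simps)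
    have "((\<lambda>x. e m x - e n x) has_real_derivative e' m x - e' n x) (at x)" for x
      by (intro DERIV_diff de)
    then have d: "deriv (\<lambda>x. e m x - e n x) = (\<lambda>x. e' m x - e' n x)" by (auto intro: DERIV_imp_deriv)
    show ?thesis
      unfolding H1_norm_on_def L2sq ue d A_def
      using add_mono[OF diff[OF meas(2,2) e'_int e'_int, of m n] diff[OF meas(1,1) e_int e_int, of m n]]
      by (intro real_sqrt_le_mono) (simp only: distrib_left ac_simps)
  qed
  have "\<exists>N. \<forall>m\<ge>N. \<forall>n\<ge>N. H1_norm_on M (\<lambda>x. u m x - u n x) < \<epsilon>" if "\<epsilon> > 0" for \<epsilon>
  proof -
    have "\<forall>\<^sub>F n in sequentially. A n < \<epsilon>\<^sup>2 / 4" using A_lim that by (intro order_tendstoD) auto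
    then obtain N where N: "\<And>n. n \<ge> N \<Longrightarrow> A n < \<epsilon>\<^sup>2 / 4" by (auto simp: eventually_sequentially)
    have "H1_norm_on M (\<lambda>x. u m x - u n x) < \<epsilon>" if mn: "m \<ge> N" "n \<ge> N" for m n
    proof -
      have "2 * (A m + A n) < \<epsilon>\<^sup>2" using N[OF mn(1)] N[OF mn(2)] by simp
      then have "sqrt (2 * (A m + A n)) < sqrt (\<epsilon>\<^sup>2)" by (rule real_sqrt_less_mono)
      then show ?thesis using H1[of m n] \<open>\<epsilon> > 0\<close> by simp
    qed
    then show ?thesis by blast
  qed
  moreover have "(\<lambda>n. L2_norm_on M (\<lambda>x. u n x - w x)) \<longlonglongrightarrow> 0"
  proof -
    have "u n x - w x = e n x" for n x by (simp add: u_def e_def algebra_simps)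
    then show ?thesis
      unfolding L2_norm_on_def using tendsto_real_sqrt[OF e_lim] by simp
  qed
  ultimately show ?thesis
    unfolding H1_on_def using smooth_fun_borel[OF w] int(1) u_test by blast
qed

section \<open>Integrals over half-lines\<close>

definition tail :: "(real \<Rightarrow> real) \<Rightarrow> real \<Rightarrow> real" where
  "tail f x = (LINT y:{x..}|lborel. f y)"

text \<open>For a continuous function, integrability over one half-line gives it over all of them.\<close>

definition tail_integrable :: "(real \<Rightarrow> real) \<Rightarrow> bool" where
  "tail_integrable f \<longleftrightarrow> continuous_on UNIV f \<and> (\<forall>x. set_integrable lborel {x..} f)"

lemma tail_integrable_continuous: "tail_integrable f \<Longrightarrow> continuous_on UNIV f"
  by (simp add: tail_integrable_def)

lemma tail_split:
  assumes "tail_integrable f" "x \<le> y"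
  shows "tail f x = integral {x..y} f + tail f y"
proof -
  have int: "set_integrable lborel {x..y} f" "set_integrable lborel {x..<y} f" "set_integrable lborel {y..} f"
    using assms unfolding tail_integrable_def
    by (auto intro: set_integrable_subset[of lborel "{x..}"])
  have "{x..} = {x..<y} \<union> {y..}" using assms(2) by auto
  then have "tail f x = (LINT z:{x..<y}|lborel. f z) + tail f y"
    unfolding tail_def using int by (simp add: set_integral_Un disjoint_iff)
  also have "(LINT z:{x..<y}|lborel. f z) = (LINT z:{x..y}|lborel. f z)"
    using assms(2) interval_integral_Ico[of x y f] interval_integral_Icc[of x y f] by simp
  finally show ?thesis using set_borel_integral_eq_integral(2)[OF int(1)] by simp
qed

lemma tail_DERIV:
  assumes f: "tail_integrable f"
  shows "(tail f has_real_derivative - f x) (at x)"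
proof -
  let ?c = "x - 1"
  have "((\<lambda>u. integral {?c..u} f) has_real_derivative f x) (at x within {?c..x+1})"
    using f by (intro integral_has_real_derivative)
      (auto intro: continuous_on_subset dest: tail_integrable_continuous)
  then have "((\<lambda>u. integral {?c..u} f) has_real_derivative f x) (at x)"
    by (simp add: at_within_Icc_at)
  then have "((\<lambda>u. tail f ?c - integral {?c..u} f) has_real_derivative 0 - f x) (at x)"
    by (intro DERIV_diff DERIV_const)
  moreover have "\<forall>\<^sub>F u in nhds x. u \<in> {?c<..}"
    by (rule eventually_nhds_in_open) auto
  then have "\<forall>\<^sub>F u in nhds x. tail f ?c - integral {?c..u} f = tail f u"
  proof eventually_elim
    case (elim u)
    then show ?case using tail_split[OF f, of ?c u] by simp
  qed
  ultimately show ?thesis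
    using DERIV_cong_ev[OF refl, of "\<lambda>u. tail f ?c - integral {?c..u} f" "tail f" x "0 - f x" "- f x"] by simp
qed

lemma tail_continuous: "tail_integrable f \<Longrightarrow> continuous_on UNIV (tail f)"
  by (meson DERIV_continuous_on has_field_derivative_at_within tail_DERIV)

lemma tail_tendsto_0:
  assumes f: "tail_integrable f"
  shows "(tail f \<longlongrightarrow> 0) at_top"
proof -
  have "((\<lambda>b. LINT z:{0..b}|lborel. f z) \<longlongrightarrow> tail f 0) at_top"
    unfolding tail_def using f
    by (intro tendsto_set_lebesgue_integral_at_top) (auto simp: tail_integrable_def)
  then have "((\<lambda>b. tail f 0 - (LINT z:{0..b}|lborel. f z)) \<longlongrightarrow> tail f 0 - tail f 0) at_top"
    by (intro tendsto_diff tendsto_const)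
  moreover have "\<forall>\<^sub>F b in at_top. tail f 0 - (LINT z:{0..b}|lborel. f z) = tail f b"
    using eventually_ge_at_top[of 0]
  proof eventually_elim
    case (elim b)
    have "set_integrable lborel {0..b} f"
      using f unfolding tail_integrable_def by (auto intro: set_integrable_subset[of lborel "{0..}"])
    then show ?case using tail_split[OF f elim] by (simp add: set_borel_integral_eq_integral)
  qed
  ultimately show ?thesis by (simp add: tendsto_cong)
qed

lemma tail_integrable_bound:
  assumes g: "tail_integrable g" and f: "continuous_on UNIV f"
    and ev: "\<forall>\<^sub>F x in at_top. \<bar>f x\<bar> \<le> g x"
  shows "tail_integrable f"
proof -
  obtain N where N: "\<And>x. x \<ge> N \<Longrightarrow> \<bar>f x\<bar> \<le> g x"
    using ev by (auto simp: eventually_at_top_linorder)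
  have "set_integrable lborel {x..} f" for x
  proof -
    let ?M = "max x N"
    have meas: "set_borel_measurable lborel {?M..} f"
      using borel_measurable_continuous_onI[OF f] unfolding set_borel_measurable_def by measurable
    have 1: "set_integrable lborel {?M..} f"
    proof (rule set_integrable_bound[OF _ meas])
      show "set_integrable lborel {?M..} g" using g by (simp add: tail_integrable_def)
      show "AE y in lborel. y \<in> {?M..} \<longrightarrow> norm (f y) \<le> norm (g y)"
        using N by (intro always_eventually) (force intro: order_trans)
    qed
    have 2: "set_integrable lborel {x..?M} f"
      by (intro borel_integrable_atLeastAtMost' continuous_on_subset[OF f]) auto
    have "{x..} = {x..?M} \<union> {?M..}" by auto
    with set_integrable_Un[OF 2 1] show ?thesis by simp
  qed
  with f show ?thesis by (simp add: tail_integrable_def)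
qed

lemma tail_FTC:
  assumes f: "continuous_on UNIV f" "\<And>x. 0 \<le> f x"
    and F: "\<And>x. (F has_real_derivative f x) (at x)" and lim: "(F \<longlongrightarrow> L) at_top"
  shows tail_integrable_FTC: "tail_integrable f" and tail_eq_FTC: "tail f x = L - F x"
proof -
  have meas: "f \<in> borel_measurable borel" using f(1) by (rule borel_measurable_continuous_onI)
  have nn: "(\<integral>\<^sup>+y. ennreal (f y) * indicator {x..} y \<partial>lborel) = ennreal (L - F x)" for x
    using nn_integral_FTC_atLeast[OF meas F f(2) lim] .
  have nn': "(\<integral>\<^sup>+y. ennreal (indicator {x..} y *\<^sub>R f y) \<partial>lborel) = ennreal (L - F x)" for x
    unfolding nn[of x, symmetric] by (intro nn_integral_cong) (simp add: indicator_def)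
  have hbi: "has_bochner_integral lborel (\<lambda>y. indicator {x..} y *\<^sub>R f y) (L - F x)" for x
  proof (rule has_bochner_integral_nn_integral[OF _ _ _ nn'])
    show "(\<lambda>y. indicator {x..} y *\<^sub>R f y) \<in> borel_measurable lborel"
      using meas by measurable
    show "AE y in lborel. 0 \<le> indicator {x..} y *\<^sub>R f y" using f(2) by simp
    have mono: "F x \<le> F y" if "x \<le> y" for y
      by (rule DERIV_nonneg_imp_nondecreasing[OF that]) (use F f(2) in blast)
    have "F x \<le> L"
      by (rule tendsto_lowerbound[OF lim]) (auto intro!: eventually_at_top_linorderI[of x] mono)
    then show "0 \<le> L - F x" by simp
  qed
  then show "tail_integrable f"
    using f(1) by (auto simp: tail_integrable_def set_integrable_def has_bochner_integral_iff)
  show "tail f x = L - F x"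
    unfolding tail_def set_lebesgue_integral_def using hbi has_bochner_integral_integral_eq by blast
qed

lemma tail_abs_le:
  assumes "tail_integrable f" "tail_integrable g" "\<And>y. y \<ge> x \<Longrightarrow> \<bar>f y\<bar> \<le> g y"
  shows "\<bar>tail f x\<bar> \<le> tail g x"
proof -
  have f: "integrable lborel (\<lambda>y. indicator {x..} y *\<^sub>R f y)" and g: "integrable lborel (\<lambda>y. indicator {x..} y *\<^sub>R g y)"
    using assms(1,2) by (auto simp: tail_integrable_def set_integrable_def)
  have "norm (tail f x) \<le> (LINT y|lborel. norm (indicator {x..} y *\<^sub>R f y))"
    unfolding tail_def set_lebesgue_integral_def by (rule integral_norm_bound)
  also have "\<dots> \<le> tail g x"
    unfolding tail_def set_lebesgue_integral_def
    by (rule integral_mono[OF integrable_norm[OF f] g]) (auto simp: indicator_def assms(3))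
  finally show ?thesis by simp
qed

lemma tail_integrable_diff: "tail_integrable f \<Longrightarrow> tail_integrable g \<Longrightarrow> tail_integrable (\<lambda>x. f x - g x)"
  unfolding tail_integrable_def by (auto intro: continuous_intros set_integral_diff)

lemma tail_diff: "tail_integrable f \<Longrightarrow> tail_integrable g \<Longrightarrow> tail (\<lambda>x. f x - g x) x = tail f x - tail g x"
  unfolding tail_integrable_def tail_def by (simp add: set_integral_diff)

lemma tail_integrable_cmult: "tail_integrable f \<Longrightarrow> tail_integrable (\<lambda>x. k * f x)"
  unfolding tail_integrable_def by (auto intro: continuous_intros)

lemma tail_cmult: "tail (\<lambda>x. k * f x) x = k * tail f x"
  unfolding tail_def by simp

lemma tail_nonneg: "(\<And>x. 0 \<le> f x) \<Longrightarrow> 0 \<le> tail f x"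
  unfolding tail_def set_lebesgue_integral_def by (intro integral_nonneg_AE) (auto simp: indicator_def)

lemma tail_integrable_mult_antimono:
  assumes f: "tail_integrable f" "\<And>x. 0 \<le> f x" and h: "continuous_on UNIV h" "\<And>x. 0 \<le> h x" "antimono h"
  shows "tail_integrable (\<lambda>y. f y * h y)" and "tail (\<lambda>y. f y * h y) x \<le> h x * tail f x"
proof -
  have *: "\<bar>f y * h y\<bar> \<le> h x * f y" if "y \<ge> x" for x y
    using that f(2)[of y] h(2) antimonoD[OF h(3) that] by (simp add: abs_mult mult_left_mono mult.commute)
  show "tail_integrable (\<lambda>y. f y * h y)"
    by (rule tail_integrable_bound[OF tail_integrable_cmult[OF f(1), of "h 0"]])
       (use * f(1) h(1) in \<open>auto intro!: continuous_intros eventually_at_top_linorderI[of 0] simp: tail_integrable_continuous\<close>)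
  then show "tail (\<lambda>y. f y * h y) x \<le> h x * tail f x"
    using tail_abs_le[OF _ tail_integrable_cmult[OF f(1), of "h x"], of _ x] * tail_cmult[of "h x" f x] by fastforce
qed

section \<open>Shooting from infinity\<close>

text \<open>Writing \<open>\<theta>\<close> for the tail integral of \<open>1 / r\<close>, a solution that decays at \<open>+\<infinity>\<close> with flux \<open>M\<close> there satisfies
  \<open>v(x) = M - \<integral>\<^sub>x\<^sup>\<infinity> r F(\<phi>)\<close> with \<open>\<phi>(x) = \<integral>\<^sub>x\<^sup>\<infinity> v / r\<close>. For \<open>V = v / E\<close> with the weight
  \<open>E(x) = exp (2 K \<integral>\<^sub>x\<^sup>\<infinity> r \<theta>)\<close> this is a fixed point equation in the bounded continuous functions on the whole line.
  Since \<open>E\<close> is nonincreasing, \<open>\<bar>\<phi>\<bar> \<le> \<parallel>V\<parallel> E \<theta>\<close>, and \<open>\<integral>\<^sub>x\<^sup>\<infinity> K r \<theta> E = (E(x) - 1) / 2\<close>; hence the map is a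
  contraction with constant \<open>1/2\<close>, and its fixed point is Lipschitz in \<open>M\<close>.\<close>

lemma shooting_from_infinity:
  fixes r F :: "real \<Rightarrow> real"
  assumes r: "continuous_on UNIV r" "\<And>x. 0 < r x"
    and int1: "tail_integrable (\<lambda>x. 1 / r x)"
    and int2: "tail_integrable (\<lambda>x. r x * tail (\<lambda>x. 1 / r x) x)"
    and F: "\<And>s t. \<bar>F s - F t\<bar> \<le> K * \<bar>s - t\<bar>" "F 0 = 0" and K: "0 \<le> K"
  obtains v \<phi> :: "real \<Rightarrow> real \<Rightarrow> real" and B :: "real \<Rightarrow> real" where
    "\<And>M x. (\<phi> M has_real_derivative - v M x / r x) (at x)"
    "\<And>M x. (v M has_real_derivative r x * F (\<phi> M x)) (at x)"
    "\<And>M. (v M \<longlongrightarrow> M) at_top"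
    "\<And>M. (\<phi> M \<longlongrightarrow> 0) at_top"
    "\<And>M M' x. \<bar>v M x - v M' x\<bar> \<le> B x * \<bar>M - M'\<bar>"
    "\<And>M M' x. \<bar>\<phi> M x - \<phi> M' x\<bar> \<le> B x * \<bar>M - M'\<bar>"
proof -
  define \<theta> where "\<theta> = tail (\<lambda>x. 1 / r x)"
  define \<Theta> where "\<Theta> = tail (\<lambda>x. r x * \<theta> x)"
  define E where "E x = exp (2 * K * \<Theta> x)" for x
  have \<theta>0: "0 \<le> \<theta> x" for x
    unfolding \<theta>_def by (rule tail_nonneg) (simp add: r(2) less_imp_le)
  have \<Theta>0: "0 \<le> \<Theta> x" for x
    unfolding \<Theta>_def by (rule tail_nonneg) (simp add: r(2) less_imp_le \<theta>0)
  have int2': "tail_integrable (\<lambda>x. r x * \<theta> x)" using int2 by (simp add: \<theta>_def)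
  have \<theta>_cont: "continuous_on UNIV \<theta>" unfolding \<theta>_def by (rule tail_continuous[OF int1])
  have \<Theta>_cont: "continuous_on UNIV \<Theta>" unfolding \<Theta>_def by (rule tail_continuous[OF int2'])
  have F_cont: "continuous_on UNIV F"
    by (rule lipschitz_on_continuous_on[where L = K]) (use F(1) K in \<open>auto simp: lipschitz_on_def dist_real_def\<close>)
  have E_DERIV: "(E has_real_derivative - (2 * K * r x * \<theta> x * E x)) (at x)" for x
    unfolding E_def using tail_DERIV[OF int2', of x]
    by (auto intro!: derivative_eq_intros simp: \<Theta>_def)
  have E_cont: "continuous_on UNIV E"
    unfolding E_def by (intro continuous_intros \<Theta>_cont)
  have E1: "1 \<le> E x" for x using K \<Theta>0 by (simp add: E_def)
  have E0: "0 \<le> E x" for x using E1[of x] by simp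
  have E_anti: "antimono E"
  proof (rule antimonoI)
    fix x y :: real assume "x \<le> y"
    moreover have "- (2 * K * r z * \<theta> z * E z) \<le> 0" for z
      using K r(2)[of z] \<theta>0[of z] E0[of z] by simp
    ultimately show "E y \<le> E x"
      using E_DERIV by (intro DERIV_nonpos_imp_nonincreasing[of x y E]) blast+
  qed
  have "(E \<longlongrightarrow> exp (2 * K * 0)) at_top"
    unfolding E_def \<Theta>_def by (intro tendsto_intros tail_tendsto_0[OF int2'])
  then have E_lim: "(E \<longlongrightarrow> 1) at_top" by simp
  \<comment> \<open>\<open>E' = - 2 K r \<theta> E\<close> makes this integral explicit; it is the source of the constant \<open>1/2\<close>\<close>
  let ?k = "\<lambda>y. K * (r y * \<theta> y * E y)"
  have k_FTC: "tail_integrable ?k" "tail ?k x = (E x - 1) / 2" for x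
  proof -
    have k: "continuous_on UNIV ?k" "0 \<le> ?k y" for y
      using r \<theta>_cont E_cont K \<theta>0 E1[of y] less_imp_le[OF r(2)] by (auto intro!: continuous_intros mult_nonneg_nonneg)
    have "((\<lambda>x. - E x / 2) has_real_derivative ?k x) (at x)" for x
      using DERIV_cdivide[OF DERIV_minus[OF E_DERIV[of x]], of 2] by (simp add: algebra_simps)
    moreover have "((\<lambda>x. - E x / 2) \<longlongrightarrow> - 1 / 2) at_top"
      by (intro tendsto_intros E_lim) auto
    ultimately show "tail_integrable ?k" "tail ?k x = (E x - 1) / 2"
      using tail_FTC[OF k, of "\<lambda>x. - E x / 2" "- 1 / 2"] by (auto simp: field_simps)
  qed
  have Er: "tail_integrable (\<lambda>y. (1 / r y) * E y)" "tail (\<lambda>y. (1 / r y) * E y) x \<le> E x * \<theta> x" for x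
    using tail_integrable_mult_antimono[OF int1 _ E_cont E0 E_anti] r(2) unfolding \<theta>_def
    by (simp_all add: less_imp_le)
  define ph where "ph V = tail (\<lambda>y. (1 / r y) * E y * apply_bcontfun V y)" for V :: "real \<Rightarrow>\<^sub>C real"
  have EV: "\<bar>(1 / r y) * E y * apply_bcontfun V y\<bar> \<le> norm V * ((1 / r y) * E y)" for V y
  proof -
    have "0 \<le> (1 / r y) * E y" using r(2)[of y] E0[of y] by simp
    then have "\<bar>(1 / r y) * E y * apply_bcontfun V y\<bar> = (1 / r y) * E y * \<bar>apply_bcontfun V y\<bar>"
      by (simp only: abs_mult[of "(1 / r y) * E y"] abs_of_nonneg)
    also have "\<dots> \<le> (1 / r y) * E y * norm V"
      using \<open>0 \<le> (1 / r y) * E y\<close> norm_bounded[of V y] by (intro mult_left_mono) auto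
    finally show ?thesis by (simp only: mult.commute)
  qed
  have ph_int: "tail_integrable (\<lambda>y. (1 / r y) * E y * apply_bcontfun V y)" for V
  proof (rule tail_integrable_bound[OF tail_integrable_cmult[OF Er(1), of "norm V"]])
    show "continuous_on UNIV (\<lambda>y. (1 / r y) * E y * apply_bcontfun V y)"
      by (intro continuous_intros tail_integrable_continuous[OF Er(1)]) auto
    show "\<forall>\<^sub>F y in at_top. \<bar>(1 / r y) * E y * apply_bcontfun V y\<bar> \<le> norm V * ((1 / r y) * E y)"
      by (intro always_eventually allI EV)
  qed
  have ph_diff: "\<bar>ph V x - ph W x\<bar> \<le> norm (V - W) * (E x * \<theta> x)" for V W x
  proof -
    have "ph V x - ph W x = tail (\<lambda>y. (1 / r y) * E y * apply_bcontfun V y - (1 / r y) * E y * apply_bcontfun W y) x"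
      unfolding ph_def by (rule tail_diff[symmetric]) (rule ph_int)+
    also have "\<dots> = tail (\<lambda>y. (1 / r y) * E y * apply_bcontfun (V - W) y) x"
      by (simp add: right_diff_distrib minus_bcontfun.rep_eq)
    finally have "\<bar>ph V x - ph W x\<bar> \<le> tail (\<lambda>y. norm (V - W) * ((1 / r y) * E y)) x"
      by (simp only:) (intro tail_abs_le ph_int tail_integrable_cmult Er(1) EV)
    also have "\<dots> \<le> norm (V - W) * (E x * \<theta> x)"
      unfolding tail_cmult by (intro mult_left_mono Er(2)) auto
    finally show ?thesis .
  qed
  have ph0: "ph 0 x = 0" for x by (simp add: ph_def tail_def)
  have ph_cont: "continuous_on UNIV (ph V)" for V
    unfolding ph_def by (rule tail_continuous[OF ph_int])
  have F_diff: "\<bar>r y * F (ph V y) - r y * F (ph W y)\<bar> \<le> norm (V - W) * ?k y" for V W y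
  proof -
    have "\<bar>F (ph V y) - F (ph W y)\<bar> \<le> K * (norm (V - W) * (E y * \<theta> y))"
      by (rule order_trans[OF F(1) mult_left_mono[OF ph_diff K]])
    then have "r y * \<bar>F (ph V y) - F (ph W y)\<bar> \<le> r y * (K * (norm (V - W) * (E y * \<theta> y)))"
      using r(2)[of y] by (intro mult_left_mono) auto
    then show ?thesis
      using r(2)[of y] by (simp add: right_diff_distrib[symmetric] abs_mult mult_ac)
  qed
  have F_int: "tail_integrable (\<lambda>y. r y * F (ph V y))" for V
  proof (rule tail_integrable_bound[OF tail_integrable_cmult[OF k_FTC(1), of "norm V"]])
    show "continuous_on UNIV (\<lambda>y. r y * F (ph V y))"
      by (rule continuous_on_mult[OF r(1) continuous_on_compose2[OF F_cont ph_cont]]) simp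
    show "\<forall>\<^sub>F y in at_top. \<bar>r y * F (ph V y)\<bar> \<le> norm V * ?k y"
    proof (intro always_eventually allI)
      show "\<bar>r y * F (ph V y)\<bar> \<le> norm V * ?k y" for y
        using F_diff[of y V 0] unfolding ph0 F(2) by simp
    qed
  qed
  define I where "I V = tail (\<lambda>y. r y * F (ph V y))" for V
  have I_diff: "\<bar>I V x - I W x\<bar> \<le> norm (V - W) * ((E x - 1) / 2)" for V W x
  proof -
    have "I V x - I W x = tail (\<lambda>y. r y * F (ph V y) - r y * F (ph W y)) x"
      unfolding I_def by (rule tail_diff[symmetric]) (rule F_int)+
    also have "\<bar>\<dots>\<bar> \<le> tail (\<lambda>y. norm (V - W) * ?k y) x"
      by (intro tail_abs_le tail_integrable_diff F_int tail_integrable_cmult[OF k_FTC(1)] F_diff)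
    finally show ?thesis unfolding tail_cmult[of _ ?k] k_FTC(2) .
  qed
  have I0: "I 0 x = 0" for x by (simp add: I_def ph0 F(2) tail_def)
  define G where "G M V x = (M - I V x) / E x" for M V x
  have G_diff: "\<bar>G M V x - G M' W x\<bar> \<le> \<bar>M - M'\<bar> + norm (V - W) / 2" for M M' V W x
  proof -
    have "\<bar>G M V x - G M' W x\<bar> = \<bar>(M - M') - (I V x - I W x)\<bar> / E x"
      using E1[of x] by (simp add: G_def diff_divide_distrib[symmetric] algebra_simps)
    also have "\<dots> \<le> (\<bar>M - M'\<bar> * E x + norm (V - W) / 2 * E x) / E x"
    proof (rule divide_right_mono)
      have "norm (V - W) * ((E x - 1) / 2) \<le> norm (V - W) / 2 * E x"
        by (simp add: field_simps)
      with I_diff[of V x W] have "\<bar>I V x - I W x\<bar> \<le> norm (V - W) / 2 * E x"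
        by (rule order_trans)
      moreover have "\<bar>M - M'\<bar> * 1 \<le> \<bar>M - M'\<bar> * E x" by (intro mult_left_mono E1) auto
      ultimately show "\<bar>(M - M') - (I V x - I W x)\<bar> \<le> \<bar>M - M'\<bar> * E x + norm (V - W) / 2 * E x"
        by (intro order_trans[OF abs_triangle_ineq4 add_mono]) simp_all
    qed (use E1[of x] in simp)
    also have "\<dots> = \<bar>M - M'\<bar> + norm (V - W) / 2"
      using E1[of x] by (simp add: add_divide_distrib)
    finally show ?thesis .
  qed
  have G_bcontfun: "G M V \<in> bcontfun" for M V
  proof (rule bcontfun_normI)
    show "continuous_on UNIV (G M V)"
      unfolding G_def I_def
    proof (rule continuous_on_divide[OF continuous_on_diff[OF continuous_on_const tail_continuous[OF F_int]] E_cont])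
      show "\<forall>x\<in>UNIV. E x \<noteq> 0"
      proof
        show "E x \<noteq> 0" for x using E1[of x] by simp
      qed
    qed
    show "norm (G M V x) \<le> \<bar>M\<bar> + norm V / 2" for x
      using G_diff[of M V x 0 0] by (simp add: G_def I0)
  qed
  define T where "T M V = Bcontfun (G M V)" for M V
  have T: "apply_bcontfun (T M V) = G M V" for M V
    unfolding T_def by (rule Bcontfun_inverse[OF G_bcontfun])
  have T_diff: "dist (T M V) (T M' W) \<le> \<bar>M - M'\<bar> + 1 / 2 * dist V W" for M M' V W
    using G_diff[of M V _ M' W] by (intro dist_bound) (simp add: T dist_norm)
  have "\<exists>!V. T M V = V" for M
    using T_diff[of M _ M] by (intro banach_fix_type[of "1/2"]) auto
  then obtain S where S: "\<And>M. T M (S M) = S M" by metis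
  have S_diff: "norm (S M - S M') \<le> 2 * \<bar>M - M'\<bar>" for M M'
    using T_diff[of M "S M" M' "S M'"] unfolding S dist_norm by simp
  have S_eq: "apply_bcontfun (S M) x = (M - I (S M) x) / E x" for M x
    using T[of M "S M"] unfolding S G_def by metis
  define v where "v M x = M - I (S M) x" for M x
  define \<phi> where "\<phi> M = ph (S M)" for M
  have v: "v M x = E x * apply_bcontfun (S M) x" for M x
    using S_eq[of M x] E1[of x] by (simp add: v_def)
  show thesis
  proof (rule that[of \<phi> v "\<lambda>x. 2 * E x * (1 + \<theta> x)"])
    show "(\<phi> M has_real_derivative - v M x / r x) (at x)" for M x
      using tail_DERIV[OF ph_int[of "S M"], of x] by (simp add: \<phi>_def ph_def v)
    show "(v M has_real_derivative r x * F (\<phi> M x)) (at x)" for M x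
      using DERIV_diff[OF DERIV_const[of M] tail_DERIV[OF F_int[of "S M"], of x]]
      by (simp add: v_def[abs_def] \<phi>_def I_def)
    show "(v M \<longlongrightarrow> M) at_top" for M
      using tendsto_diff[OF tendsto_const[of M] tail_tendsto_0[OF F_int[of "S M"]]]
      by (simp add: v_def[abs_def] I_def)
    show "(\<phi> M \<longlongrightarrow> 0) at_top" for M
      unfolding \<phi>_def ph_def by (rule tail_tendsto_0[OF ph_int])
    have step: "E x * norm (S M - S M') \<le> 2 * E x * \<bar>M - M'\<bar>" for M M' x
      using mult_left_mono[OF S_diff[of M M'], of "E x"] E1[of x] by (simp add: mult_ac)
    show "\<bar>v M x - v M' x\<bar> \<le> 2 * E x * (1 + \<theta> x) * \<bar>M - M'\<bar>" for M M' x
    proof -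
      have "\<bar>v M x - v M' x\<bar> = E x * \<bar>apply_bcontfun (S M - S M') x\<bar>"
        using E1[of x] by (simp add: v minus_bcontfun.rep_eq abs_mult flip: right_diff_distrib)
      also have "\<dots> \<le> E x * norm (S M - S M')"
        using norm_bounded[of "S M - S M'" x] E1[of x] by (intro mult_left_mono) auto
      also have "\<dots> \<le> 2 * E x * \<bar>M - M'\<bar>" by (rule step)
      also have "\<dots> \<le> 2 * E x * (1 + \<theta> x) * \<bar>M - M'\<bar>"
        using E1[of x] \<theta>0[of x] by (intro mult_right_mono) auto
      finally show ?thesis .
    qed
    show "\<bar>\<phi> M x - \<phi> M' x\<bar> \<le> 2 * E x * (1 + \<theta> x) * \<bar>M - M'\<bar>" for M M' x
    proof -
      have "\<bar>\<phi> M x - \<phi> M' x\<bar> \<le> E x * norm (S M - S M') * \<theta> x"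
        using ph_diff[of "S M" x "S M'"] by (simp add: \<phi>_def mult_ac)
      also have "\<dots> \<le> 2 * E x * \<bar>M - M'\<bar> * \<theta> x" by (intro mult_right_mono step \<theta>0)
      also have "\<dots> \<le> 2 * E x * \<bar>M - M'\<bar> * (1 + \<theta> x)"
        using E1[of x] by (intro mult_left_mono) auto
      finally show ?thesis by (simp only: mult_ac)
    qed
  qed
qed

section \<open>Elementary facts on real functions\<close>

lemma last_zero_before:
  fixes f :: "real \<Rightarrow> real"
  assumes f: "continuous_on UNIV f" and "x \<le> z" "f x \<le> 0" "0 < f z"
  obtains s where "x \<le> s" "s < z" "f s = 0" "\<And>y. s < y \<Longrightarrow> y \<le> z \<Longrightarrow> 0 < f y"
proof -
  let ?S = "{x..z} \<inter> {y. f y \<le> 0}"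
  have "closed {y. f y \<le> 0}" using f by (intro closed_Collect_le continuous_intros) auto
  then have "compact ?S" by (intro compact_Int_closed) auto
  moreover have "?S \<noteq> {}" using assms by auto
  ultimately obtain s where s: "s \<in> ?S" "\<And>y. y \<in> ?S \<Longrightarrow> y \<le> s"
    using compact_attains_sup[of ?S] by blast
  have pos: "0 < f y" if "s < y" "y \<le> z" for y
    using s(1) s(2)[of y] that by force
  have sz: "s < z" using s(1) assms(4) by (cases "s = z") auto
  have "f s = 0"
  proof (rule ccontr)
    assume "f s \<noteq> 0"
    then have "f s < 0" using s(1) by auto
    moreover have "(f \<longlongrightarrow> f s) (at_right s)"
      using f by (simp add: continuous_on_eq_continuous_at continuous_at_imp_continuous_at_within
          flip: continuous_within)
    ultimately have "\<forall>\<^sub>F y in at_right s. f y < 0" by (intro order_tendstoD)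
    moreover have "\<forall>\<^sub>F y in at_right s. y \<in> {s<..<z}" using sz by (rule eventually_at_right_real)
    ultimately have "\<forall>\<^sub>F y in at_right s. False"
      by eventually_elim (use pos in force)
    then show False by simp
  qed
  then show thesis using s(1) sz pos by (intro that[of s]) auto
qed

lemma first_zero_after:
  fixes f :: "real \<Rightarrow> real"
  assumes f: "continuous_on UNIV f" and "z \<le> x" "f x \<le> 0" "0 < f z"
  obtains s where "s \<le> x" "z < s" "f s = 0" "\<And>y. z \<le> y \<Longrightarrow> y < s \<Longrightarrow> 0 < f y"
proof -
  have "continuous_on UNIV (\<lambda>y. f (- y))"
    by (rule continuous_on_compose2[OF f continuous_on_minus[OF continuous_on_id]]) simp
  then obtain s where s: "- x \<le> s" "s < - z" "f (- s) = 0" "\<And>y. s < y \<Longrightarrow> y \<le> - z \<Longrightarrow> 0 < f (- y)"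
    using last_zero_before[of "\<lambda>y. f (- y)" "- x" "- z"] assms by auto
  show thesis
    using s(1-3) s(4)[of "- y" for y] by (intro that[of "- s"]) force+
qed

lemma DERIV_continuous_on_UNIV: "(\<And>x. (f has_real_derivative f' x) (at x)) \<Longrightarrow> continuous_on UNIV f"
  by (meson DERIV_continuous_on has_field_derivative_at_within)

lemma DERIV_nonpos_tendsto_le:
  fixes f f' :: "real \<Rightarrow> real"
  assumes f: "\<And>x. (f has_real_derivative f' x) (at x)" and "\<And>x. x \<ge> a \<Longrightarrow> f' x \<le> 0"
    and lim: "(f \<longlongrightarrow> L) at_top"
  shows "L \<le> f a"
proof (rule tendsto_upperbound[OF lim])
  have "f x \<le> f a" if "a \<le> x" for x
    by (rule DERIV_nonpos_imp_nonincreasing[OF that]) (use assms in blast)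
  then show "\<forall>\<^sub>F x in at_top. f x \<le> f a" by (rule eventually_at_top_linorderI)
qed simp

lemma DERIV_nonneg_tendsto_ge:
  fixes f f' :: "real \<Rightarrow> real"
  assumes f: "\<And>x. (f has_real_derivative f' x) (at x)" and "\<And>x. x \<ge> a \<Longrightarrow> f' x \<ge> 0"
    and lim: "(f \<longlongrightarrow> L) at_top"
  shows "f a \<le> L"
  using DERIV_nonpos_tendsto_le[of "\<lambda>x. - f x" "\<lambda>x. - f' x" a "- L"] assms
  by (auto intro!: DERIV_minus tendsto_minus)

lemma DERIV_nonneg_tendsto_at_bot_le:
  fixes f f' :: "real \<Rightarrow> real"
  assumes f: "\<And>x. (f has_real_derivative f' x) (at x)" and "\<And>x. x \<le> x0 \<Longrightarrow> f' x \<ge> 0"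
    and lim: "(f \<longlongrightarrow> L) at_bot"
  shows "L \<le> f x0"
proof (rule tendsto_upperbound[OF lim])
  have "f x \<le> f x0" if "x \<le> x0" for x
    by (rule DERIV_nonneg_imp_nondecreasing[OF that]) (use assms in blast)
  then show "\<forall>\<^sub>F x in at_bot. f x \<le> f x0" by (auto simp: eventually_at_bot_linorder)
qed simp

text \<open>L'Hospital's rule for \<open>0/0\<close> at \<open>+\<infinity>\<close>: once \<open>f'\<close> lies between two multiples of \<open>g'\<close>, integration from
  \<open>+\<infinity>\<close> puts \<open>f\<close> between the same multiples of \<open>g\<close>.\<close>

lemma lhopital_at_top_0_0:
  fixes f g f' g' :: "real \<Rightarrow> real"
  assumes f: "\<And>x. (f has_real_derivative f' x) (at x)" "(f \<longlongrightarrow> 0) at_top"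
    and g: "\<And>x. (g has_real_derivative g' x) (at x)" "(g \<longlongrightarrow> 0) at_top" "\<forall>\<^sub>F x in at_top. g' x < 0"
    and lim: "((\<lambda>x. f' x / g' x) \<longlongrightarrow> L) at_top"
  shows "((\<lambda>x. f x / g x) \<longlongrightarrow> L) at_top"
proof (rule tendstoI)
  fix e :: real assume "0 < e"
  then have "\<forall>\<^sub>F x in at_top. dist (f' x / g' x) L < e / 2" by (intro tendstoD[OF lim]) simp
  then have "\<forall>\<^sub>F x in at_top. g' x < 0 \<and> dist (f' x / g' x) L < e / 2"
    using g(3) by eventually_elim simp
  then have "\<forall>\<^sub>F x in at_top. \<forall>y\<ge>x. g' y < 0 \<and> dist (f' y / g' y) L < e / 2"
    by (rule eventually_all_ge_at_top)
  then show "\<forall>\<^sub>F x in at_top. dist (f x / g x) L < e"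
  proof eventually_elim
    case (elim x)
    have gpos: "0 < g x"
      using elim g(1) by (intro DERIV_neg_imp_decreasing_at_top[OF _ g(2)]) blast
    have bound: "f' y \<le> (L - e / 2) * g' y" "(L + e / 2) * g' y \<le> f' y" if "x \<le> y" for y
    proof -
      have "L - e / 2 < f' y / g' y" "f' y / g' y < L + e / 2" "g' y < 0"
        using elim[rule_format, OF that] unfolding dist_real_def abs_less_iff by linarith+
      then show "f' y \<le> (L - e / 2) * g' y" "(L + e / 2) * g' y \<le> f' y"
        by (simp_all add: less_divide_eq divide_less_eq less_imp_le)
    qed
    have "0 \<le> f x - (L - e / 2) * g x"
    proof (rule DERIV_nonpos_tendsto_le[where f = "\<lambda>x. f x - (L - e / 2) * g x"])
      show "((\<lambda>x. f x - (L - e / 2) * g x) has_real_derivative f' y - (L - e / 2) * g' y) (at y)" for y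
        by (intro DERIV_diff DERIV_cmult f g)
      show "((\<lambda>x. f x - (L - e / 2) * g x) \<longlongrightarrow> 0) at_top"
        using tendsto_diff[OF f(2) tendsto_mult_left[OF g(2), of "L - e / 2"]] by simp
    qed (use bound in auto)
    moreover have "f x - (L + e / 2) * g x \<le> 0"
    proof (rule DERIV_nonneg_tendsto_ge[where f = "\<lambda>x. f x - (L + e / 2) * g x"])
      show "((\<lambda>x. f x - (L + e / 2) * g x) has_real_derivative f' y - (L + e / 2) * g' y) (at y)" for y
        by (intro DERIV_diff DERIV_cmult f g)
      show "((\<lambda>x. f x - (L + e / 2) * g x) \<longlongrightarrow> 0) at_top"
        using tendsto_diff[OF f(2) tendsto_mult_left[OF g(2), of "L + e / 2"]] by simp
    qed (use bound in auto)
    ultimately have "L - e / 2 \<le> f x / g x" "f x / g x \<le> L + e / 2"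
      using gpos by (simp_all add: le_divide_eq divide_le_eq)
    then show ?case using \<open>0 < e\<close> by (auto simp: dist_real_def abs_less_iff)
  qed
qed

lemma powr_diff_le:
  assumes "1 < p" "0 \<le> t" "t \<le> s" "s \<le> (1 :: real)"
  shows "s powr p - t powr p \<le> p * (s - t)"
proof (cases "t = 0 \<or> t = s")
  case True
  have "s powr p \<le> s powr 1" if "s > 0" using assms that by (intro powr_mono_both') auto
  then have "s powr p \<le> s" using assms by (cases "s = 0") auto
  also have "s * 1 \<le> s * p" using assms by (intro mult_left_mono) auto
  finally have "s powr p \<le> s * p" by simp
  then show ?thesis using True by (auto simp: mult.commute)
next
  case False
  then have t: "0 < t" "t < s" using assms by auto
  have "((\<lambda>x. x powr p) has_real_derivative p * x powr (p - 1)) (at x)" if "t \<le> x" "x \<le> s" for x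
    using t that by (auto intro!: derivative_eq_intros simp: powr_diff)
  from MVT2[OF t(2) this] obtain z where z: "t < z" "z < s" "s powr p - t powr p = (s - t) * (p * z powr (p - 1))"
    by blast
  have "z powr (p - 1) \<le> 1" using z t assms by (intro powr_le1) auto
  then have "p * z powr (p - 1) \<le> p * 1" using assms by (intro mult_left_mono) auto
  then have "(s - t) * (p * z powr (p - 1)) \<le> (s - t) * (p * 1)"
    by (rule mult_left_mono) (use t in simp)
  then show ?thesis unfolding z(3) by (simp add: mult.commute)
qed

section \<open>The equation in flux form\<close>

locale profile_ode =
  fixes a c p :: real
  assumes a: "0 < a" and c: "0 < c" and p: "1 < p"
begin

definition r :: "real \<Rightarrow> real" where "r z = exp (exp (2 * z) / 4 - a * z)"

definition b :: "real \<Rightarrow> real" where "b z = exp (2 * z) / 2 - a"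

definition R :: "real \<Rightarrow> real" where "R s = c * (s - s powr p)"

text \<open>The reaction is frozen outside the unit interval, where it becomes 0; this makes it globally
  Lipschitz and nonnegative, and changes nothing for solutions with values in the unit interval.\<close>

definition R01 :: "real \<Rightarrow> real" where "R01 s = R (max 0 (min 1 s))"

definition \<theta> :: "real \<Rightarrow> real" where "\<theta> = tail (\<lambda>x. 1 / r x)"

lemma r_pos: "0 < r z" by (simp add: r_def)

lemma r_nz [simp]: "r z \<noteq> 0" by (simp add: r_def)

lemma r_DERIV: "(r has_real_derivative b z * r z) (at z)"
  unfolding r_def b_def by (auto intro!: derivative_eq_intros)

lemma inv_r_DERIV: "((\<lambda>x. 1 / r x) has_real_derivative - (b z * (1 / r z))) (at z)"
proof -
  have "1 / r x = exp (a * x - exp (2 * x) / 4)" for x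
    by (simp add: r_def exp_diff)
  then show ?thesis
    unfolding b_def by (auto intro!: derivative_eq_intros simp: algebra_simps)
qed

lemma r_cont: "continuous_on UNIV r"
  by (rule DERIV_continuous_on_UNIV[OF r_DERIV])

lemma inv_r_cont: "continuous_on UNIV (\<lambda>x. 1 / r x)"
  by (intro continuous_on_divide continuous_on_const r_cont) simp

lemma r_ge: "exp (- a * z) \<le> r z"
  by (simp add: r_def)

lemma r_ge_1: "z \<le> 0 \<Longrightarrow> 1 \<le> r z"
  using a by (intro order_trans[OF _ r_ge]) (simp add: mult_nonneg_nonpos)

lemma exp_tail_integrable: "tail_integrable (\<lambda>x. k * exp (- k * x))" if "k > 0" for k :: real
proof (rule tail_integrable_FTC)
  show "((\<lambda>x. - exp (- k * x)) has_real_derivative k * exp (- k * x)) (at x)" for x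
    by (auto intro!: derivative_eq_intros)
  show "((\<lambda>x. - exp (- k * x)) \<longlongrightarrow> 0) at_top"
    using that by real_asymp
qed (use that in \<open>auto intro!: continuous_intros\<close>)

lemma inv_r_tail_integrable: "tail_integrable (\<lambda>x. 1 / r x)"
proof (rule tail_integrable_bound[OF exp_tail_integrable[of 1] inv_r_cont])
  have "\<forall>\<^sub>F x in at_top. 1 / r x \<le> exp (- x)"
    unfolding r_def by real_asymp
  then show "\<forall>\<^sub>F x in at_top. \<bar>1 / r x\<bar> \<le> 1 * exp (- 1 * x)"
    by eventually_elim (simp add: r_pos less_imp_le)
qed simp

lemma \<theta>_DERIV: "(\<theta> has_real_derivative - 1 / r x) (at x)"
  using tail_DERIV[OF inv_r_tail_integrable, of x] by (simp add: \<theta>_def)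

lemma \<theta>_tendsto_0: "(\<theta> \<longlongrightarrow> 0) at_top"
  unfolding \<theta>_def by (rule tail_tendsto_0[OF inv_r_tail_integrable])

lemma \<theta>_cont: "continuous_on UNIV \<theta>"
  by (rule DERIV_continuous_on_UNIV[OF \<theta>_DERIV])

lemma \<theta>_pos: "0 < \<theta> x"
proof -
  have "\<theta> (x + 1) \<ge> 0" unfolding \<theta>_def by (rule tail_nonneg) (simp add: r_pos less_imp_le)
  moreover have "\<theta> (x + 1) < \<theta> x"
    by (rule DERIV_neg_imp_decreasing) (use \<theta>_DERIV r_pos in \<open>force simp: divide_neg_pos\<close>)+
  ultimately show ?thesis by simp
qed

lemma weighted_DERIV:
  "((\<lambda>x. exp (- 2 * x) * (1 / r x)) has_real_derivative - (2 + b x) * (exp (- 2 * x) * (1 / r x))) (at x)"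
proof -
  have e: "((\<lambda>x. exp (- 2 * x)) has_real_derivative - 2 * exp (- 2 * x)) (at x)"
    by (auto intro!: derivative_eq_intros)
  have alg: "- 2 * A * I + - (q * I) * A = - (2 + q) * (A * I)" for A I q :: real
    by (simp add: algebra_simps)
  show ?thesis by (rule DERIV_cong[OF DERIV_mult[OF e inv_r_DERIV] alg])
qed

text \<open>Both \<open>\<theta>\<close> (with \<open>u = 1\<close>) and the profile (with \<open>u = v\<close>) have this form, so the decay of both is
  that of \<open>e\<^sup>-\<^sup>2\<^sup>x / r\<close>, up to constants.\<close>

lemma tendsto_ratio_weighted:
  assumes f: "\<And>x. (f has_real_derivative - u x / r x) (at x)" "(f \<longlongrightarrow> 0) at_top"
    and u: "(u \<longlongrightarrow> L) at_top"
  shows "((\<lambda>x. f x / (exp (- 2 * x) * (1 / r x))) \<longlongrightarrow> 2 * L) at_top"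
proof (rule lhopital_at_top_0_0)
  show "\<And>x. (f has_real_derivative - u x / r x) (at x)" by (rule f(1))
  show "((\<lambda>x. exp (- 2 * x) * (1 / r x)) has_real_derivative - (2 + b x) * (exp (- 2 * x) * (1 / r x))) (at x)" for x
    by (rule weighted_DERIV)
  have "\<forall>\<^sub>F x in at_top. 0 < b x" unfolding b_def by real_asymp
  then show "\<forall>\<^sub>F x in at_top. - (2 + b x) * (exp (- 2 * x) * (1 / r x)) < 0"
    by eventually_elim (intro mult_neg_pos, simp_all add: r_pos)
  show "((\<lambda>x. exp (- 2 * x) * (1 / r x)) \<longlongrightarrow> 0) at_top" unfolding r_def by real_asymp
  have "((\<lambda>x. (2 + b x) * exp (- 2 * x)) \<longlongrightarrow> 1 / 2) at_top" unfolding b_def by real_asymp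
  from tendsto_divide[OF u this] have "((\<lambda>x. u x / ((2 + b x) * exp (- 2 * x))) \<longlongrightarrow> 2 * L) at_top" by (simp add: mult.commute)
  moreover have "- u x / r x / (- (2 + b x) * (exp (- 2 * x) * (1 / r x))) = u x / ((2 + b x) * exp (- 2 * x))" for x
  proof -
    have "- w / s / (- q * (t * (1 / s))) = w / (q * t)" if "s \<noteq> 0" for q s t w :: real
      using that by simp
    then show ?thesis by (metis r_nz)
  qed
  ultimately show "((\<lambda>x. - u x / r x / (- (2 + b x) * (exp (- 2 * x) * (1 / r x)))) \<longlongrightarrow> 2 * L) at_top"
    by (simp only:)
qed (rule f(2))

lemma r_\<theta>_le: "\<forall>\<^sub>F x in at_top. r x * \<theta> x \<le> 4 * exp (- 2 * x)"
proof -
  have "((\<lambda>x. \<theta> x / (exp (- 2 * x) * (1 / r x))) \<longlongrightarrow> 2 * 1) at_top"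
    by (rule tendsto_ratio_weighted[of \<theta> "\<lambda>_. 1", OF \<theta>_DERIV \<theta>_tendsto_0 tendsto_const])
  then have "\<forall>\<^sub>F x in at_top. \<theta> x / (exp (- 2 * x) * (1 / r x)) < 4" by (rule order_tendstoD) simp
  then show ?thesis
  proof eventually_elim
    case (elim x)
    then have "\<theta> x * r x < 4 * exp (- (2 * x))" using r_pos[of x] by (simp add: field_simps)
    then show ?case by (simp add: mult.commute)
  qed
qed

lemma r_\<theta>_tail_integrable: "tail_integrable (\<lambda>x. r x * \<theta> x)"
proof (rule tail_integrable_bound[OF tail_integrable_cmult[OF exp_tail_integrable[of 2], of 2]])
  show "continuous_on UNIV (\<lambda>x. r x * \<theta> x)" by (intro continuous_on_mult r_cont \<theta>_cont)
  show "\<forall>\<^sub>F x in at_top. \<bar>r x * \<theta> x\<bar> \<le> 2 * (2 * exp (- 2 * x))"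
    using r_\<theta>_le by eventually_elim (simp add: r_pos \<theta>_pos less_imp_le)
qed simp

lemma R_pos: "0 < R s" if "0 < s" "s < 1"
proof -
  have "s powr p < s powr 1" using that p by (intro powr_less_mono') auto
  then show ?thesis using that c by (simp add: R_def)
qed

lemma R_0_1 [simp]: "R 0 = 0" "R 1 = 0" by (auto simp: R_def)

lemma R_nonneg: "0 \<le> s \<Longrightarrow> s \<le> 1 \<Longrightarrow> 0 \<le> R s"
  using R_pos[of s] by (cases "s = 0 \<or> s = 1") auto

lemma R_le: "0 \<le> s \<Longrightarrow> R s \<le> c * s"
  using c by (simp add: R_def)

lemma R01_eq: "0 \<le> s \<Longrightarrow> s \<le> 1 \<Longrightarrow> R01 s = R s"
  by (simp add: R01_def)

lemma R01_nonneg: "0 \<le> R01 s"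
  unfolding R01_def by (intro R_nonneg) auto

lemma R01_nonpos_arg: "s \<le> 0 \<Longrightarrow> R01 s = 0"
  by (simp add: R01_def)

lemma R01_ge_1_arg: "s \<ge> 1 \<Longrightarrow> R01 s = 0"
  by (simp add: R01_def)

lemma R_lipschitz_le:
  assumes "0 \<le> t" "t \<le> s" "s \<le> 1"
  shows "\<bar>R s - R t\<bar> \<le> c * (1 + p) * (s - t)"
proof -
  have "s powr p - t powr p \<le> p * (s - t)" by (rule powr_diff_le[OF p assms])
  moreover have "t powr p \<le> s powr p" using assms p by (intro powr_mono2) auto
  moreover have "0 \<le> p * (s - t)" using assms p by simp
  ultimately have "\<bar>(s - t) - (s powr p - t powr p)\<bar> \<le> (s - t) + p * (s - t)"
    using assms by (simp add: abs_le_iff)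
  then have "c * \<bar>(s - t) - (s powr p - t powr p)\<bar> \<le> c * ((s - t) + p * (s - t))"
    using c by (intro mult_left_mono) auto
  moreover have "R s - R t = c * ((s - t) - (s powr p - t powr p))"
    by (simp add: R_def algebra_simps)
  ultimately show ?thesis using c by (simp only: abs_mult abs_of_pos) (simp add: distrib_left distrib_right mult.assoc)
qed

lemma R01_lipschitz: "\<bar>R01 s - R01 t\<bar> \<le> c * (1 + p) * \<bar>s - t\<bar>"
proof -
  define k where "k x = max 0 (min 1 x)" for x :: real
  have k: "0 \<le> k x" "k x \<le> 1" for x by (auto simp: k_def)
  have "\<bar>R (k s) - R (k t)\<bar> \<le> c * (1 + p) * \<bar>k s - k t\<bar>"
    using R_lipschitz_le[of "k t" "k s"] R_lipschitz_le[of "k s" "k t"] k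
    by (cases "k t \<le> k s") (auto simp: abs_minus_commute)
  also have "\<dots> \<le> c * (1 + p) * \<bar>s - t\<bar>"
    using c p by (intro mult_left_mono) (auto simp: k_def)
  finally show ?thesis by (simp add: R01_def k_def)
qed

text \<open>The second component is the flux \<open>- r \<phi>'\<close>.\<close>

definition flux_pair :: "(real \<Rightarrow> real) \<Rightarrow> (real \<Rightarrow> real) \<Rightarrow> bool" where
  "flux_pair \<phi> v \<longleftrightarrow> (\<forall>x. (\<phi> has_real_derivative - v x / r x) (at x)) \<and>
    (\<forall>x. (v has_real_derivative r x * R01 (\<phi> x)) (at x))"

lemma flux_pair_DERIV:
  assumes "flux_pair \<phi> v"
  shows "(\<phi> has_real_derivative - v x / r x) (at x)" "(v has_real_derivative r x * R01 (\<phi> x)) (at x)"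
  using assms by (auto simp: flux_pair_def)

lemma flux_pair_continuous: "flux_pair \<phi> v \<Longrightarrow> continuous_on UNIV \<phi>" "flux_pair \<phi> v \<Longrightarrow> continuous_on UNIV v"
  by (meson DERIV_continuous_on_UNIV flux_pair_DERIV)+

lemma flux_pair_v_mono:
  assumes "flux_pair \<phi> v" "x \<le> y" shows "v x \<le> v y"
proof (rule DERIV_nonneg_imp_nondecreasing[OF assms(2)])
  have "0 \<le> r z * R01 (\<phi> z)" for z using r_pos[of z] R01_nonneg by simp
  then show "\<exists>d. (v has_real_derivative d) (at z) \<and> 0 \<le> d" for z
    using flux_pair_DERIV(2)[OF assms(1)] by blast
qed

lemma flux_pair_decreasing:
  assumes "flux_pair \<phi> v" "x \<le> y" "\<And>z. x \<le> z \<Longrightarrow> z \<le> y \<Longrightarrow> 0 \<le> v z" shows "\<phi> y \<le> \<phi> x"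
proof (rule DERIV_nonpos_imp_nonincreasing[OF assms(2)])
  fix z assume "x \<le> z" "z \<le> y"
  then have "- v z / r z \<le> 0" using r_pos[of z] assms(3)[of z] by (simp add: divide_nonpos_pos)
  then show "\<exists>d. (\<phi> has_real_derivative d) (at z) \<and> d \<le> 0"
    using flux_pair_DERIV(1)[OF assms(1)] by blast
qed

lemma flux_pair_strict_decreasing:
  assumes "flux_pair \<phi> v" "x < y" "\<And>z. x < z \<Longrightarrow> z < y \<Longrightarrow> 0 < v z" shows "\<phi> y < \<phi> x"
proof -
  obtain z where z: "x < z" "z < y" "\<phi> y - \<phi> x = (y - x) * (- v z / r z)"
    using MVT2[OF assms(2), of \<phi> "\<lambda>z. - v z / r z"] flux_pair_DERIV(1)[OF assms(1)] by blast
  have "(y - x) * (- v z / r z) < 0"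
    using assms(2) assms(3)[OF z(1,2)] r_pos[of z] by (intro mult_pos_neg) auto
  then show ?thesis using z(3) by simp
qed

text \<open>The constant pair \<open>(1, 0)\<close> is a solution, and this is forward uniqueness for it: \<open>v\<^sup>2 + (1 - \<phi>)\<^sup>2\<close>
  satisfies a Gronwall inequality on every compact interval.\<close>

lemma flux_pair_stays_at_one:
  assumes s: "flux_pair \<phi> v" and "\<phi> x0 = 1" "v x0 = 0" "x0 \<le> x1"
  shows "\<phi> x1 = 1"
proof -
  define K where "K = c * (1 + p)"
  have "compact ((\<lambda>x. r x * K + 1 / r x) ` {x0..x1})"
  proof (rule compact_continuous_image)
    have "continuous_on UNIV (\<lambda>x. r x * K + 1 / r x)"
      by (rule continuous_on_add[OF continuous_on_mult[OF r_cont continuous_on_const] inv_r_cont])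
    then show "continuous_on {x0..x1} (\<lambda>x. r x * K + 1 / r x)" by (rule continuous_on_subset) simp
  qed simp
  then obtain C where "\<forall>y\<in>(\<lambda>x. r x * K + 1 / r x) ` {x0..x1}. norm y \<le> C"
    using compact_imp_bounded bounded_iff by blast
  then have C: "\<forall>x\<in>{x0..x1}. r x * K + 1 / r x \<le> C" by (auto dest: abs_le_D1)
  define E where "E x = (v x)\<^sup>2 + (1 - \<phi> x)\<^sup>2" for x
  define E' where "E' x = 2 * v x * (r x * R01 (\<phi> x)) + 2 * (1 - \<phi> x) * (v x / r x)" for x
  have dE: "(E has_real_derivative E' x) (at x)" for x
    unfolding E_def E'_def
    using flux_pair_DERIV[OF s, of x] by (auto intro!: derivative_eq_intros simp: power2_eq_square)
  have E'_le: "E' x \<le> C * E x" if x: "x \<in> {x0..x1}" for x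
  proof -
    have "\<bar>R01 (\<phi> x)\<bar> \<le> K * \<bar>1 - \<phi> x\<bar>"
      using R01_lipschitz[of 1 "\<phi> x"] by (simp add: K_def R01_ge_1_arg)
    then have "\<bar>v x\<bar> * (r x * \<bar>R01 (\<phi> x)\<bar>) \<le> \<bar>v x\<bar> * (r x * (K * \<bar>1 - \<phi> x\<bar>))"
      using r_pos[of x] by (intro mult_left_mono) auto
    moreover have "v x * (r x * R01 (\<phi> x)) \<le> \<bar>v x\<bar> * (r x * \<bar>R01 (\<phi> x)\<bar>)"
      using abs_ge_self[of "v x * (r x * R01 (\<phi> x))"] r_pos[of x] by (simp only: abs_mult abs_of_pos)
    ultimately have 1: "v x * (r x * R01 (\<phi> x)) \<le> \<bar>v x\<bar> * (r x * (K * \<bar>1 - \<phi> x\<bar>))"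
      by linarith
    have 2: "(1 - \<phi> x) * (v x / r x) \<le> \<bar>1 - \<phi> x\<bar> * (\<bar>v x\<bar> / r x)"
      using abs_ge_self[of "(1 - \<phi> x) * (v x / r x)"] r_pos[of x] by (simp only: abs_mult abs_divide abs_of_pos)
    have "E' x = 2 * (v x * (r x * R01 (\<phi> x))) + 2 * ((1 - \<phi> x) * (v x / r x))"
      by (simp only: E'_def mult.assoc)
    also have "\<dots> \<le> 2 * (\<bar>v x\<bar> * (r x * (K * \<bar>1 - \<phi> x\<bar>))) + 2 * (\<bar>1 - \<phi> x\<bar> * (\<bar>v x\<bar> / r x))"
      using 1 2 by linarith
    also have "\<dots> = 2 * (\<bar>v x\<bar> * \<bar>1 - \<phi> x\<bar>) * (r x * K + 1 / r x)"
      by (simp add: distrib_left)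
    also have "\<dots> \<le> E x * (r x * K + 1 / r x)"
    proof (rule mult_right_mono)
      show "2 * (\<bar>v x\<bar> * \<bar>1 - \<phi> x\<bar>) \<le> E x"
        using sum_squares_bound[of "\<bar>v x\<bar>" "\<bar>1 - \<phi> x\<bar>"] by (simp add: E_def mult.assoc)
      show "0 \<le> r x * K + 1 / r x" using r_pos[of x] c p by (simp add: K_def)
    qed
    also have "\<dots> \<le> E x * C" using C x by (intro mult_left_mono) (auto simp: E_def)
    finally show ?thesis by (simp add: mult.commute)
  qed
  have "E x1 * exp (- C * x1) \<le> E x0 * exp (- C * x0)"
  proof (rule DERIV_nonpos_imp_nonincreasing[OF \<open>x0 \<le> x1\<close>])
    fix x assume "x0 \<le> x" "x \<le> x1"
    then have "(E' x - C * E x) * exp (- C * x) \<le> 0"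
      using E'_le[of x] by (intro mult_nonpos_nonneg) auto
    moreover have "((\<lambda>x. E x * exp (- C * x)) has_real_derivative (E' x - C * E x) * exp (- C * x)) (at x)"
      using dE[of x] by (auto intro!: derivative_eq_intros simp: algebra_simps)
    ultimately show "\<exists>d. ((\<lambda>x. E x * exp (- C * x)) has_real_derivative d) (at x) \<and> d \<le> 0" by blast
  qed
  then have "E x1 \<le> 0" using assms by (simp add: E_def mult_le_0_iff)
  then show ?thesis by (simp add: E_def sum_power2_le_zero_iff)
qed

section \<open>Existence of the profile by shooting\<close>

definition decaying_pair :: "real \<Rightarrow> (real \<Rightarrow> real) \<Rightarrow> (real \<Rightarrow> real) \<Rightarrow> bool" where
  "decaying_pair M \<phi> v \<longleftrightarrow> flux_pair \<phi> v \<and> (v \<longlongrightarrow> M) at_top \<and> (\<phi> \<longlongrightarrow> 0) at_top"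

lemma decaying_pair_v_le:
  assumes "decaying_pair M \<phi> v" shows "v x \<le> M"
proof (rule DERIV_nonneg_tendsto_ge[where f = v])
  show "(v has_real_derivative r y * R01 (\<phi> y)) (at y)" for y
    using assms flux_pair_DERIV by (auto simp: decaying_pair_def)
  show "0 \<le> r y * R01 (\<phi> y)" for y using r_pos[of y] R01_nonneg by simp
qed (use assms in \<open>simp add: decaying_pair_def\<close>)

lemma decaying_pair_ge_\<theta>:
  assumes s: "decaying_pair M \<phi> v" and k: "\<And>y. y \<ge> x \<Longrightarrow> k \<le> v y"
  shows "k * \<theta> x \<le> \<phi> x"
proof -
  have "0 \<le> \<phi> x - k * \<theta> x"
  proof (rule DERIV_nonpos_tendsto_le[where f = "\<lambda>x. \<phi> x - k * \<theta> x"])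
    show "((\<lambda>x. \<phi> x - k * \<theta> x) has_real_derivative - v y / r y - k * (- 1 / r y)) (at y)" for y
      using s flux_pair_DERIV(1) by (intro DERIV_diff DERIV_cmult \<theta>_DERIV) (auto simp: decaying_pair_def)
    show "- v y / r y - k * (- 1 / r y) \<le> 0" if "x \<le> y" for y
      using k[OF that] r_pos[of y] by (simp add: field_simps)
    show "((\<lambda>x. \<phi> x - k * \<theta> x) \<longlongrightarrow> 0) at_top"
      using tendsto_diff[OF _ tendsto_mult_left[OF \<theta>_tendsto_0, of k], of \<phi> 0] s by (simp add: decaying_pair_def)
  qed
  then show ?thesis by simp
qed

lemma decaying_pair_le_\<theta>:
  assumes s: "decaying_pair M \<phi> v" shows "\<phi> x \<le> M * \<theta> x"
proof -
  have "\<phi> x - M * \<theta> x \<le> 0"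
  proof (rule DERIV_nonneg_tendsto_ge[where f = "\<lambda>x. \<phi> x - M * \<theta> x"])
    show "((\<lambda>x. \<phi> x - M * \<theta> x) has_real_derivative - v y / r y - M * (- 1 / r y)) (at y)" for y
      using s flux_pair_DERIV(1) by (intro DERIV_diff DERIV_cmult \<theta>_DERIV) (auto simp: decaying_pair_def)
    show "0 \<le> - v y / r y - M * (- 1 / r y)" for y
      using decaying_pair_v_le[OF s, of y] r_pos[of y] by (simp add: field_simps)
    show "((\<lambda>x. \<phi> x - M * \<theta> x) \<longlongrightarrow> 0) at_top"
      using tendsto_diff[OF _ tendsto_mult_left[OF \<theta>_tendsto_0, of M], of \<phi> 0] s by (simp add: decaying_pair_def)
  qed
  then show ?thesis by simp
qed

text \<open>The loss of flux on \<open>[x, \<infinity>)\<close>, relative to \<open>M\<close>, is at most \<open>\<Theta> x\<close>.\<close>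

definition \<Theta> :: "real \<Rightarrow> real" where "\<Theta> x = c * tail (\<lambda>x. r x * \<theta> x) x"

lemma \<Theta>_DERIV: "(\<Theta> has_real_derivative c * - (r x * \<theta> x)) (at x)"
  unfolding \<Theta>_def by (intro DERIV_cmult tail_DERIV r_\<theta>_tail_integrable)

lemma \<Theta>_tendsto_0: "(\<Theta> \<longlongrightarrow> 0) at_top"
  using tendsto_mult_left[OF tail_tendsto_0[OF r_\<theta>_tail_integrable], of c]
  by (simp add: \<Theta>_def[abs_def])

lemma R01_le:
  assumes "s \<le> t" "0 \<le> t" shows "R01 s \<le> c * t"
proof (cases "0 \<le> s \<and> s \<le> 1")
  case True
  then have "R01 s \<le> c * s" using R_le by (simp add: R01_eq)
  also have "\<dots> \<le> c * t" using assms c by simp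
  finally show ?thesis .
next
  case False
  then have "R01 s = 0" by (auto simp: R01_nonpos_arg R01_ge_1_arg)
  then show ?thesis using assms c by simp
qed

lemma decaying_pair_v_ge:
  assumes s: "decaying_pair M \<phi> v" and "0 \<le> M"
  shows "M * (1 - \<Theta> x) \<le> v x"
proof -
  have "M + M * 0 \<le> v x + M * \<Theta> x"
  proof (rule DERIV_nonpos_tendsto_le[where f = "\<lambda>x. v x + M * \<Theta> x"])
    show "((\<lambda>x. v x + M * \<Theta> x) has_real_derivative r y * R01 (\<phi> y) + M * (c * - (r y * \<theta> y))) (at y)" for y
      using s flux_pair_DERIV(2) by (intro DERIV_add DERIV_cmult \<Theta>_DERIV) (auto simp: decaying_pair_def)
    show "r y * R01 (\<phi> y) + M * (c * - (r y * \<theta> y)) \<le> 0" for y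
    proof -
      have "R01 (\<phi> y) \<le> c * (M * \<theta> y)"
        using decaying_pair_le_\<theta>[OF s] \<open>0 \<le> M\<close> \<theta>_pos[of y] by (intro R01_le) auto
      then have "r y * R01 (\<phi> y) \<le> r y * (c * (M * \<theta> y))"
        using r_pos[of y] by (intro mult_left_mono) auto
      then show ?thesis by (simp add: mult_ac)
    qed
    show "((\<lambda>x. v x + M * \<Theta> x) \<longlongrightarrow> M + M * 0) at_top"
      using s by (intro tendsto_intros \<Theta>_tendsto_0) (simp add: decaying_pair_def)
  qed
  then show ?thesis by (simp add: right_diff_distrib)
qed

text \<open>From some point on, which does not depend on \<open>M\<close>, at most half of the flux is lost. So, with \<open>\<phi> \<le> M \<theta>\<close>, all
  solutions of the family are comparable to \<open>M \<theta>\<close> there.\<close>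

lemma flux_ge_half:
  obtains x0 where "x0 \<ge> 0" "\<And>M \<phi> v x. decaying_pair M \<phi> v \<Longrightarrow> 0 < M \<Longrightarrow> x0 \<le> x \<Longrightarrow> M / 2 \<le> v x"
proof -
  have "\<forall>\<^sub>F x in at_top. \<Theta> x < 1 / 2" using \<Theta>_tendsto_0 by (rule order_tendstoD) simp
  then obtain x0 where x0: "\<And>x. x \<ge> x0 \<Longrightarrow> \<Theta> x < 1 / 2" by (auto simp: eventually_at_top_linorder)
  have "M / 2 \<le> v x" if "decaying_pair M \<phi> v" "0 < M" "max 0 x0 \<le> x" for M \<phi> v x
  proof -
    have "M * (1 / 2) \<le> M * (1 - \<Theta> x)" using that(2,3) x0[of x] by (intro mult_left_mono) auto
    also have "\<dots> \<le> v x" using that by (intro decaying_pair_v_ge) auto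
    finally show ?thesis by simp
  qed
  then show thesis by (intro that[of "max 0 x0"]) auto
qed

text \<open>Between a point where \<open>\<phi> > 1\<close> and the next point where \<open>\<phi> = 1\<close> the flux is positive somewhere, say at \<open>z\<close>.
  To the right of \<open>z\<close> it can only grow. To the left it stays constant: as long as it is positive, \<open>\<phi> \<ge> \<phi> z > 1\<close>,
  where the clamped reaction vanishes. So overshooting excludes a negative flux.\<close>

lemma overshoot_imp_v_pos:
  assumes s: "decaying_pair M \<phi> v" and "1 < \<phi> x1"
  shows "0 < v x"
proof -
  have pair: "flux_pair \<phi> v" and lim: "(\<phi> \<longlongrightarrow> 0) at_top" using s by (auto simp: decaying_pair_def)
  have cont: "continuous_on UNIV (\<lambda>x. \<phi> x - 1)"
    by (intro continuous_intros flux_pair_continuous[OF pair])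
  have "\<forall>\<^sub>F x in at_top. \<phi> x < 1" using lim by (rule order_tendstoD) simp
  then have "\<forall>\<^sub>F x in at_top. \<phi> x < 1 \<and> x1 \<le> x"
    using eventually_ge_at_top[of x1] by eventually_elim simp
  then obtain x2 where x2: "\<phi> x2 < 1" "x1 \<le> x2" by (auto simp: eventually_at_top_linorder)
  obtain e where e: "x1 < e" "\<phi> e - 1 = 0" "\<And>y. x1 \<le> y \<Longrightarrow> y < e \<Longrightarrow> 0 < \<phi> y - 1"
    using first_zero_after[OF cont, of x1 x2] x2 assms(2) by auto
  obtain z where z: "x1 < z" "z < e" "\<phi> e - \<phi> x1 = (e - x1) * (- v z / r z)"
    using MVT2[OF e(1), of \<phi> "\<lambda>z. - v z / r z"] flux_pair_DERIV(1)[OF pair] by blast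
  have "(e - x1) * (- v z / r z) < 0" using z(3) e(2) assms(2) by linarith
  then have vz: "0 < v z"
    using e(1) r_pos[of z] by (auto simp: mult_less_0_iff zero_less_divide_iff zero_less_mult_iff)
  have \<phi>z: "1 < \<phi> z" using e(3)[of z] z by auto
  show ?thesis
  proof (cases "z \<le> x")
    case True
    then show ?thesis using flux_pair_v_mono[OF pair True] vz by simp
  next
    case False
    show ?thesis
    proof (rule ccontr)
      assume "\<not> 0 < v x"
      then obtain t where t: "t < z" "v t = 0" "\<And>y. t < y \<Longrightarrow> y \<le> z \<Longrightarrow> 0 < v y"
        using last_zero_before[OF flux_pair_continuous(2)[OF pair], of x z] False vz by auto
      obtain y where y: "t < y" "y < z" "v z - v t = (z - t) * (r y * R01 (\<phi> y))"
        using MVT2[OF t(1), of v "\<lambda>y. r y * R01 (\<phi> y)"] flux_pair_DERIV(2)[OF pair] by blast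
      have "\<phi> z \<le> \<phi> y" using t(3) y by (intro flux_pair_decreasing[OF pair]) (auto simp: less_imp_le)
      then have "R01 (\<phi> y) = 0" using \<phi>z by (intro R01_ge_1_arg) simp
      then show False using y(3) t(2) vz by simp
    qed
  qed
qed

lemma overshoot_exists:
  assumes S: "\<And>M. decaying_pair M (\<phi> M) (v M)"
  shows "\<exists>M>0. \<exists>x. 1 < \<phi> M x"
proof -
  obtain x0 where x0: "\<And>M \<phi> v x. decaying_pair M \<phi> v \<Longrightarrow> 0 < M \<Longrightarrow> x0 \<le> x \<Longrightarrow> M / 2 \<le> v x"
    using flux_ge_half by metis
  define M where "M = 4 / \<theta> x0"
  have M: "0 < M" using \<theta>_pos by (simp add: M_def)
  have "M / 2 * \<theta> x0 \<le> \<phi> M x0"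
    using x0[OF S M] by (intro decaying_pair_ge_\<theta>[OF S])
  moreover have "M / 2 * \<theta> x0 = 2" using \<theta>_pos[of x0] by (simp add: M_def)
  ultimately show ?thesis using M by (intro exI[of _ M] conjI exI[of _ x0]) auto
qed

lemma R_ge_linear:
  assumes "0 \<le> s" "s \<le> 1 / 2"
  shows "c * (1 - (1 / 2) powr (p - 1)) * s \<le> R s"
proof (cases "s = 0")
  case False
  have "s powr p = s * s powr (p - 1)" using False assms by (simp add: powr_diff)
  moreover have "s powr (p - 1) \<le> (1 / 2) powr (p - 1)" using assms p by (intro powr_mono2) auto
  then have "s * s powr (p - 1) \<le> s * (1 / 2) powr (p - 1)" using assms by (intro mult_left_mono) auto
  ultimately have "c * (s - s * (1 / 2) powr (p - 1)) \<le> c * (s - s powr p)"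
    using c by (intro mult_left_mono) auto
  then show ?thesis by (simp add: R_def algebra_simps)
qed simp

text \<open>If the flux stayed nonnegative for small \<open>M\<close>, then \<open>\<phi>\<close> would be at least a fixed multiple of \<open>M\<close> on
  \<open>(-\<infinity>, 0]\<close> and at most \<open>1/2\<close> on \<open>[x1, \<infinity>)\<close>. On the long interval \<open>[x1, 0]\<close> then \<open>v' \<ge> R(\<phi>) \<ge> k \<phi>\<close>, so the
  flux would change by more than \<open>M\<close>.\<close>

lemma undershoot_exists:
  assumes S: "\<And>M. decaying_pair M (\<phi> M) (v M)"
  shows "\<exists>M>0. \<exists>x. v M x < 0"
proof -
  obtain x0 where x0: "x0 \<ge> 0" "\<And>M \<phi> v x. decaying_pair M \<phi> v \<Longrightarrow> 0 < M \<Longrightarrow> x0 \<le> x \<Longrightarrow> M / 2 \<le> v x"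
    using flux_ge_half by metis
  define k where "k = c * (1 - (1 / 2) powr (p - 1))"
  have "(1 / 2 :: real) powr (p - 1) < 1" using p by (simp add: powr01_less_one)
  then have k: "0 < k" using c by (simp add: k_def)
  define q where "q = k * \<theta> x0 / 2"
  have q: "0 < q" using k \<theta>_pos by (simp add: q_def)
  \<comment> \<open>on \<open>[x1, 0]\<close>, a growth rate of \<open>M q\<close> changes the flux by \<open>2 M\<close>\<close>
  define x1 where "x1 = - 2 / q"
  have x1: "x1 < 0" using q by (simp add: x1_def)
  \<comment> \<open>then \<open>\<phi> \<le> M \<theta>(x1) = 1/2\<close> to the right of \<open>x1\<close>\<close>
  define M where "M = 1 / (2 * \<theta> x1)"
  have M: "0 < M" using \<theta>_pos by (simp add: M_def)
  have pair: "flux_pair (\<phi> M) (v M)" using S[of M] by (simp add: decaying_pair_def)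
  have "\<exists>x. v M x < 0"
  proof (rule ccontr)
    assume "\<nexists>x. v M x < 0"
    then have nn: "0 \<le> v M x" for x by (auto simp: not_less)
    have low: "M * q / k \<le> \<phi> M x" if "x \<le> 0" for x
    proof -
      have "M / 2 * \<theta> x0 \<le> \<phi> M x0" using x0(2)[OF S M] by (intro decaying_pair_ge_\<theta>[OF S])
      also have "\<phi> M x0 \<le> \<phi> M x" using that x0(1) nn by (intro flux_pair_decreasing[OF pair]) auto
      finally show ?thesis using k by (simp add: q_def)
    qed
    have up: "\<phi> M x \<le> 1 / 2" if "x1 \<le> x" for x
    proof -
      have "\<phi> M x \<le> \<phi> M x1" using nn by (intro flux_pair_decreasing[OF pair that])
      also have "\<dots> \<le> M * \<theta> x1" by (rule decaying_pair_le_\<theta>[OF S])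
      finally show ?thesis using \<theta>_pos[of x1] by (simp add: M_def)
    qed
    obtain z where z: "x1 < z" "z < 0" "v M 0 - v M x1 = (0 - x1) * (r z * R01 (\<phi> M z))"
      using MVT2[OF x1, of "v M" "\<lambda>z. r z * R01 (\<phi> M z)"] flux_pair_DERIV(2)[OF pair] by blast
    have p0: "0 \<le> \<phi> M z" using low[of z] z M q k by (intro order_trans[OF _ low]) auto
    have "M * q = k * (M * q / k)" using k by simp
    also have "\<dots> \<le> k * \<phi> M z" using low[of z] z k by (intro mult_left_mono) auto
    also have "\<dots> \<le> R01 (\<phi> M z)"
      using R_ge_linear[of "\<phi> M z"] up[of z] z p0 by (simp add: R01_eq k_def)
    also have "\<dots> \<le> r z * R01 (\<phi> M z)"
      using mult_right_mono[OF r_ge_1[of z] R01_nonneg[of "\<phi> M z"]] z by simp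
    finally have "(0 - x1) * (M * q) \<le> v M 0 - v M x1"
      unfolding z(3) using x1 by (intro mult_left_mono) auto
    moreover have "(0 - x1) * (M * q) = 2 * M" using q by (simp add: x1_def)
    ultimately show False
      using decaying_pair_v_le[OF S, of M 0] nn[of x1] M by linarith
  qed
  with M show ?thesis by blast
qed

text \<open>The set \<open>U\<close> of overshooting and the set \<open>V\<close> of undershooting values are open, nonempty and disjoint in
  the connected half-line \<open>M > 0\<close>, hence do not cover it.\<close>

lemma critical_pair_exists:
  obtains M \<phi> v where "0 < M" "decaying_pair M \<phi> v" "\<And>x. 0 \<le> v x" "\<And>x. \<phi> x \<le> 1"
proof -
  have K: "0 \<le> c * (1 + p)" using c p by simp
  obtain v \<phi> :: "real \<Rightarrow> real \<Rightarrow> real" and B where vp: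
    "\<And>M x. (\<phi> M has_real_derivative - v M x / r x) (at x)"
    "\<And>M x. (v M has_real_derivative r x * R01 (\<phi> M x)) (at x)"
    "\<And>M. (v M \<longlongrightarrow> M) at_top" "\<And>M. (\<phi> M \<longlongrightarrow> 0) at_top"
    "\<And>M M' x. \<bar>v M x - v M' x\<bar> \<le> B x * \<bar>M - M'\<bar>"
    "\<And>M M' x. \<bar>\<phi> M x - \<phi> M' x\<bar> \<le> B x * \<bar>M - M'\<bar>"
    using shooting_from_infinity[OF r_cont r_pos inv_r_tail_integrable
        r_\<theta>_tail_integrable[unfolded \<theta>_def] R01_lipschitz R01_nonpos_arg[OF order_refl] K] by metis
  have S: "decaying_pair M (\<phi> M) (v M)" for M
    using vp by (simp add: decaying_pair_def flux_pair_def)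
  have cont: "continuous_on UNIV (\<lambda>M. f M x)"
    if "\<And>M M'. \<bar>f M x - f M' x\<bar> \<le> B x * \<bar>M - M'\<bar>" for f :: "real \<Rightarrow> real \<Rightarrow> real" and x
  proof (rule lipschitz_on_continuous_on[where L = "\<bar>B x\<bar>"], rule lipschitz_onI)
    show "dist (f M x) (f M' x) \<le> \<bar>B x\<bar> * dist M M'" for M M'
      using order_trans[OF that[of M M'] mult_right_mono[of "B x" "\<bar>B x\<bar>" "\<bar>M - M'\<bar>"]]
      by (simp add: dist_real_def)
  qed simp
  define U where "U = (\<Union>x. {M. 1 < \<phi> M x})"
  define V where "V = (\<Union>x. {M. v M x < 0})"
  have "open U" "open V" unfolding U_def V_def
    by (intro open_UN ballI open_Collect_less continuous_on_const cont vp(5,6))+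
  moreover have "U \<inter> V \<inter> {0<..} = {}"
  proof -
    have "0 < v M x" if "1 < \<phi> M y" for M x y by (rule overshoot_imp_v_pos[OF S that])
    then show ?thesis unfolding U_def V_def by (auto dest: less_asym)
  qed
  moreover have "U \<inter> {0<..} \<noteq> {}" "V \<inter> {0<..} \<noteq> {}"
    using overshoot_exists[OF S] undershoot_exists[OF S] by (auto simp: U_def V_def)
  ultimately have "\<not> {0<..} \<subseteq> U \<union> V"
    using connectedD[OF connected_Ioi[of "0 :: real"], of U V] by blast
  then obtain M where "0 < M" "M \<notin> U" "M \<notin> V" by auto
  with S[of M] show thesis by (intro that[of M "\<phi> M" "v M"]) (auto simp: U_def V_def not_less)
qed

definition profile :: "(real \<Rightarrow> real) \<Rightarrow> (real \<Rightarrow> real) \<Rightarrow> bool" where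
  "profile \<phi> v \<longleftrightarrow> (\<forall>x. (\<phi> has_real_derivative - v x / r x) (at x)) \<and>
    (\<forall>x. (v has_real_derivative r x * R (\<phi> x)) (at x)) \<and> (\<forall>x. 0 < \<phi> x \<and> \<phi> x < 1) \<and> (\<forall>x. 0 < v x)"

text \<open>For a critical value the weak inequalities become strict: a zero of the flux would propagate to
  \<open>-\<infinity>\<close>, where then the reaction vanishes and \<open>\<phi> = 1\<close>. By forward uniqueness \<open>\<phi>\<close> would be 1 from there on,
  against its decay.\<close>

lemma profile_exists:
  obtains M \<phi> v where "0 < M" "decaying_pair M \<phi> v" "profile \<phi> v"
proof -
  obtain M \<phi> v where M: "0 < M" and S: "decaying_pair M \<phi> v" and v0: "\<And>x. 0 \<le> v x" and \<phi>1: "\<And>x. \<phi> x \<le> 1"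
    using critical_pair_exists by metis
  have pair: "flux_pair \<phi> v" and lim: "(\<phi> \<longlongrightarrow> 0) at_top" "(v \<longlongrightarrow> M) at_top" using S by (auto simp: decaying_pair_def)
  have not_stay: False if "\<phi> x = 1" "v x = 0" for x
  proof -
    have "\<forall>\<^sub>F y in at_top. \<phi> y = 1"
      using flux_pair_stays_at_one[OF pair that] by (intro eventually_at_top_linorderI[of x])
    then have "(\<phi> \<longlongrightarrow> 1) at_top" by (rule tendsto_eventually)
    with lim(1) show False using tendsto_unique[of at_top \<phi> 0 1] by simp
  qed
  have \<phi>0: "0 < \<phi> x" for x
  proof -
    obtain x0 where x0: "\<And>M \<phi> v x. decaying_pair M \<phi> v \<Longrightarrow> 0 < M \<Longrightarrow> x0 \<le> x \<Longrightarrow> M / 2 \<le> v x"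
      using flux_ge_half by metis
    let ?y = "max x x0"
    have "M / 2 * \<theta> ?y \<le> \<phi> ?y" using x0[OF S M] by (intro decaying_pair_ge_\<theta>[OF S]) auto
    moreover have "0 < M / 2 * \<theta> ?y" using M \<theta>_pos by simp
    moreover have "\<phi> ?y \<le> \<phi> x" using v0 by (intro flux_pair_decreasing[OF pair]) auto
    ultimately show ?thesis by linarith
  qed
  have vpos: "0 < v x" for x
  proof (rule ccontr)
    assume "\<not> 0 < v x"
    then have "v x = 0" using v0[of x] by simp
    then have v00: "v y = 0" if "y \<le> x" for y using flux_pair_v_mono[OF pair that] v0[of y] by simp
    obtain z where z: "x - 1 < z" "z < x" "v x - v (x - 1) = (x - (x - 1)) * (r z * R01 (\<phi> z))"
      using MVT2[of "x - 1" x v "\<lambda>z. r z * R01 (\<phi> z)"] flux_pair_DERIV(2)[OF pair] by auto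
    then have "R01 (\<phi> z) = 0" using v00[of x] v00[of "x - 1"] by simp
    then have "\<phi> z = 1" using R_pos[of "\<phi> z"] \<phi>0[of z] \<phi>1[of z] by (fastforce simp: R01_eq)
    with not_stay[of z] v00[of z] z show False by simp
  qed
  have \<phi>lt: "\<phi> x < 1" for x
    using flux_pair_strict_decreasing[OF pair, of "x - 1" x] vpos \<phi>1[of "x - 1"] by force
  have "profile \<phi> v"
    unfolding profile_def using flux_pair_DERIV[OF pair] \<phi>0 \<phi>1 \<phi>lt vpos by (simp add: R01_eq less_imp_le)
  with M S that show thesis by blast
qed

section \<open>Limits and asymptotics of the profile\<close>

lemma R_continuous: "continuous_on {0..1} R"
proof (rule lipschitz_on_continuous_on[where L = "c * (1 + p)"], rule lipschitz_onI)
  show "dist (R s) (R t) \<le> c * (1 + p) * dist s t" if "s \<in> {0..1}" "t \<in> {0..1}" for s t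
    using R01_lipschitz[of s t] that by (simp add: R01_eq dist_real_def)
qed (use c p in simp)

lemma r_at_bot: "filterlim r at_top at_bot"
proof (rule filterlim_at_top_mono)
  show "filterlim (\<lambda>z. exp (- a * z)) at_top at_bot" using a by real_asymp
qed (intro always_eventually allI r_ge)

lemma r_at_top: "filterlim r at_top at_top"
  unfolding r_def by real_asymp

lemma bounded_div_r_tendsto_0:
  assumes "\<And>x. \<bar>f x\<bar> \<le> B" shows "((\<lambda>x. f x / r x) \<longlongrightarrow> 0) at_bot" "((\<lambda>x. f x / r x) \<longlongrightarrow> 0) at_top"
proof -
  have "norm (f x / r x) \<le> B / r x" for x
    using assms[of x] r_pos[of x] by (simp add: divide_right_mono)
  then show "((\<lambda>x. f x / r x) \<longlongrightarrow> 0) at_bot" "((\<lambda>x. f x / r x) \<longlongrightarrow> 0) at_top"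
    using r_at_bot r_at_top
    by (auto intro!: Lim_null_comparison[where g = "\<lambda>x. B / r x"] real_tendsto_divide_at_top[OF tendsto_const])
qed

lemma profile_antimono: "profile \<phi> v \<Longrightarrow> x < y \<Longrightarrow> \<phi> y < \<phi> x"
  using flux_pair_strict_decreasing[of \<phi> v x y] by (auto simp: profile_def flux_pair_def R01_eq less_imp_le)

lemma profile_flux_pair: "profile \<phi> v \<Longrightarrow> flux_pair \<phi> v"
  by (auto simp: profile_def flux_pair_def R01_eq less_imp_le)

text \<open>If \<open>\<phi>\<close> stayed below some \<open>t < 1\<close>, then \<open>R(\<phi>)\<close> would be bounded below on \<open>(-\<infinity>, 0]\<close>, and the
  positive flux would decrease at least linearly towards \<open>-\<infinity>\<close>.\<close>

lemma profile_tendsto_1: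
  assumes pr: "profile \<phi> v"
  shows "(\<phi> \<longlongrightarrow> 1) at_bot"
proof (rule order_tendstoI)
  fix t :: real assume "1 < t"
  then show "\<forall>\<^sub>F x in at_bot. \<phi> x < t"
    using pr by (intro always_eventually allI) (force simp: profile_def intro: less_trans)
next
  fix t :: real assume t: "t < 1"
  have "\<exists>x. t < \<phi> x"
  proof (rule ccontr)
    assume "\<nexists>x. t < \<phi> x"
    then have le: "\<phi> x \<le> t" for x by (auto simp: not_less)
    have range: "0 < \<phi> x" "\<phi> x < 1" for x using pr by (auto simp: profile_def)
    have ne: "{\<phi> 0..t} \<noteq> {}" using le[of 0] by simp
    obtain s where s: "s \<in> {\<phi> 0..t}" "\<And>y. y \<in> {\<phi> 0..t} \<Longrightarrow> R s \<le> R y"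
    proof -
      have "continuous_on {\<phi> 0..t} R"
        using range[of 0] t by (intro continuous_on_subset[OF R_continuous]) auto
      from continuous_attains_inf[OF compact_Icc ne this] show thesis using that by blast
    qed
    have k: "0 < R s" using s(1) range[of 0] t by (intro R_pos) auto
    define x where "x = - (v 0 / R s)"
    have v0: "0 < v y" for y using pr by (simp add: profile_def)
    have x: "x < 0" using k v0[of 0] by (simp add: x_def)
    obtain z where z: "x < z" "z < 0" "v 0 - v x = (0 - x) * (r z * R (\<phi> z))"
      using MVT2[OF x, of v "\<lambda>z. r z * R (\<phi> z)"] pr by (auto simp: profile_def)
    have "R s \<le> R (\<phi> z)" using profile_antimono[OF pr z(2)] le by (intro s(2)) (simp add: less_imp_le)
    also have "\<dots> \<le> r z * R (\<phi> z)"
      using mult_right_mono[OF r_ge_1[of z] R_nonneg[of "\<phi> z"]] z range[of z] by (simp add: less_imp_le)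
    finally have "(0 - x) * R s \<le> v 0 - v x" unfolding z(3) using x by (intro mult_left_mono) auto
    moreover have "(0 - x) * R s = v 0" using k by (simp add: x_def)
    ultimately show False using v0[of x] by simp
  qed
  then obtain x where x: "t < \<phi> x" ..
  then have "t < \<phi> y" if "y \<le> x" for y
    using profile_antimono[OF pr, of y x] that by (cases "y = x") auto
  then show "\<forall>\<^sub>F x in at_bot. t < \<phi> x" by (auto simp: eventually_at_bot_linorder)
qed

lemma profile_asymptotics:
  assumes S: "decaying_pair M \<phi> v"
  shows "((\<lambda>x. \<phi> x / (exp (- 2 * x) * (1 / r x))) \<longlongrightarrow> 2 * M) at_top"
  using S flux_pair_DERIV(1) by (intro tendsto_ratio_weighted[of \<phi> v]) (auto simp: decaying_pair_def)

lemma profile_v_bounds: "profile \<phi> v \<Longrightarrow> decaying_pair M \<phi> v \<Longrightarrow> \<bar>v x\<bar> \<le> M"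
  using decaying_pair_v_le[of M \<phi> v x] by (auto simp: profile_def less_imp_le)

lemma inv_r_le: "1 / r x \<le> exp (a * x)"
proof -
  have "1 / r x \<le> 1 / exp (- a * x)" by (intro divide_left_mono r_ge) (auto simp: r_pos)
  then show ?thesis by (simp add: exp_minus field_simps)
qed

lemma exp_at_bot: "((\<lambda>x. k * exp (a * x)) \<longlongrightarrow> 0) at_bot"
proof -
  have "((\<lambda>x. exp (a * x)) \<longlongrightarrow> 0) at_bot" using a by real_asymp
  from tendsto_mult_left[OF this, of k] show ?thesis by simp
qed

lemma one_minus_profile_le:
  assumes pr: "profile \<phi> v" and S: "decaying_pair M \<phi> v"
  shows "1 - \<phi> x \<le> M / a * exp (a * x)"
proof -
  have "0 \<le> M / a * exp (a * x) - (1 - \<phi> x)"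
  proof (rule DERIV_nonneg_tendsto_at_bot_le[where f = "\<lambda>x. M / a * exp (a * x) - (1 - \<phi> x)"])
    show "((\<lambda>x. M / a * exp (a * x) - (1 - \<phi> x)) has_real_derivative M * exp (a * y) - (0 - - v y / r y)) (at y)" for y
    proof (intro DERIV_diff DERIV_const)
      show "((\<lambda>x. M / a * exp (a * x)) has_real_derivative M * exp (a * y)) (at y)"
        using a by (auto intro!: derivative_eq_intros)
      show "(\<phi> has_real_derivative - v y / r y) (at y)" using pr by (simp add: profile_def)
    qed
    show "0 \<le> M * exp (a * y) - (0 - - v y / r y)" for y
    proof -
      have "v y * (1 / r y) \<le> M * exp (a * y)"
        using profile_v_bounds[OF pr S, of y] r_pos[of y] inv_r_le[of y] by (intro mult_mono) auto
      then show ?thesis by simp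
    qed
    show "((\<lambda>x. M / a * exp (a * x) - (1 - \<phi> x)) \<longlongrightarrow> 0) at_bot"
      using tendsto_diff[OF exp_at_bot[of "M / a"] tendsto_diff[OF tendsto_const[of 1] profile_tendsto_1[OF pr]]] by simp
  qed
  then show ?thesis by simp
qed

end

section \<open>Uniqueness\<close>

text \<open>On the component of \<open>{f > 0}\<close> that contains \<open>x0\<close>, \<open>D\<close> is strictly increasing; at the left end of the component
  it is nonnegative, or tends to 0 if the component is unbounded.\<close>

lemma flux_pos_of_positive_part:
  fixes f D :: "real \<Rightarrow> real"
  assumes f: "continuous_on UNIV f"
    and inc: "\<And>x y. x < y \<Longrightarrow> (\<And>z. x < z \<Longrightarrow> z < y \<Longrightarrow> 0 < f z) \<Longrightarrow> D x < D y"
    and zero: "\<And>s y. f s = 0 \<Longrightarrow> s < y \<Longrightarrow> (\<And>z. s < z \<Longrightarrow> z \<le> y \<Longrightarrow> 0 < f z) \<Longrightarrow> 0 \<le> D s"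
    and lim: "(D \<longlongrightarrow> 0) at_bot" and x0: "0 < f x0"
  shows "0 < D x0"
proof (cases "\<exists>x\<le>x0. f x \<le> 0")
  case True
  then obtain x where "x \<le> x0" "f x \<le> 0" by blast
  then obtain s where s: "s < x0" "f s = 0" "\<And>y. s < y \<Longrightarrow> y \<le> x0 \<Longrightarrow> 0 < f y"
    using last_zero_before[OF f, of x x0] x0 by metis
  have "0 \<le> D s" using zero[OF s(2,1)] s(3) by blast
  also have "D s < D x0" using s(3) by (intro inc s(1)) auto
  finally show ?thesis .
next
  case False
  then have pos: "0 < f x" if "x \<le> x0" for x using that by (meson not_le)
  have "0 \<le> D (x0 - 1)"
  proof (rule tendsto_upperbound[OF lim])
    show "\<forall>\<^sub>F x in at_bot. D x \<le> D (x0 - 1)"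
      unfolding eventually_at_bot_linorder
    proof (intro exI[of _ "x0 - 2"] allI impI)
      fix x assume "x \<le> x0 - 2"
      then have "D x < D (x0 - 1)" using pos by (intro inc) auto
      then show "D x \<le> D (x0 - 1)" by simp
    qed
  qed simp
  also have "D (x0 - 1) < D x0" using pos by (intro inc) auto
  finally show ?thesis .
qed

text \<open>Applied to \<open>f\<close>, \<open>D\<close> and to their reflections \<open>f (- x)\<close>, \<open>- D (- x)\<close>, the previous lemma gives contradictory signs of
  \<open>D\<close> at a point where \<open>f > 0\<close>.\<close>

lemma nonpos_of_flux:
  fixes f D :: "real \<Rightarrow> real"
  assumes f: "continuous_on UNIV f"
    and inc: "\<And>x y. x < y \<Longrightarrow> (\<And>z. x < z \<Longrightarrow> z < y \<Longrightarrow> 0 < f z) \<Longrightarrow> D x < D y"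
    and left: "\<And>s y. f s = 0 \<Longrightarrow> s < y \<Longrightarrow> (\<And>z. s < z \<Longrightarrow> z \<le> y \<Longrightarrow> 0 < f z) \<Longrightarrow> 0 \<le> D s"
    and right: "\<And>s y. f s = 0 \<Longrightarrow> y < s \<Longrightarrow> (\<And>z. y \<le> z \<Longrightarrow> z < s \<Longrightarrow> 0 < f z) \<Longrightarrow> D s \<le> 0"
    and lim: "(D \<longlongrightarrow> 0) at_bot" "(D \<longlongrightarrow> 0) at_top"
  shows "f x0 \<le> 0"
proof (rule ccontr)
  assume "\<not> f x0 \<le> 0"
  then have x0: "0 < f x0" by simp
  have "0 < D x0" by (rule flux_pos_of_positive_part[OF f inc left lim(1) x0])
  moreover have "0 < - D (- (- x0))"
  proof (rule flux_pos_of_positive_part[where f = "\<lambda>x. f (- x)" and D = "\<lambda>x. - D (- x)"])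
    show "continuous_on UNIV (\<lambda>x. f (- x))"
      by (rule continuous_on_compose2[OF f continuous_on_minus[OF continuous_on_id]]) simp
    show "- D (- x) < - D (- y)" if "x < y" "\<And>z. x < z \<Longrightarrow> z < y \<Longrightarrow> 0 < f (- z)" for x y
      using inc[of "- y" "- x"] that(1) that(2)[of "- z" for z] by force
    show "0 \<le> - D (- s)" if "f (- s) = 0" "s < y" "\<And>z. s < z \<Longrightarrow> z \<le> y \<Longrightarrow> 0 < f (- z)" for s y
      using right[of "- s" "- y"] that(1,2) that(3)[of "- z" for z] by force
    have "((\<lambda>x. - D x) \<longlongrightarrow> 0) at_top" using tendsto_minus[OF lim(2)] by simp
    then show "((\<lambda>x. - D (- x)) \<longlongrightarrow> 0) at_bot"
      by (simp add: filterlim_at_top_mirror)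
    show "0 < f (- (- x0))" using x0 by simp
  qed
  ultimately show False by simp
qed

context profile_ode
begin

text \<open>The reaction divided by \<open>\<phi>\<close> is decreasing in \<open>\<phi>\<close>, which makes the Wronskian monotone wherever \<open>\<phi>1 > \<phi>2\<close>. At a
  point where \<open>\<phi>1 = \<phi>2\<close> its sign is that of the derivative of \<open>\<phi>1 - \<phi>2\<close>.\<close>

lemma wronskian_comparison:
  assumes s1: "flux_pair \<phi>1 w1" and s2: "flux_pair \<phi>2 w2"
    and range: "\<And>x. 0 < \<phi>1 x \<and> \<phi>1 x \<le> 1" "\<And>x. 0 < \<phi>2 x \<and> \<phi>2 x \<le> 1"
    and lim: "((\<lambda>x. w2 x * \<phi>1 x - w1 x * \<phi>2 x) \<longlongrightarrow> 0) at_bot"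
      "((\<lambda>x. w2 x * \<phi>1 x - w1 x * \<phi>2 x) \<longlongrightarrow> 0) at_top"
  shows "\<phi>1 x \<le> \<phi>2 x"
proof -
  let ?D = "\<lambda>x. w2 x * \<phi>1 x - w1 x * \<phi>2 x"
  let ?D' = "\<lambda>x. c * r x * \<phi>1 x * \<phi>2 x * (\<phi>1 x powr (p - 1) - \<phi>2 x powr (p - 1))"
  have D: "(?D has_real_derivative ?D' x) (at x)" for x
  proof -
    have "(?D has_real_derivative (r x * R (\<phi>2 x)) * \<phi>1 x + (- w1 x / r x) * w2 x
        - ((r x * R (\<phi>1 x)) * \<phi>2 x + (- w2 x / r x) * w1 x)) (at x)"
      using flux_pair_DERIV[OF s1, of x] flux_pair_DERIV[OF s2, of x] range(1)[of x] range(2)[of x]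
      by (intro DERIV_diff DERIV_mult) (auto simp: R01_eq less_imp_le)
    moreover have "s powr p = s * s powr (p - 1)" if "0 < s" for s
      using that by (simp add: powr_diff)
    then have Req: "R (\<phi>1 x) = c * (\<phi>1 x - \<phi>1 x * \<phi>1 x powr (p - 1))" "R (\<phi>2 x) = c * (\<phi>2 x - \<phi>2 x * \<phi>2 x powr (p - 1))"
      using range[of x] by (simp_all add: R_def)
    have "(r x * R (\<phi>2 x)) * \<phi>1 x + (- w1 x / r x) * w2 x
        - ((r x * R (\<phi>1 x)) * \<phi>2 x + (- w2 x / r x) * w1 x) = ?D' x"
      unfolding Req by (simp add: algebra_simps)
    ultimately show ?thesis by (simp only:)
  qed
  have slope: "((\<lambda>x. \<phi>1 x - \<phi>2 x) has_real_derivative (w2 x - w1 x) / r x) (at x)" for x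
    using DERIV_diff[OF flux_pair_DERIV(1)[OF s1, of x] flux_pair_DERIV(1)[OF s2, of x]] by (simp add: diff_divide_distrib)
  have flux: "?D s = \<phi>1 s * (w2 s - w1 s)" if "\<phi>1 s - \<phi>2 s = 0" for s
    using that by (simp add: algebra_simps)
  have "\<phi>1 x - \<phi>2 x \<le> 0"
  proof (rule nonpos_of_flux[where f = "\<lambda>x. \<phi>1 x - \<phi>2 x" and D = ?D])
    show "continuous_on UNIV (\<lambda>x. \<phi>1 x - \<phi>2 x)" by (rule DERIV_continuous_on_UNIV[OF slope])
    show "?D x < ?D y" if xy: "x < y" and pos: "\<And>z. x < z \<Longrightarrow> z < y \<Longrightarrow> 0 < \<phi>1 z - \<phi>2 z" for x y
    proof (rule DERIV_pos_imp_increasing_open[where f = ?D, OF xy])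
      fix z assume z: "x < z" "z < y"
      have "\<phi>2 z powr (p - 1) < \<phi>1 z powr (p - 1)"
        using pos[OF z] range(2)[of z] p by (intro powr_less_mono2) auto
      then have "0 < ?D' z" using c r_pos[of z] range[of z] by (intro mult_pos_pos) auto
      then show "\<exists>d. (?D has_real_derivative d) (at z) \<and> 0 < d" using D by blast
    next
      show "continuous_on {x..y} ?D"
        by (rule continuous_on_subset[OF DERIV_continuous_on_UNIV[OF D]]) simp
    qed
    show "0 \<le> ?D s" if s: "\<phi>1 s - \<phi>2 s = 0" and y: "s < y" and pos: "\<And>z. s < z \<Longrightarrow> z \<le> y \<Longrightarrow> 0 < \<phi>1 z - \<phi>2 z" for s y
    proof (rule ccontr)
      assume "\<not> 0 \<le> ?D s"
      then have "w2 s - w1 s < 0" using range(1)[of s] by (simp add: flux[OF s] zero_le_mult_iff)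
      then have "(w2 s - w1 s) / r s < 0" using r_pos[of s] by (simp add: divide_neg_pos)
      from DERIV_neg_dec_right[OF slope this] obtain d where
        d: "d > 0" "\<And>h. 0 < h \<Longrightarrow> h < d \<Longrightarrow> \<phi>1 (s + h) - \<phi>2 (s + h) < \<phi>1 s - \<phi>2 s" by blast
      define h where "h = min (d / 2) (y - s)"
      have "0 < h" "h < d" "s + h \<le> y" using d(1) y by (auto simp: h_def min_def)
      then show False using d(2)[of h] pos[of "s + h"] s by simp
    qed
    show "?D s \<le> 0" if s: "\<phi>1 s - \<phi>2 s = 0" and y: "y < s" and pos: "\<And>z. y \<le> z \<Longrightarrow> z < s \<Longrightarrow> 0 < \<phi>1 z - \<phi>2 z" for s y
    proof (rule ccontr)
      assume "\<not> ?D s \<le> 0"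
      then have "0 < w2 s - w1 s" using range(1)[of s] by (simp add: flux[OF s] mult_le_0_iff)
      then have "0 < (w2 s - w1 s) / r s" using r_pos[of s] by simp
      from DERIV_pos_inc_left[OF slope this] obtain d where
        d: "d > 0" "\<And>h. 0 < h \<Longrightarrow> h < d \<Longrightarrow> \<phi>1 (s - h) - \<phi>2 (s - h) < \<phi>1 s - \<phi>2 s" by blast
      define h where "h = min (d / 2) (s - y)"
      have "0 < h" "h < d" "y \<le> s - h" using d(1) y by (auto simp: h_def min_def)
      then show False using d(2)[of h] pos[of "s - h"] s by simp
    qed
  qed (use lim in auto)
  then show ?thesis by simp
qed

text \<open>Since \<open>R'(1) = - c (p - 1) < 0\<close>, \<open>R\<close> is bounded below near 1 by a multiple of \<open>1 - s\<close>.\<close>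

lemma R_ge_near_1:
  obtains m where "0 < m" "\<And>s. 1 / 2 \<le> s \<Longrightarrow> s \<le> 1 \<Longrightarrow> m * (1 - s) \<le> R s"
proof -
  define q where "q = min 1 (p - 1)"
  have q: "0 < q" "q \<le> 1" using p by (auto simp: q_def)
  have *: "q * (1 - s) \<le> 1 - s powr (p - 1)" if s: "1 / 2 \<le> s" "s \<le> 1" for s
  proof (cases "s = 1")
    case False
    then have lt: "s < 1" using s by simp
    have "((\<lambda>x. x powr q) has_real_derivative q * x powr (q - 1)) (at x)" if "s \<le> x" "x \<le> 1" for x
      using s that by (auto intro!: derivative_eq_intros simp: powr_diff)
    from MVT2[OF lt this] obtain z where z: "s < z" "z < 1" "1 powr q - s powr q = (1 - s) * (q * z powr (q - 1))"
      by blast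
    have "1 \<le> z powr (q - 1)"
      using powr_mono2'[of "q - 1" z 1] z s q by simp
    then have "(1 - s) * (q * 1) \<le> (1 - s) * (q * z powr (q - 1))"
      using lt q by (intro mult_left_mono) auto
    then have "q * (1 - s) \<le> 1 - s powr q" using z(3) by (simp add: mult.commute)
    moreover have "s powr (p - 1) \<le> s powr q" using s by (intro powr_mono') (auto simp: q_def)
    ultimately show ?thesis by simp
  qed simp
  show thesis
  proof (rule that[of "c * (1 / 2) * q"])
    show "0 < c * (1 / 2) * q" using c q by simp
    fix s :: real assume s: "1 / 2 \<le> s" "s \<le> 1"
    have "R s = c * s * (1 - s powr (p - 1))" using s by (simp add: R_def powr_diff algebra_simps)
    moreover have "c * (1 / 2) * (q * (1 - s)) \<le> c * s * (1 - s powr (p - 1))"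
      using *[OF s] s c q by (intro mult_mono) auto
    ultimately show "c * (1 / 2) * q * (1 - s) \<le> R s" by (simp add: mult.assoc)
  qed
qed

text \<open>A positive limit of the flux would give \<open>1 - \<psi> \<ge> k e\<^sup>a\<^sup>x\<close> near \<open>-\<infinity>\<close>. There \<open>r \<ge> e\<^sup>-\<^sup>a\<^sup>x\<close>, so
  \<open>w' = r R(\<psi>)\<close> would be bounded below by a positive constant, and \<open>w\<close> would become negative.\<close>

lemma flux_tendsto_0_at_bot:
  assumes s: "flux_pair \<psi> w" and range: "\<And>x. 0 \<le> \<psi> x \<and> \<psi> x \<le> 1" and w: "\<And>x. 0 \<le> w x"
    and lim: "(\<psi> \<longlongrightarrow> 1) at_bot"
  shows "(w \<longlongrightarrow> 0) at_bot"
proof (rule order_tendstoI)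
  fix t :: real assume "t < 0"
  then show "\<forall>\<^sub>F x in at_bot. t < w x" using w by (intro always_eventually allI) (rule less_le_trans)
next
  fix e :: real assume e: "0 < e"
  have "\<exists>x. w x < e"
  proof (rule ccontr)
    assume "\<nexists>x. w x < e"
    then have we: "e \<le> w x" for x by (auto simp: not_less)
    define k where "k = e * exp (- 1 / 4) / a"
    have k: "0 < k" using e a by (simp add: k_def)
    have low: "k * exp (a * x) \<le> 1 - \<psi> x" if x: "x \<le> 0" for x
    proof -
      have "0 \<le> 1 - \<psi> x - k * exp (a * x)"
      proof (rule DERIV_nonneg_tendsto_at_bot_le[where f = "\<lambda>x. 1 - \<psi> x - k * exp (a * x)"])
        show "((\<lambda>x. 1 - \<psi> x - k * exp (a * x)) has_real_derivative 0 - - w y / r y - k * (a * exp (a * y))) (at y)" for y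
          by (intro DERIV_diff DERIV_const flux_pair_DERIV(1)[OF s]) (auto intro!: derivative_eq_intros)
        show "0 \<le> 0 - - w y / r y - k * (a * exp (a * y))" if "y \<le> x" for y
        proof -
          have "exp (2 * y) \<le> 1" using that x by simp
          then have "exp (- 1 / 4) * exp (a * y) \<le> exp (a * y - exp (2 * y) / 4)"
            by (simp flip: exp_add)
          also have "\<dots> = 1 / r y" by (simp add: r_def exp_diff)
          finally have "e * (exp (- 1 / 4) * exp (a * y)) \<le> w y * (1 / r y)"
            using we[of y] e r_pos[of y] by (intro mult_mono) auto
          then show ?thesis using a by (simp add: k_def)
        qed
        show "((\<lambda>x. 1 - \<psi> x - k * exp (a * x)) \<longlongrightarrow> 0) at_bot"
          using tendsto_diff[OF tendsto_diff[OF tendsto_const[of 1] lim] exp_at_bot[of k]] by simp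
      qed
      then show ?thesis by simp
    qed
    obtain m where m: "0 < m" "\<And>s. 1 / 2 \<le> s \<Longrightarrow> s \<le> 1 \<Longrightarrow> m * (1 - s) \<le> R s"
      using R_ge_near_1 by metis
    have "\<forall>\<^sub>F x in at_bot. 1 / 2 < \<psi> x" using lim by (rule order_tendstoD) simp
    then obtain N where N: "\<And>x. x \<le> N \<Longrightarrow> 1 / 2 < \<psi> x" by (auto simp: eventually_at_bot_linorder)
    define y where "y = min 0 N"
    have wy: "0 < w y" using we[of y] e by simp
    define x where "x = y - w y / (m * k)"
    have xy: "x < y" using wy m k by (simp add: x_def)
    obtain z where z: "x < z" "z < y" "w y - w x = (y - x) * (r z * R01 (\<psi> z))"
      using MVT2[OF xy, of w "\<lambda>z. r z * R01 (\<psi> z)"] flux_pair_DERIV(2)[OF s] by blast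
    have "1 = exp (- a * z) * exp (a * z)" by (simp flip: exp_add)
    also have "\<dots> \<le> r z * exp (a * z)" by (intro mult_right_mono r_ge) simp
    finally have "m * k * 1 \<le> m * k * (r z * exp (a * z))" using m k by (intro mult_left_mono) auto
    also have "\<dots> = r z * (m * (k * exp (a * z)))" by simp
    also have "\<dots> \<le> r z * (m * (1 - \<psi> z))"
      using low[of z] z m r_pos[of z] by (intro mult_left_mono) (auto simp: y_def)
    also have "\<dots> \<le> r z * R01 (\<psi> z)"
      using m(2)[of "\<psi> z"] N[of z] range[of z] z r_pos[of z]
      by (intro mult_left_mono) (auto simp: y_def R01_eq)
    finally have "(y - x) * (m * k) \<le> w y - w x" unfolding z(3) using xy by (intro mult_left_mono) auto
    moreover have "(y - x) * (m * k) = w y" using m k by (simp add: x_def)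
    ultimately show False using we[of x] e by simp
  qed
  then obtain x where x: "w x < e" ..
  then have "w y < e" if "y \<le> x" for y using flux_pair_v_mono[OF s that] by simp
  then show "\<forall>\<^sub>F x in at_bot. w x < e" by (auto simp: eventually_at_bot_linorder)
qed

text \<open>A crude bound on a possibly unbounded flux is enough here: \<open>w' \<le> c r \<le> c r'\<close> for large \<open>x\<close>, so \<open>w \<le> C + c r\<close>,
  while \<open>r \<theta> \<rightarrow> 0\<close>.\<close>

lemma flux_times_\<theta>_tendsto_0:
  assumes s: "flux_pair \<psi> w" and range: "\<And>x. 0 \<le> \<psi> x \<and> \<psi> x \<le> 1" and w: "\<And>x. 0 \<le> w x"
  shows "((\<lambda>x. w x * \<theta> x) \<longlongrightarrow> 0) at_top"
proof -
  have "\<forall>\<^sub>F x in at_top. 1 \<le> b x" unfolding b_def by real_asymp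
  then obtain x0 where x0: "\<And>x. x0 \<le> x \<Longrightarrow> 1 \<le> b x" by (auto simp: eventually_at_top_linorder)
  define C where "C = \<bar>w x0 - c * r x0\<bar>"
  have bound: "w x * \<theta> x \<le> C * \<theta> x + c * (r x * \<theta> x)" if "x0 \<le> x" for x
  proof -
    have "w x - c * r x \<le> w x0 - c * r x0"
    proof (rule DERIV_nonpos_imp_nonincreasing[OF that])
      fix y assume y: "x0 \<le> y" "y \<le> x"
      have "R (\<psi> y) \<le> c * \<psi> y" using range[of y] by (intro R_le) auto
      also have "\<dots> \<le> c * b y" using range[of y] x0[OF y(1)] c by (intro mult_left_mono) auto
      finally have "r y * R01 (\<psi> y) \<le> r y * (c * b y)"
        using range[of y] r_pos[of y] by (intro mult_left_mono) (auto simp: R01_eq)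
      then have "r y * R01 (\<psi> y) - c * (b y * r y) \<le> 0" by (simp add: mult_ac)
      moreover have "((\<lambda>x. w x - c * r x) has_real_derivative r y * R01 (\<psi> y) - c * (b y * r y)) (at y)"
        by (intro DERIV_diff DERIV_cmult r_DERIV flux_pair_DERIV(2)[OF s])
      ultimately show "\<exists>d. ((\<lambda>x. w x - c * r x) has_real_derivative d) (at y) \<and> d \<le> 0" by blast
    qed
    then have "w x \<le> C + c * r x" by (simp add: C_def)
    from mult_right_mono[OF this, of "\<theta> x"] show ?thesis
      using \<theta>_pos[of x] by (simp add: algebra_simps less_imp_le)
  qed
  have r\<theta>: "((\<lambda>x. r x * \<theta> x) \<longlongrightarrow> 0) at_top"
  proof (rule Lim_null_comparison)
    show "\<forall>\<^sub>F x in at_top. norm (r x * \<theta> x) \<le> 4 * exp (- 2 * x)"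
      using r_\<theta>_le by eventually_elim (simp add: r_pos \<theta>_pos less_imp_le)
    show "((\<lambda>x :: real. 4 * exp (- 2 * x)) \<longlongrightarrow> 0) at_top" by real_asymp
  qed
  show ?thesis
  proof (rule Lim_null_comparison)
    show "\<forall>\<^sub>F x in at_top. norm (w x * \<theta> x) \<le> C * \<theta> x + c * (r x * \<theta> x)"
      using bound w \<theta>_pos by (intro eventually_at_top_linorderI[of x0]) (simp add: less_imp_le)
    show "((\<lambda>x. C * \<theta> x + c * (r x * \<theta> x)) \<longlongrightarrow> 0) at_top"
      using tendsto_add[OF tendsto_mult_left[OF \<theta>_tendsto_0, of C] tendsto_mult_left[OF r\<theta>, of c]] by simp
  qed
qed

text \<open>A negative flux would persist to \<open>-\<infinity>\<close>, and \<open>\<psi>\<close> would increase there from its limit 1 to values above 1.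
  So \<open>\<psi>\<close> is nonincreasing. A zero of \<open>\<psi>\<close> would make \<open>\<psi>\<close> and then the flux vanish to the right of it, hence the flux vanish
  everywhere to the left, and \<open>\<psi>\<close> would be 0 near \<open>-\<infinity>\<close>.\<close>

lemma flux_pair_positivity:
  assumes s: "flux_pair \<psi> w" and range: "\<And>x. 0 \<le> \<psi> x \<and> \<psi> x \<le> 1"
    and lim: "(\<psi> \<longlongrightarrow> 1) at_bot"
  shows "0 \<le> w x" and "0 < \<psi> x"
proof -
  have w: "0 \<le> w x" for x
  proof (rule ccontr)
    assume "\<not> 0 \<le> w x"
    then have neg: "w y < 0" if "y \<le> x" for y using flux_pair_v_mono[OF s that] by simp
    have inc: "\<psi> y < \<psi> z" if "y < z" "z \<le> x" for y z
    proof (rule DERIV_pos_imp_increasing[OF that(1)])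
      fix t assume "y \<le> t" "t \<le> z"
      then have "0 < - w t / r t" using neg[of t] that r_pos[of t] by (simp add: divide_neg_pos)
      then show "\<exists>d. (\<psi> has_real_derivative d) (at t) \<and> 0 < d" using flux_pair_DERIV(1)[OF s] by blast
    qed
    have "1 \<le> \<psi> (x - 1)"
      by (rule tendsto_upperbound[OF lim])
        (use inc in \<open>auto simp: eventually_at_bot_linorder intro!: exI[of _ "x - 2"] less_imp_le\<close>)
    then show False using inc[of "x - 1" x] range[of x] by simp
  qed
  show "0 \<le> w x" by (rule w)
  have anti: "\<psi> y \<le> \<psi> x" if "x \<le> y" for x y using w by (intro flux_pair_decreasing[OF s that])
  show "0 < \<psi> x"
  proof (rule ccontr)
    assume "\<not> 0 < \<psi> x"
    then have z: "\<psi> y = 0" if "x \<le> y" for y using anti[OF that] range[of y] by simp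
    obtain y where y: "x < y" "\<psi> (x + 1) - \<psi> x = (x + 1 - x) * (- w y / r y)"
      using MVT2[of x "x + 1" \<psi> "\<lambda>y. - w y / r y"] flux_pair_DERIV(1)[OF s] by auto
    have "w y = 0" using y z[of x] z[of "x + 1"] r_pos[of y] by simp
    then have w0: "w t = 0" if "t \<le> y" for t using flux_pair_v_mono[OF s that] w[of t] by simp
    have "\<psi> t = 0" if ty: "t < y" for t
    proof -
      obtain u where "u < y" "\<psi> y - \<psi> t = (y - t) * (- w u / r u)"
        using MVT2[OF ty, of \<psi> "\<lambda>y. - w y / r y"] flux_pair_DERIV(1)[OF s] by blast
      then show ?thesis using w0[of u] z[of y] y(1) by simp
    qed
    then have "(\<psi> \<longlongrightarrow> 0) at_bot"
      by (intro tendsto_eventually) (auto simp: eventually_at_bot_linorder intro!: exI[of _ "y - 1"])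
    with lim show False using tendsto_unique[of at_bot \<psi> 1 0] by simp
  qed
qed

lemma flux_pair_unique:
  assumes pr: "profile \<phi> v" and S: "decaying_pair M \<phi> v"
    and s: "flux_pair \<psi> w" and range: "\<And>x. 0 \<le> \<psi> x \<and> \<psi> x \<le> 1"
    and lim: "(\<psi> \<longlongrightarrow> 1) at_bot"  "(\<psi> \<longlongrightarrow> 0) at_top"
  shows "\<psi> x = \<phi> x"
proof -
  note pos = flux_pair_positivity[OF s range lim(1)]
  have s0: "flux_pair \<phi> v" using pr by (rule profile_flux_pair)
  have \<phi>: "0 < \<phi> x" "\<phi> x < 1" "0 < v x" for x using pr by (auto simp: profile_def)
  have lim\<phi>: "(\<phi> \<longlongrightarrow> 1) at_bot" "(\<phi> \<longlongrightarrow> 0) at_top" "(v \<longlongrightarrow> M) at_top"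
    using profile_tendsto_1[OF pr] S by (auto simp: decaying_pair_def)
  have w0: "(w \<longlongrightarrow> 0) at_bot" by (rule flux_tendsto_0_at_bot[OF s range pos(1) lim(1)])
  have v0: "(v \<longlongrightarrow> 0) at_bot"
    using \<phi> by (intro flux_tendsto_0_at_bot[OF s0 _ _ lim\<phi>(1)]) (auto simp: less_imp_le)
  have bot: "((\<lambda>x. w x * \<phi> x - v x * \<psi> x) \<longlongrightarrow> 0) at_bot"
    using tendsto_diff[OF tendsto_mult[OF w0 lim\<phi>(1)] tendsto_mult[OF v0 lim(1)]] by simp
  have "((\<lambda>x. w x * \<phi> x) \<longlongrightarrow> 0) at_top"
  proof (rule Lim_null_comparison)
    show "\<forall>\<^sub>F x in at_top. norm (w x * \<phi> x) \<le> M * (w x * \<theta> x)"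
    proof (intro always_eventually allI)
      fix x
      have "w x * \<phi> x \<le> w x * (M * \<theta> x)"
        using decaying_pair_le_\<theta>[OF S] pos(1) by (intro mult_left_mono)
      then show "norm (w x * \<phi> x) \<le> M * (w x * \<theta> x)"
        using pos(1)[of x] \<phi>(1)[of x] by (simp add: mult_ac)
    qed
    show "((\<lambda>x. M * (w x * \<theta> x)) \<longlongrightarrow> 0) at_top"
      using tendsto_mult_left[OF flux_times_\<theta>_tendsto_0[OF s range pos(1)], of M] by simp
  qed
  from tendsto_diff[OF this tendsto_mult[OF lim\<phi>(3) lim(2)]]
  have top: "((\<lambda>x. w x * \<phi> x - v x * \<psi> x) \<longlongrightarrow> 0) at_top" by simp
  have "\<phi> x \<le> \<psi> x"
    using \<phi> pos(2) range by (intro wronskian_comparison[OF s0 s _ _ bot top]) (auto simp: less_imp_le)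
  moreover have "((\<lambda>x. v x * \<psi> x - w x * \<phi> x) \<longlongrightarrow> 0) at_bot" "((\<lambda>x. v x * \<psi> x - w x * \<phi> x) \<longlongrightarrow> 0) at_top"
    using tendsto_minus[OF bot] tendsto_minus[OF top] by simp_all
  then have "\<psi> x \<le> \<phi> x"
    using \<phi> pos(2) range by (intro wronskian_comparison[OF s s0]) (auto simp: less_imp_le)
  ultimately show ?thesis by simp
qed

end

section \<open>Weak solutions and profiles\<close>

lemma not_set_integrable_ge_const:
  fixes f :: "real \<Rightarrow> real"
  assumes int: "set_integrable lborel S f" and S: "S \<in> sets borel" "emeasure lborel S = \<infinity>"
    and "0 < e" and ge: "\<And>x. x \<in> S \<Longrightarrow> e \<le> f x"
  shows False
proof -
  have "set_integrable lborel S (\<lambda>x. e)"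
  proof (rule set_integrable_bound[OF int])
    show "set_borel_measurable lborel S (\<lambda>x. e)"
      using S(1) unfolding set_borel_measurable_def by measurable
    show "AE x in lborel. x \<in> S \<longrightarrow> norm e \<le> norm (f x)"
      using ge \<open>0 < e\<close> by (intro always_eventually) force
  qed
  then have "set_integrable lborel S (\<lambda>x. e / e)" by (rule set_integrable_divide) 
  then have "integrable lborel (indicator S :: real \<Rightarrow> real)" using \<open>0 < e\<close> by (simp add: set_integrable_def)
  then have "emeasure lborel S < \<infinity>" using S(1) by (simp add: integrable_indicator_iff)
  with S(2) show False by simp
qed

lemma emeasure_lborel_half_lines: "emeasure lborel {a :: real..} = \<infinity>" "emeasure lborel {..a :: real} = \<infinity>"
proof -
  have le: "of_nat n \<le> emeasure lborel {a..}" "of_nat n \<le> emeasure lborel {..a}" for n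
    using emeasure_mono[of "{a..a + real n}" "{a..}" lborel] emeasure_mono[of "{a - real n..a}" "{..a}" lborel]
    by (auto simp: ennreal_of_nat_eq_real_of_nat)
  have "x = \<infinity>" if "\<And>n. of_nat n \<le> x" for x :: ennreal
    using that ennreal_Ex_less_of_nat[of x] by (auto simp: less_top[symmetric] top_unique not_le[symmetric])
  with le show "emeasure lborel {a..} = \<infinity>" "emeasure lborel {..a} = \<infinity>" by blast+
qed

lemma integrable_of_tails:
  assumes "tail_integrable h" "tail_integrable (\<lambda>x. h (- x))"
  shows "integrable lborel h"
proof -
  have "set_integrable lborel {0..} h" using assms(1) by (simp add: tail_integrable_def)
  moreover have "set_integrable lborel {..0} h"
  proof -
    have "integrable lborel (\<lambda>x. indicator {0..} x * h (- x))"
      using assms(2) by (simp add: tail_integrable_def set_integrable_def)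
    from lborel_integrable_real_affine[OF this, of "-1" 0]
    have "integrable lborel (\<lambda>x. indicator {0..} (- x) * h x)" by simp
    moreover have "indicator {0..} (- x) = (indicator {..0} x :: real)" for x :: real
      by (simp add: indicator_def)
    ultimately show ?thesis by (simp add: set_integrable_def)
  qed
  ultimately have "set_integrable lborel ({0..} \<union> {..0}) h" by (intro set_integrable_Un) auto
  moreover have "{0..} \<union> {..0} = (UNIV :: real set)" by auto
  ultimately show ?thesis by (simp add: set_integrable_def)
qed

context profile_ode
begin

text \<open>As the flux is monotone, it has a fixed sign near each end, and \<open>\<psi>\<close> is monotone there. The weight is at
  least 1 near both ends, so integrability keeps \<open>\<psi>\<close> from staying away from 0 at \<open>+\<infinity>\<close>, and from 1 at \<open>-\<infinity>\<close>.\<close>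

lemma limits_of_weighted_integrable:
  assumes s: "flux_pair \<psi> w" and range: "\<And>x. 0 \<le> \<psi> x \<and> \<psi> x \<le> 1"
    and \<eta>: "\<And>x. x \<le> 0 \<Longrightarrow> \<eta> x = 1" "\<And>x. x \<ge> 1 \<Longrightarrow> \<eta> x = 0"
    and int: "integrable lborel (\<lambda>x. r x * (\<psi> x - \<eta> x)\<^sup>2)"
  shows "(\<psi> \<longlongrightarrow> 1) at_bot" "(\<psi> \<longlongrightarrow> 0) at_top"
proof -
  have setint: "set_integrable lborel S (\<lambda>x. r x * (\<psi> x - \<eta> x)\<^sup>2)" if "S \<in> sets borel" for S
    unfolding set_integrable_def using integrable_mult_indicator[OF _ int] that by simp
  have no_top: False if e: "0 < e" and ge: "\<And>x. x \<ge> N \<Longrightarrow> e \<le> \<psi> x" for e N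
  proof -
    have "\<forall>\<^sub>F x in at_top. 1 \<le> r x" using r_at_top by (simp add: filterlim_at_top)
    then obtain N1 where N1: "\<And>x. x \<ge> N1 \<Longrightarrow> 1 \<le> r x" by (auto simp: eventually_at_top_linorder)
    let ?N = "max N (max N1 1)"
    have "e\<^sup>2 \<le> r x * (\<psi> x - \<eta> x)\<^sup>2" if "x \<in> {?N..}" for x
    proof -
      have "1 * e\<^sup>2 \<le> r x * (\<psi> x)\<^sup>2"
        using N1[of x] ge[of x] that e by (intro mult_mono power_mono) auto
      then show ?thesis using that \<eta>(2)[of x] by simp
    qed
    then show False
      using e by (intro not_set_integrable_ge_const[OF setint[of "{?N..}"], of "e\<^sup>2"])
        (auto simp: emeasure_lborel_half_lines)
  qed
  have no_bot: False if e: "0 < e" and ge: "\<And>x. x \<le> N \<Longrightarrow> e \<le> 1 - \<psi> x" for e N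
  proof -
    let ?N = "min N 0"
    have "e\<^sup>2 \<le> r x * (\<psi> x - \<eta> x)\<^sup>2" if "x \<in> {..?N}" for x
    proof -
      have "1 * e\<^sup>2 \<le> r x * (1 - \<psi> x)\<^sup>2"
        using r_ge_1[of x] ge[of x] that e by (intro mult_mono power_mono) auto
      then show ?thesis using that \<eta>(1)[of x] by (simp add: power2_commute)
    qed
    then show False
      using e by (intro not_set_integrable_ge_const[OF setint[of "{..?N}"], of "e\<^sup>2"])
        (auto simp: emeasure_lborel_half_lines)
  qed
  have inc: "\<psi> x \<le> \<psi> y" if "x \<le> y" "\<And>z. x \<le> z \<Longrightarrow> z \<le> y \<Longrightarrow> w z \<le> 0" for x y
  proof (rule DERIV_nonneg_imp_nondecreasing[OF that(1)])
    fix z assume "x \<le> z" "z \<le> y"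
    then have "0 \<le> - w z / r z" using that(2)[of z] r_pos[of z] by (simp add: divide_nonpos_pos)
    then show "\<exists>d. (\<psi> has_real_derivative d) (at z) \<and> 0 \<le> d" using flux_pair_DERIV(1)[OF s] by blast
  qed
  show "(\<psi> \<longlongrightarrow> 0) at_top"
  proof (cases "\<exists>x. 0 \<le> w x")
    case True
    then obtain x1 where "0 \<le> w x1" ..
    then have w: "0 \<le> w x" if "x1 \<le> x" for x using flux_pair_v_mono[OF s that] by simp
    show ?thesis
    proof (rule order_tendstoI)
      show "\<forall>\<^sub>F x in at_top. t < \<psi> x" if "t < 0" for t
        using that range by (intro always_eventually allI) (meson less_le_trans)
      show "\<forall>\<^sub>F x in at_top. \<psi> x < t" if t: "0 < t" for t
      proof -
        obtain x where x: "x1 \<le> x" "\<psi> x < t" using no_top[OF t, of x1] by (meson not_le)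
        have "\<psi> y < t" if "x \<le> y" for y
          using flux_pair_decreasing[OF s that] w x by force
        then show ?thesis by (rule eventually_at_top_linorderI)
      qed
    qed
  next
    case False
    then have w: "w x < 0" for x by (simp add: not_le)
    have "\<psi> 0 < \<psi> 1"
    proof (rule DERIV_pos_imp_increasing[where f = \<psi>])
      have "0 < - w z / r z" for z using w[of z] r_pos[of z] by (simp add: divide_neg_pos)
      then show "\<exists>d. (\<psi> has_real_derivative d) (at z) \<and> 0 < d" for z using flux_pair_DERIV(1)[OF s] by blast
    qed simp
    then have "0 < \<psi> 1" using range[of 0] by simp
    moreover have "\<psi> 1 \<le> \<psi> x" if "1 \<le> x" for x using w by (intro inc[OF that]) (simp add: less_imp_le)
    ultimately show ?thesis using no_top by blast
  qed
  show "(\<psi> \<longlongrightarrow> 1) at_bot"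
  proof (cases "\<exists>x. w x \<le> 0")
    case True
    then obtain x1 where "w x1 \<le> 0" ..
    then have w: "w x \<le> 0" if "x \<le> x1" for x using flux_pair_v_mono[OF s that] by simp
    have "\<psi> x = 1" if x: "x \<le> x1" for x
    proof (rule ccontr)
      assume "\<psi> x \<noteq> 1"
      then have "0 < 1 - \<psi> x" using range[of x] by simp
      moreover have "1 - \<psi> x \<le> 1 - \<psi> y" if "y \<le> x" for y using inc[OF that] w x by simp
      ultimately show False using no_bot by blast
    qed
    then show ?thesis by (intro tendsto_eventually) (auto simp: eventually_at_bot_linorder)
  next
    case False
    then have w: "0 < w x" for x by (simp add: not_le)
    show ?thesis
    proof (rule order_tendstoI)
      show "\<forall>\<^sub>F x in at_bot. \<psi> x < t" if "1 < t" for t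
        using that range by (intro always_eventually allI) (meson le_less_trans)
      show "\<forall>\<^sub>F x in at_bot. t < \<psi> x" if t: "t < 1" for t
      proof -
        obtain x where x: "t < \<psi> x" using no_bot[of "1 - t" 0] t by (meson diff_gt_0_iff_gt diff_left_mono not_le)
        have "t < \<psi> y" if "y \<le> x" for y
          using flux_pair_decreasing[OF s that] w x by (force simp: less_imp_le)
        then show ?thesis by (auto simp: eventually_at_bot_linorder)
      qed
    qed
  qed
qed

lemma R_borel: "R \<in> borel_measurable borel"
  unfolding R_def[abs_def] by measurable

lemma b_cont: "continuous_on S b"
  unfolding b_def by (intro continuous_intros) auto

lemma R01_cont: "continuous_on UNIV R01"
  by (rule lipschitz_on_continuous_on[where L = "c * (1 + p)"], rule lipschitz_onI)
    (use R01_lipschitz c p in \<open>auto simp: dist_real_def\<close>)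

lemma R01_bounded: "\<bar>R01 s\<bar> \<le> c"
  using R01_le[of s "max s 0"] R01_nonneg[of s] R01_ge_1_arg[of s] R01_nonpos_arg[of s] c
  by (cases "s \<le> 0 \<or> 1 \<le> s") (auto intro: order_trans[OF _ mult_left_mono[of s 1 c, simplified]] simp: R01_eq)

lemma weak_solution_imp_flux_pair:
  assumes \<eta>: "cutoff_fun \<eta>" and \<psi>: "\<psi> \<in> L2_loc" and g: "g \<in> L2_loc" and wd: "has_weak_deriv \<psi> g"
    and range: "AE x in lborel. 0 \<le> \<psi> x \<and> \<psi> x \<le> 1"
    and weak: "\<And>\<kappa>. test_fun \<kappa> \<Longrightarrow> - (LINT x|lborel. g x * deriv \<kappa> x)
       + (LINT x|lborel. (b x * g x + R (\<psi> x)) * \<kappa> x) = 0"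
  obtains u w where "AE x in lborel. \<psi> x = u x" "flux_pair u w" "\<And>x. 0 \<le> u x \<and> u x \<le> 1"
proof -
  have [measurable]: "\<psi> \<in> borel_measurable borel" "g \<in> borel_measurable borel" "R01 \<in> borel_measurable borel"
      "b \<in> borel_measurable borel" "R \<in> borel_measurable borel"
    using \<psi> g R01_cont b_cont R_borel by (auto intro: L2_loc_borel borel_measurable_continuous_onI)
  have "has_weak_deriv g (\<lambda>x. - (b x * g x + R01 (\<psi> x)))"
    unfolding has_weak_deriv_def
  proof safe
    fix \<kappa> assume \<kappa>: "test_fun \<kappa>"
    then have [measurable]: "\<kappa> \<in> borel_measurable borel" by (auto simp: test_fun_def intro: smooth_fun_borel)
    have "(LINT x|lborel. (b x * g x + R (\<psi> x)) * \<kappa> x) = (LINT x|lborel. (b x * g x + R01 (\<psi> x)) * \<kappa> x)"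
    proof (rule integral_cong_AE)
      show "AE x in lborel. (b x * g x + R (\<psi> x)) * \<kappa> x = (b x * g x + R01 (\<psi> x)) * \<kappa> x"
        using range by eventually_elim (simp add: R01_eq)
    qed measurable
    then show "(LINT x|lborel. g x * deriv \<kappa> x) = - (LINT x|lborel. - (b x * g x + R01 (\<psi> x)) * \<kappa> x)"
      using weak[OF \<kappa>] by (simp only: mult_minus_left Bochner_Integration.integral_minus)
  qed
  from weak_second_order_regularity[OF \<eta> \<psi> g wd b_cont R01_cont R01_bounded this]
  obtain u u' where u: "AE x in lborel. \<psi> x = u x" "\<And>x. (u has_real_derivative u' x) (at x)"
    "\<And>x. (u' has_real_derivative - (b x * u' x + R01 (u x))) (at x)" by metis
  have u_cont: "continuous_on UNIV u" by (rule DERIV_continuous_on_UNIV[OF u(2)])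
  have "AE x in lborel. 0 \<le> u x" using u(1) range by eventually_elim simp
  then have u0: "0 \<le> u x" for x by (rule AE_continuous_nonneg[OF u_cont])
  have "AE x in lborel. 0 \<le> 1 - u x" using u(1) range by eventually_elim simp
  then have "0 \<le> 1 - u x" for x
    by (rule AE_continuous_nonneg[OF continuous_on_diff[OF continuous_on_const u_cont]])
  then have u1: "u x \<le> 1" for x by simp
  define w where "w x = - (r x * u' x)" for x
  have "(w has_real_derivative r x * R01 (u x)) (at x)" for x
    unfolding w_def
    by (rule DERIV_cong[OF DERIV_minus[OF DERIV_mult[OF r_DERIV u(3)]]]) (simp add: algebra_simps)
  moreover have "(u has_real_derivative - w x / r x) (at x)" for x
    using u(2)[of x] by (simp add: w_def)
  ultimately have "flux_pair u w" by (simp add: flux_pair_def)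
  with u(1) u0 u1 show thesis by (intro that) auto
qed

lemma profile_slope_DERIV:
  assumes "profile \<phi> v"
  shows "((\<lambda>x. - v x / r x) has_real_derivative - (b x * (- v x / r x)) - R (\<phi> x)) (at x)"
proof -
  have "((\<lambda>x. - v x * (1 / r x)) has_real_derivative (- (r x * R (\<phi> x))) * (1 / r x) + (- (b x * (1 / r x))) * (- v x)) (at x)"
    using assms by (intro DERIV_mult DERIV_minus inv_r_DERIV) (simp add: profile_def)
  then show ?thesis by (simp add: algebra_simps)
qed

text \<open>The algebra generated by \<open>\<phi>\<close>, \<open>\<phi>'\<close>, \<open>e\<^sup>2\<^sup>x\<close> and all real powers of \<open>\<phi>\<close> is closed under differentiation: the
  equation expresses \<open>\<phi>''\<close> in it, and the powers are differentiable because \<open>\<phi> > 0\<close>.\<close>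

lemma profile_smooth:
  assumes pr: "profile \<phi> v"
  shows "smooth_fun \<phi>"
proof -
  define g where "g x = - v x / r x" for x
  define S where "S = {\<phi>, g, \<lambda>x. exp (2 * x)} \<union> {\<lambda>x. \<phi> x powr q |q. True}"
  note gen = fun_algebra.generator[of _ S]
  have in_S: "\<phi> \<in> fun_algebra S" "g \<in> fun_algebra S" "(\<lambda>x. exp (2 * x)) \<in> fun_algebra S"
    "(\<lambda>x. \<phi> x powr q) \<in> fun_algebra S" for q
    by (rule gen, force simp: S_def)+
  have \<phi>': "(\<phi> has_real_derivative g x) (at x)" for x using pr by (simp add: profile_def g_def)
  have pos: "0 < \<phi> x" for x using pr by (simp add: profile_def)
  show ?thesis
  proof (rule smooth_fun_algebra[OF _ in_S(1)])
    fix h assume "h \<in> S"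
    then consider "h = \<phi>" | "h = g" | "h = (\<lambda>x. exp (2 * x))" | q where "h = (\<lambda>x. \<phi> x powr q)"
      by (auto simp: S_def)
    then show "\<exists>g' \<in> fun_algebra S. \<forall>x. (h has_real_derivative g' x) (at x)"
    proof cases
      case 1
      then show ?thesis using \<phi>' in_S(2) by blast
    next
      case 2
      let ?g' = "\<lambda>x. (- 1) * (((1 / 2) * exp (2 * x) + (- a)) * g x) + (- c) * (\<phi> x + (- 1) * \<phi> x powr p)"
      have "?g' \<in> fun_algebra S"
        by (intro fun_algebra.add fun_algebra.mult fun_algebra.const in_S)
      moreover have "(g has_real_derivative ?g' x) (at x)" for x
        unfolding g_def
        by (rule DERIV_cong[OF profile_slope_DERIV[OF pr]]) (simp add: b_def R_def algebra_simps)
      ultimately show ?thesis using 2 by (intro bexI[of _ ?g']) auto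
    next
      case 3
      have "(\<lambda>x. 2 * exp (2 * x)) \<in> fun_algebra S" by (intro fun_algebra.mult fun_algebra.const in_S)
      moreover have "((\<lambda>x. exp (2 * x)) has_real_derivative 2 * exp (2 * x)) (at x)" for x :: real
        by (auto intro!: derivative_eq_intros)
      ultimately show ?thesis using 3 by (intro bexI[of _ "\<lambda>x. 2 * exp (2 * x)"]) auto
    next
      case (4 q)
      let ?g' = "\<lambda>x. q * \<phi> x powr (q - 1) * g x"
      have "?g' \<in> fun_algebra S" by (intro fun_algebra.mult fun_algebra.const in_S)
      moreover have "((\<lambda>x. \<phi> x powr q) has_real_derivative ?g' x) (at x)" for x
      proof -
        have "((\<lambda>y. y powr q) has_real_derivative q * \<phi> x powr (q - 1)) (at (\<phi> x))"
          using pos[of x] by (auto intro!: derivative_eq_intros simp: powr_diff)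
        from DERIV_chain2[OF this \<phi>'] show ?thesis .
      qed
      ultimately show ?thesis using 4 by (intro bexI[of _ ?g']) auto
    qed
  qed
qed

lemma profile_weak:
  assumes pr: "profile \<phi> v"
  defines "g \<equiv> \<lambda>x. - v x / r x"
  shows "\<phi> \<in> L2_loc" "g \<in> L2_loc" "has_weak_deriv \<phi> g"
    and "test_fun \<kappa> \<Longrightarrow> - (LINT x|lborel. g x * deriv \<kappa> x)
       + (LINT x|lborel. (b x * g x + R (\<phi> x)) * \<kappa> x) = 0"
proof -
  have \<phi>': "(\<phi> has_real_derivative g x) (at x)" for x using pr by (simp add: profile_def g_def)
  have g': "(g has_real_derivative - (b x * g x) - R (\<phi> x)) (at x)" for x
    unfolding g_def by (rule profile_slope_DERIV[OF pr])
  have \<phi>_cont: "continuous_on UNIV \<phi>" and g_cont: "continuous_on UNIV g"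
    by (rule DERIV_continuous_on_UNIV[OF \<phi>'], rule DERIV_continuous_on_UNIV[OF g'])
  then show "\<phi> \<in> L2_loc" "g \<in> L2_loc" by (auto intro: continuous_L2_loc)
  show "has_weak_deriv \<phi> g" by (rule C1_has_weak_deriv[OF \<phi>' g_cont])
  have "continuous_on UNIV (\<lambda>x. R (\<phi> x))"
    using pr by (intro continuous_on_compose2[OF R_continuous \<phi>_cont]) (auto simp: profile_def less_imp_le)
  then have "continuous_on UNIV (\<lambda>x. - (b x * g x) - R (\<phi> x))"
    by (intro continuous_on_diff continuous_on_minus continuous_on_mult b_cont g_cont)
  from C1_has_weak_deriv[OF g' this] have "has_weak_deriv g (\<lambda>x. - (b x * g x) - R (\<phi> x))" .
  moreover assume "test_fun \<kappa>"
  ultimately have "(LINT x|lborel. g x * deriv \<kappa> x) = - (LINT x|lborel. (- (b x * g x) - R (\<phi> x)) * \<kappa> x)"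
    by (simp add: has_weak_deriv_def)
  also have "\<dots> = (LINT x|lborel. - ((- (b x * g x) - R (\<phi> x)) * \<kappa> x))" by simp
  also have "\<dots> = (LINT x|lborel. (b x * g x + R (\<phi> x)) * \<kappa> x)"
    by (rule arg_cong[where f = "integral\<^sup>L lborel"]) (auto simp: algebra_simps)
  finally show "- (LINT x|lborel. g x * deriv \<kappa> x) + (LINT x|lborel. (b x * g x + R (\<phi> x)) * \<kappa> x) = 0"
    by simp
qed

text \<open>At \<open>+\<infinity>\<close> the integrands are dominated by multiples of \<open>r \<theta>\<close> and \<open>1 / r\<close>, because \<open>\<phi> \<le> M \<theta>\<close> and
  \<open>\<bar>\<phi>'\<bar> \<le> M / r\<close>; at \<open>-\<infinity>\<close> by multiples of \<open>e\<^sup>a\<^sup>x\<close>, because \<open>1 - \<phi> \<le> (M / a) e\<^sup>a\<^sup>x\<close> and \<open>r\<close> is comparable to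
  \<open>e\<^sup>-\<^sup>a\<^sup>x\<close>.\<close>

lemma profile_weighted_integrable:
  assumes pr: "profile \<phi> v" and S: "decaying_pair M \<phi> v" and \<eta>: "cutoff_fun \<eta>"
  shows "integrable lborel (\<lambda>x. r x * (\<phi> x - \<eta> x)\<^sup>2)"
    and "integrable lborel (\<lambda>x. r x * (deriv (\<lambda>x. \<phi> x - \<eta> x) x)\<^sup>2)"
proof -
  have sm: "smooth_fun \<eta>" and \<eta>1: "\<And>x. x \<le> 0 \<Longrightarrow> \<eta> x = 1" and \<eta>0: "\<And>x. x \<ge> 1 \<Longrightarrow> \<eta> x = 0"
    using \<eta> by (auto simp: cutoff_fun_def)
  define g where "g x = - v x / r x" for x
  have \<phi>': "(\<phi> has_real_derivative g x) (at x)" for x using pr by (simp add: profile_def g_def)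
  have \<phi>_cont: "continuous_on UNIV \<phi>" by (rule DERIV_continuous_on_UNIV[OF \<phi>'])
  have dw: "deriv (\<lambda>x. \<phi> x - \<eta> x) x = g x - deriv \<eta> x" for x
    by (rule DERIV_imp_deriv[OF DERIV_diff[OF \<phi>' smooth_fun_DERIV[OF sm]]])
  have g_cont: "continuous_on UNIV g"
    unfolding g_def using flux_pair_continuous(2)[OF profile_flux_pair[OF pr]]
    by (intro continuous_on_divide continuous_on_minus r_cont) auto
  have d0: "deriv \<eta> x = 0" if "x < 0 \<or> 1 < x" for x
    by (rule cutoff_fun_deriv_zero[OF \<eta> that])
  have cont1: "continuous_on UNIV (\<lambda>x. r x * (\<phi> x - \<eta> x)\<^sup>2)"
    by (intro continuous_on_mult continuous_on_power continuous_on_diff r_cont \<phi>_cont smooth_fun_continuous_on[OF sm])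
  have cont2: "continuous_on UNIV (\<lambda>x. r x * (g x - deriv \<eta> x)\<^sup>2)"
    by (intro continuous_on_mult continuous_on_power continuous_on_diff r_cont g_cont
        smooth_fun_continuous_on[OF smooth_fun_deriv[OF sm]])
  have refl: "continuous_on UNIV (\<lambda>x. h (- x))" if "continuous_on UNIV h" for h :: "real \<Rightarrow> real"
    by (rule continuous_on_compose2[OF that continuous_on_minus[OF continuous_on_id]]) simp
  have vM: "(v x)\<^sup>2 \<le> M\<^sup>2" for x
    using power_mono[OF profile_v_bounds[OF pr S, of x], of 2] by simp
  have rg: "r x * (g x)\<^sup>2 \<le> M\<^sup>2 * (1 / r x)" for x
    using vM[of x] r_pos[of x] by (simp add: g_def power_divide power2_eq_square divide_right_mono)
  have \<phi>0: "0 < \<phi> x" "\<phi> x < 1" for x using pr by (auto simp: profile_def)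
  have expt: "tail_integrable (\<lambda>x. K * (a * exp (- a * x)))" for K
    by (rule tail_integrable_cmult[OF exp_tail_integrable[OF a]])
  show "integrable lborel (\<lambda>x. r x * (\<phi> x - \<eta> x)\<^sup>2)"
  proof (rule integrable_of_tails)
    show "tail_integrable (\<lambda>x. r x * (\<phi> x - \<eta> x)\<^sup>2)"
    proof (rule tail_integrable_bound[OF tail_integrable_cmult[OF r_\<theta>_tail_integrable, of "\<bar>M\<bar>\<^sup>2"] cont1])
      have "\<forall>\<^sub>F x in at_top. \<theta> x < 1" using \<theta>_tendsto_0 by (rule order_tendstoD) simp
      moreover have "\<forall>\<^sub>F x in at_top. (1::real) \<le> x" by (rule eventually_ge_at_top)
      ultimately show "\<forall>\<^sub>F x in at_top. \<bar>r x * (\<phi> x - \<eta> x)\<^sup>2\<bar> \<le> \<bar>M\<bar>\<^sup>2 * (r x * \<theta> x)"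
      proof eventually_elim
        case (elim x)
        have "(\<phi> x)\<^sup>2 \<le> (M * \<theta> x)\<^sup>2"
          using decaying_pair_le_\<theta>[OF S, of x] \<phi>0[of x] by (intro power_mono) auto
        also have "\<dots> = M\<^sup>2 * (\<theta> x * \<theta> x)" by (simp add: power_mult_distrib power2_eq_square)
        also have "\<dots> \<le> M\<^sup>2 * (\<theta> x * 1)" using elim(1) \<theta>_pos[of x] by (intro mult_left_mono) auto
        finally have "r x * (\<phi> x)\<^sup>2 \<le> r x * (M\<^sup>2 * \<theta> x)" using r_pos[of x] by (intro mult_left_mono) auto
        then show ?case using elim(2) r_pos[of x] by (simp add: \<eta>0 mult_ac)
      qed
    qed
    show "tail_integrable (\<lambda>x. r (- x) * (\<phi> (- x) - \<eta> (- x))\<^sup>2)"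
    proof (rule tail_integrable_bound[OF expt refl[OF cont1]])
      show "\<forall>\<^sub>F x in at_top. \<bar>r (- x) * (\<phi> (- x) - \<eta> (- x))\<^sup>2\<bar> \<le> exp (1 / 4) * (M / a)\<^sup>2 / a * (a * exp (- a * x))"
        using eventually_ge_at_top[of 0]
      proof eventually_elim
        case (elim x)
        have "r (- x) \<le> exp (1 / 4 + a * x)" using elim by (simp add: r_def)
        then have "r (- x) \<le> exp (1 / 4) * exp (a * x)" by (simp add: exp_add)
        moreover have "(1 - \<phi> (- x))\<^sup>2 \<le> (M / a * exp (a * (- x)))\<^sup>2"
          using one_minus_profile_le[OF pr S, of "- x"] \<phi>0[of "- x"] by (intro power_mono) auto
        ultimately have "r (- x) * (1 - \<phi> (- x))\<^sup>2 \<le> exp (1 / 4) * exp (a * x) * (M / a * exp (a * (- x)))\<^sup>2"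
          using r_pos[of "- x"] by (intro mult_mono) auto
        also have "\<dots> = exp (1 / 4) * (M / a)\<^sup>2 * (exp (a * x) * (exp (a * (- x)))\<^sup>2)"
          by (simp only: power_mult_distrib mult_ac)
        also have "exp (a * x) * (exp (a * (- x)))\<^sup>2 = exp (- a * x)"
          by (simp add: power2_eq_square flip: exp_add)
        finally show ?case using elim r_pos[of "- x"] a by (simp add: \<eta>1 power2_commute)
      qed
    qed
  qed
  show "integrable lborel (\<lambda>x. r x * (deriv (\<lambda>x. \<phi> x - \<eta> x) x)\<^sup>2)"
    unfolding dw
  proof (rule integrable_of_tails)
    show "tail_integrable (\<lambda>x. r x * (g x - deriv \<eta> x)\<^sup>2)"
    proof (rule tail_integrable_bound[OF tail_integrable_cmult[OF inv_r_tail_integrable, of "M\<^sup>2"] cont2])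
      show "\<forall>\<^sub>F x in at_top. \<bar>r x * (g x - deriv \<eta> x)\<^sup>2\<bar> \<le> M\<^sup>2 * (1 / r x)"
        using eventually_gt_at_top[of 1]
      proof eventually_elim
        case (elim x)
        then show ?case using rg[of x] d0[of x] r_pos[of x] by (simp add: abs_mult)
      qed
    qed
    show "tail_integrable (\<lambda>x. r (- x) * (g (- x) - deriv \<eta> (- x))\<^sup>2)"
    proof (rule tail_integrable_bound[OF expt refl[OF cont2]])
      show "\<forall>\<^sub>F x in at_top. \<bar>r (- x) * (g (- x) - deriv \<eta> (- x))\<^sup>2\<bar> \<le> M\<^sup>2 / a * (a * exp (- a * x))"
        using eventually_gt_at_top[of 0]
      proof eventually_elim
        case (elim x)
        have "M\<^sup>2 * (1 / r (- x)) \<le> M\<^sup>2 * exp (a * - x)" by (intro mult_left_mono inv_r_le) simp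
        from order_trans[OF rg[of "- x"] this] show ?case using elim d0[of "- x"] r_pos[of "- x"] a by (simp add: abs_mult)
      qed
    qed
  qed
qed

end

theorem theorem2:
  fixes d :: nat and p :: real and \<eta> :: "real \<Rightarrow> real"
  assumes "d \<ge> 2" and "1 < p" and "ereal p < p_star d"
    and "cutoff_fun \<eta>"
  shows "\<exists>\<phi> :: real \<Rightarrow> real.
    admissible_solution d p \<eta> \<phi> \<and>
    (\<forall>\<psi>. admissible_solution d p \<eta> \<psi> \<longrightarrow> (AE \<zeta> in lborel. \<psi> \<zeta> = \<phi> \<zeta>)) \<and>
    smooth_fun \<phi> \<and>
    classical_solution d p \<phi> \<and>
    (\<forall>\<zeta>. 0 < \<phi> \<zeta> \<and> \<phi> \<zeta> < 1) \<and>
    (\<forall>x y. x < y \<longrightarrow> \<phi> y < \<phi> x) \<and>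
    (\<phi> \<longlongrightarrow> 1) at_bot \<and>
    (deriv \<phi> \<longlongrightarrow> 0) at_bot \<and>
    (\<phi> \<longlongrightarrow> 0) at_top \<and>
    (deriv \<phi> \<longlongrightarrow> 0) at_top \<and>
    (\<exists>C>0. ((\<lambda>\<zeta>. \<phi> \<zeta> /
        exp (- exp (2 * \<zeta>) / 4 + ((5 - p) / (p - 1) - real d + 1) * \<zeta>)) \<longlongrightarrow> C) at_top)"
proof -
  define a where "a = (p + 3) / (p - 1) - real d + 1"
  define c where "c = 2 / (p - 1) * ((p + 1) / (p - 1) - real d + 1)"
  have p1: "0 < p - 1" using assms(2) by simp
  \<comment> \<open>the condition \<open>p < p\<^sup>*\<close>, that is \<open>p (d - 2) < d\<close>, says precisely that the reaction coefficient is positive\<close>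
  have key: "0 < (p + 1) / (p - 1) - real d + 1"
  proof -
    have "p * (real d - 2) < real d"
    proof (cases "d = 2")
      case False
      then have "0 < real d - 2" using assms(1) by simp
      moreover have "p < real d / (real d - 2)" using assms(3) False by (simp add: p_star_def)
      ultimately show ?thesis by (simp add: pos_less_divide_eq)
    qed simp
    then have "0 < (real d - p * (real d - 2)) / (p - 1)" using p1 by simp
    also have "(real d - p * (real d - 2)) / (p - 1) = (p + 1) / (p - 1) - real d + 1"
      using p1 by (simp add: field_simps)
    finally show ?thesis .
  qed
  have a: "0 < a"
  proof -
    have "(p + 3) / (p - 1) = (p + 1) / (p - 1) + 2 / (p - 1)" by (simp flip: add_divide_distrib)
    moreover have "0 < 2 / (p - 1)" using p1 by simp
    ultimately show ?thesis using key unfolding a_def by linarith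
  qed
  have c: "0 < c" unfolding c_def using key p1 by (intro mult_pos_pos) auto
  interpret profile_ode a c p by standard (use a c assms(2) in auto)
  have rho: "rho d p = r" unfolding rho_def[abs_def] r_def[abs_def] by (simp add: a_def)
  have drift: "drift d p = b" unfolding drift_def[abs_def] b_def[abs_def] by (auto simp: a_def)
  have reaction: "reaction d p = R" unfolding reaction_def[abs_def] R_def[abs_def] by (simp add: c_def)
  have mu: "mu d p = density lborel r" by (simp add: mu_def rho)
  have r_borel [measurable]: "r \<in> borel_measurable borel" by (rule borel_measurable_continuous_onI[OF r_cont])
  have mu_int: "integrable (mu d p) f \<longleftrightarrow> integrable lborel (\<lambda>x. r x * f x)"
    if "f \<in> borel_measurable borel" for f :: "real \<Rightarrow> real"
    unfolding mu using that r_pos by (subst integrable_density) (auto simp: less_imp_le)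
  obtain M \<phi> v where M: "0 < M" and S: "decaying_pair M \<phi> v" and pr: "profile \<phi> v"
    using profile_exists .
  have \<phi>': "(\<phi> has_real_derivative - v x / r x) (at x)" for x using pr by (simp add: profile_def)
  then have d\<phi>: "deriv \<phi> = (\<lambda>x. - v x / r x)" by (auto intro: DERIV_imp_deriv)
  have range: "0 < \<phi> x" "\<phi> x < 1" for x using pr by (auto simp: profile_def)
  have sm: "smooth_fun \<phi>" by (rule profile_smooth[OF pr])
  have sm_w: "smooth_fun (\<lambda>x. \<phi> x - \<eta> x)"
    using assms(4) by (intro smooth_fun_diff sm) (simp add: cutoff_fun_def)
  have "weak_solution d p \<phi>"
    unfolding weak_solution_def H1_loc_def drift reaction using profile_weak[OF pr] by blast
  moreover have "(\<lambda>x. \<phi> x - \<eta> x) \<in> H1_on (mu d p)"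
  proof (rule smooth_mem_H1_on[OF assms(4) _ sm_w])
    show "sets (mu d p) = sets borel" by (simp add: mu)
    have [measurable]: "(\<lambda>x. \<phi> x - \<eta> x) \<in> borel_measurable borel" "deriv (\<lambda>x. \<phi> x - \<eta> x) \<in> borel_measurable borel"
      using smooth_fun_borel sm_w smooth_fun_deriv by blast+
    show "integrable (mu d p) (\<lambda>x. (\<phi> x - \<eta> x)\<^sup>2)"
      by (subst mu_int) (use profile_weighted_integrable(1)[OF pr S assms(4)] in measurable)
    show "integrable (mu d p) (\<lambda>x. (deriv (\<lambda>x. \<phi> x - \<eta> x) x)\<^sup>2)"
      by (subst mu_int) (use profile_weighted_integrable(2)[OF pr S assms(4)] in measurable)
  qed
  ultimately have adm: "admissible_solution d p \<eta> \<phi>"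
    using range by (simp add: admissible_solution_def less_imp_le)
  have uniq: "AE \<zeta> in lborel. \<psi> \<zeta> = \<phi> \<zeta>" if \<psi>: "admissible_solution d p \<eta> \<psi>" for \<psi>
  proof -
    from \<psi> obtain g where g: "\<psi> \<in> L2_loc" "g \<in> L2_loc" "has_weak_deriv \<psi> g"
      "\<And>\<kappa>. test_fun \<kappa> \<Longrightarrow> - (LINT x|lborel. g x * deriv \<kappa> x) + (LINT x|lborel. (b x * g x + R (\<psi> x)) * \<kappa> x) = 0"
      unfolding admissible_solution_def weak_solution_def H1_loc_def drift reaction by blast
    have ae: "AE x in lborel. 0 \<le> \<psi> x \<and> \<psi> x \<le> 1" using \<psi> by (simp add: admissible_solution_def)
    from weak_solution_imp_flux_pair[OF assms(4) g(1-3) ae g(4)]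
    obtain u w where u: "AE x in lborel. \<psi> x = u x" "flux_pair u w" "\<And>x. 0 \<le> u x \<and> u x \<le> 1" by metis
    have [measurable]: "\<psi> \<in> borel_measurable borel" "u \<in> borel_measurable borel" "\<eta> \<in> borel_measurable borel"
      using g(1) assms(4) flux_pair_continuous(1)[OF u(2)]
      by (auto intro: L2_loc_borel borel_measurable_continuous_onI smooth_fun_borel simp: cutoff_fun_def)
    have "integrable (mu d p) (\<lambda>x. (\<psi> x - \<eta> x)\<^sup>2)"
      using \<psi> by (simp add: admissible_solution_def H1_on_def)
    then have "integrable lborel (\<lambda>x. r x * (\<psi> x - \<eta> x)\<^sup>2)" by (subst (asm) mu_int) measurable
    moreover have "(\<lambda>x. r x * (u x - \<eta> x)\<^sup>2) \<in> borel_measurable lborel" by measurable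
    moreover have "AE x in lborel. r x * (\<psi> x - \<eta> x)\<^sup>2 = r x * (u x - \<eta> x)\<^sup>2"
      using u(1) by eventually_elim simp
    ultimately have "integrable lborel (\<lambda>x. r x * (u x - \<eta> x)\<^sup>2)"
      by (rule integrable_cong_AE_imp)
    then have "(u \<longlongrightarrow> 1) at_bot" "(u \<longlongrightarrow> 0) at_top"
      using limits_of_weighted_integrable[OF u(2,3), of \<eta>] assms(4) by (auto simp: cutoff_fun_def)
    then have "u x = \<phi> x" for x by (rule flux_pair_unique[OF pr S u(2,3)])
    with u(1) show ?thesis by simp
  qed
  have "classical_solution d p \<phi>"
    unfolding classical_solution_def drift reaction d\<phi>
    using \<phi>' profile_slope_DERIV[OF pr] DERIV_imp_deriv[OF profile_slope_DERIV[OF pr]]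
    by (auto simp: field_differentiable_def)
  moreover have lim: "(\<phi> \<longlongrightarrow> 1) at_bot" "(\<phi> \<longlongrightarrow> 0) at_top"
    using profile_tendsto_1[OF pr] S by (auto simp: decaying_pair_def)
  moreover have "(deriv \<phi> \<longlongrightarrow> 0) at_bot" "(deriv \<phi> \<longlongrightarrow> 0) at_top"
    unfolding d\<phi> using bounded_div_r_tendsto_0[of "\<lambda>x. - v x" M] profile_v_bounds[OF pr S] by auto
  moreover have "\<exists>C>0. ((\<lambda>\<zeta>. \<phi> \<zeta> / exp (- exp (2 * \<zeta>) / 4 + ((5 - p) / (p - 1) - real d + 1) * \<zeta>)) \<longlongrightarrow> C) at_top"
  proof (intro exI conjI)
    have exponent: "(5 - p) / (p - 1) - real d + 1 = a - 2" using p1 by (simp add: a_def field_simps)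
    have "exp (- exp (2 * x) / 4 + ((5 - p) / (p - 1) - real d + 1) * x) = exp (- 2 * x) * (1 / r x)" for x
      unfolding exponent by (simp add: r_def left_diff_distrib flip: exp_add exp_minus inverse_eq_divide)
    then show "((\<lambda>\<zeta>. \<phi> \<zeta> / exp (- exp (2 * \<zeta>) / 4 + ((5 - p) / (p - 1) - real d + 1) * \<zeta>)) \<longlongrightarrow> 2 * M) at_top"
      using profile_asymptotics[OF S] by (simp only:)
  qed (use M in simp)
  ultimately show ?thesis
    using adm uniq sm range profile_antimono[OF pr] by blast
qed

end
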